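(* For every spherical tangle diagram $S$, either $\det F(S)\equiv0\pmod 4$ or $\det F(S)\equiv1\pmod 4$.
   Context: A spherical tangle is a properly embedded compact 1-submanifold $S$ of $H_0-\mathrm{Int}(H_1)\cong S^2\times[0,1]$, where $H_1$ is a closed 3-ball in the interior of a closed 3-ball $H_0$, whose boundary consists of four fixed points NW, NE, SW, SE in the projection plane on each of $\partial H_0$ and $\partial H_1$. It may have closed (circle) components. It is represented by diagrams. Kauffman bracket: let $A=e^{i\pi/4}$ and $\Phi=\{z\in\mathbb C:z^8=1\}$. At a crossing of a link diagram the two regions swept by rotating the over-strand counterclockwise are the $A$-regions, the other two the $B$-regions; $A$-type (resp. $B$-type) splitting opens a channel joining the two $A$-regions (resp. $B$-regions). A state $\sigma$ chooses a splitting at each crossing; $\alpha(\sigma),\beta(\sigma)$ are the numbers of $A$-type and $B$-type splittings and $d(\sigma)$ the number of resulting circles. $\langle L\rangle=\sum_{\sigma:\,d(\sigma)=1}A^{\alpha(\sigma)-\beta(\sigma)}$. Invariant: for $j,k\in\{1,2\}$ let $S_{jk}$ be the link diagram obtained from $S$ by filling the hole $H_1$ with two vertical arcs (NW to SW, NE to SE) if $k=1$, with two horizontal arcs (NW to NE, SW to SE) if $k=2$, and then joining the four outer endpoints outside $H_0$ without crossings: NW to NE and SW to SE if $j=1$ (numerator closure), NW to SW and NE to SE if $j=2$ (denominator closure). Then $$F(S)=\left\{z\begin{pmatrix}\langle S_{11}\rangle&-i\langle S_{12}\rangle\\ i\langle S_{21}\rangle&\langle S_{22}\rangle\end{pmatrix}:z\in\Phi\right\}\cap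 M_{2\times2}(\mathbb Z),$$ which is of the form $\{M,-M\}$, an element of $PM_{2\times2}(\mathbb Z)=M_{2\times2}(\mathbb Z)/\pm1$; $\det F(S):=\det M$ is well defined. *)

theory Defs
  imports "HOL-Analysis.Analysis" "HOL-Number_Theory.Cong"
begin

text \<open>
  Diagrams are encoded as combinatorial maps (rotation systems), in the spirit of planar diagram
  codes.  The four half-edges (darts) at a crossing are, in counterclockwise order,
  \<open>U1, O1, U2, O2\<close>; the under-strand is \<open>U1-U2\<close>, the over-strand is \<open>O1-O2\<close>.
  The darts \<open>End p\<close> are the ends of the diagram at the boundary points \<open>p\<close>.
\<close>

datatype strand_end = U1 | O1 | U2 | O2

datatype 'p dart = Cross nat strand_end | End 'p

text \<open>
  The crossings are numbered \<open>0, \<dots>, crossings D - 1\<close>, \<open>arcs D\<close> is the involution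
  exchanging the two darts of each edge, and \<open>loops D\<close> is the number of closed components
  without any crossing.  Neither the position of these loops nor the relative position of the
  connected components of the diagram is recorded; the number of circles of a state does not depend on them.
\<close>

record 'p diagram =
  crossings :: nat
  arcs :: "'p dart \<Rightarrow> 'p dart"
  loops :: nat

definition darts :: "('p, 'z) diagram_scheme \<Rightarrow> 'p dart set" where
  "darts D = {Cross c e | c e. c < crossings D} \<union> range End"

text \<open>
  For permutations of a finite set the reflexive transitive closure below is already symmetric,
  so these are the orbits of the group generated by \<open>fs\<close>.
\<close>

definition orbits :: "('a \<Rightarrow> 'a) set \<Rightarrow> 'a set \<Rightarrow> 'a set set" where
  "orbits fs X = (\<lambda>x. {y. (x, y) \<in> {(u, f u) | u f. f \<in> fs}\<^sup>*}) ` X"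


section \<open>Link diagrams and the Kauffman bracket\<close>

text \<open>
  In a link diagram the ends are joined in pairs \<open>p\<close>, \<open>joins L p\<close> by further arcs without
  crossings.
\<close>

record 'p link_diagram = "'p diagram" +
  joins :: "'p \<Rightarrow> 'p"

datatype splitting = A_type | B_type

text \<open>
  Rotated counterclockwise, the over-strand sweeps the regions between \<open>O1\<close> and \<open>U2\<close> and
  between \<open>O2\<close> and \<open>U1\<close>.  These are the A-regions; a channel between them leaves the
  arcs \<open>U1-O1\<close> and \<open>U2-O2\<close>.
\<close>

fun split_crossing :: "splitting \<Rightarrow> strand_end \<Rightarrow> strand_end" where
  "split_crossing A_type U1 = O1"
| "split_crossing A_type O1 = U1"
| "split_crossing A_type U2 = O2"
| "split_crossing A_type O2 = U2"
| "split_crossing B_type O1 = U2"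
| "split_crossing B_type U2 = O1"
| "split_crossing B_type O2 = U1"
| "split_crossing B_type U1 = O2"

definition states :: "'p link_diagram \<Rightarrow> (nat \<Rightarrow> splitting) set" where
  "states L = {..<crossings L} \<rightarrow>\<^sub>E UNIV"

fun reconnect :: "'p link_diagram \<Rightarrow> (nat \<Rightarrow> splitting) \<Rightarrow> 'p dart \<Rightarrow> 'p dart" where
  "reconnect L \<sigma> (Cross c e) = Cross c (split_crossing (\<sigma> c) e)"
| "reconnect L \<sigma> (End p) = End (joins L p)"

definition circles :: "'p link_diagram \<Rightarrow> (nat \<Rightarrow> splitting) \<Rightarrow> nat" where
  "circles L \<sigma> = card (orbits {arcs L, reconnect L \<sigma>} (darts L)) + loops L"

definition splittings :: "'p link_diagram \<Rightarrow> (nat \<Rightarrow> splitting) \<Rightarrow> splitting \<Rightarrow> nat" where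
  "splittings L \<sigma> s = card {c. c < crossings L \<and> \<sigma> c = s}"

definition bracket :: "'p link_diagram \<Rightarrow> complex" where
  "bracket L = (\<Sum>\<sigma> | \<sigma> \<in> states L \<and> circles L \<sigma> = 1.
     exp (\<i> * of_real pi / 4) powi (int (splittings L \<sigma> A_type) - int (splittings L \<sigma> B_type)))"


section \<open>Spherical tangle diagrams\<close>

datatype corner = NW | NE | SE | SW

datatype endpoint = Outer corner | Inner corner

type_synonym tangle = "endpoint diagram"

fun ccw_end :: "strand_end \<Rightarrow> strand_end" where
  "ccw_end U1 = O1"
| "ccw_end O1 = U2"
| "ccw_end U2 = O2"
| "ccw_end O2 = U1"

fun ccw_corner :: "corner \<Rightarrow> corner" where
  "ccw_corner NW = SW"
| "ccw_corner SW = SE"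
| "ccw_corner SE = NE"
| "ccw_corner NE = NW"

fun cw_corner :: "corner \<Rightarrow> corner" where
  "cw_corner NW = NE"
| "cw_corner NE = SE"
| "cw_corner SE = SW"
| "cw_corner SW = NW"

text \<open>
  The annulus between the two boundary circles becomes a sphere when each of them is collapsed to
  a point.  Around the point that replaces the outer circle the orientation of the
  sphere is opposite to the counterclockwise sense along this circle in the plane.
\<close>

fun rot :: "endpoint dart \<Rightarrow> endpoint dart" where
  "rot (Cross c e) = Cross c (ccw_end e)"
| "rot (End (Inner p)) = End (Inner (ccw_corner p))"
| "rot (End (Outer p)) = End (Outer (cw_corner p))"

text \<open>
  The last condition says that every connected component of the resulting map on
  a closed surface (vertices, edges, faces, components counted as orbits) has genus 0: it is the sum
  over all components of Euler's relation, and each summand on the left is at most 2.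
\<close>

definition spherical_tangle_diagram :: "tangle \<Rightarrow> bool" where
  "spherical_tangle_diagram S \<longleftrightarrow>
     (\<forall>x \<in> darts S. arcs S x \<in> darts S \<and> arcs S x \<noteq> x \<and> arcs S (arcs S x) = x) \<and>
     int (card (orbits {rot} (darts S))) - int (card (orbits {arcs S} (darts S)))
       + int (card (orbits {rot \<circ> arcs S} (darts S)))
     = 2 * int (card (orbits {rot, arcs S} (darts S)))"

fun vertical :: "corner \<Rightarrow> corner" where
  "vertical NW = SW"
| "vertical SW = NW"
| "vertical NE = SE"
| "vertical SE = NE"

fun horizontal :: "corner \<Rightarrow> corner" where
  "horizontal NW = NE"
| "horizontal NE = NW"
| "horizontal SW = SE"
| "horizontal SE = SW"

fun closing_arcs :: "2 \<Rightarrow> 2 \<Rightarrow> endpoint \<Rightarrow> endpoint" where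
  "closing_arcs j k (Outer p) = Outer (if j = 1 then horizontal p else vertical p)"
| "closing_arcs j k (Inner p) = Inner (if k = 1 then vertical p else horizontal p)"

definition closure_diagram :: "tangle \<Rightarrow> 2 \<Rightarrow> 2 \<Rightarrow> endpoint link_diagram" where
  "closure_diagram S j k =
     \<lparr>crossings = crossings S, arcs = arcs S, loops = loops S, joins = closing_arcs j k\<rparr>"

definition bracket_matrix :: "tangle \<Rightarrow> complex^2^2" where
  "bracket_matrix S = vector
     [vector [bracket (closure_diagram S 1 1), - \<i> * bracket (closure_diagram S 1 2)],
      vector [\<i> * bracket (closure_diagram S 2 1), bracket (closure_diagram S 2 2)]]"

definition invariant_F :: "tangle \<Rightarrow> (int^2^2) set" where
  "invariant_F S = {M. \<exists>z::complex. z ^ 8 = 1 \<and>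
     (\<forall>i j. of_int (M $ i $ j) = z * bracket_matrix S $ i $ j)}"

text \<open>
  The value is unspecified unless \<open>invariant_F S\<close> is nonempty and all its members have the same
  determinant.
\<close>

definition det_F :: "tangle \<Rightarrow> int" where
  "det_F S = (THE d. \<exists>M \<in> invariant_F S. d = det M)"

end

theory Submission
  imports Defs "HOL-Combinatorics.Cycles" "Jordan_Normal_Form.Determinant"
begin

text \<open>
  In fact the determinant is a perfect square.

  A diagram of genus 0 has a checkerboard colouring, that is, a 2-colouring of its darts which
  alternates along the arcs and around each vertex. It is respected by all splittings, so every
  state is a permutation of the darts of one colour, and the number of circles is the number of its
  cycles. Changing one splitting multiplies the permutation by a transposition. Hence the parity of
  the number of B-type splittings is the same in all states with one circle, and up to a common
  factor the entries of the matrix are integers.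

  A permutation matrix \<open>\<Pi>\<close> has one cycle iff the minor of \<open>1 - \<Pi>\<close> that omits one point is 1 (otherwise
  it is 0). Adding the two rows of a crossing gives a row that does not depend on the splitting, so
  that the determinant is linear in the splitting and the state sum is itself a determinant. The two
  closures at each hole only affect one row each, and the Pluecker relation writes the determinant of
  the four closures as a product of two state sums \<open>P P'\<close>. The terms of both sums vanish unless the
  state consists of four strands from the outer to the inner circle, and there they agree up to sign.
  In genus 0 such a state is a rotation by a fixed angle modulo a half turn, so the signs are constant
  and \<open>P' = \<plusminus> P\<close>.
\<close>

section \<open>Orbits of permutations\<close>

text \<open>The determinant multiplies brackets of different closures, that is, sums over
  independent pairs of states, so its terms cannot be compared one by one. The Pluecker relation
  removes this obstacle. Its four vectors are the two possible rows at the outer hole and the two at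
  the inner hole: one row from each hole gives a closure, both rows of the outer hole give
  \<open>P\<close>, both rows of the inner hole give \<open>P'\<close>. The same relation holds for
  every single state \<open>W\<close> and equates a term product \<open>u W * u' W\<close> with a
  difference of two products of 0/1 indicators. The colours of the NW ends decide which of these two
  products vanishes for all \<open>W\<close>. This fixes the sign in
  \<open>u' W = \<epsilon> * u W\<close> and, by the parity of the number of B-type splittings, also
  the power of \<open>- \<i>\<close> in front of the terms. The base \<open>- \<i>\<close> is the
  inverse of the square of \<open>A\<close>: with \<open>w\<close> B-type splittings the weight is
  \<open>A ^ n * (- \<i>) ^ w\<close>. Whenever \<open>\<epsilon> = -1\<close>, the exponent of
  \<open>- \<i>\<close> is shifted by 1 in both factors, and the two effects cancel. Hence the
  result is a square and not the negative of one.\<close>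

definition orb :: "('a \<Rightarrow> 'a) set \<Rightarrow> 'a \<Rightarrow> 'a set" where
  "orb fs x = {y. (x, y) \<in> {(u, f u) | u f. f \<in> fs}\<^sup>*}"

lemma orbits_orb: "orbits fs X = orb fs ` X"
  by (simp add: orbits_def orb_def)

lemma orb_refl [simp]: "x \<in> orb fs x"
  by (simp add: orb_def)

lemma orb_step: "y \<in> orb fs x \<Longrightarrow> f \<in> fs \<Longrightarrow> f y \<in> orb fs x"
  unfolding orb_def by (auto intro: rtrancl_into_rtrancl)

lemma orb_trans: "y \<in> orb fs x \<Longrightarrow> z \<in> orb fs y \<Longrightarrow> z \<in> orb fs x"
  unfolding orb_def by auto

lemma orb_induct [consumes 1, case_names base step]:
  assumes "y \<in> orb fs x" "P x"
    and "\<And>z f. z \<in> orb fs x \<Longrightarrow> P z \<Longrightarrow> f \<in> fs \<Longrightarrow> P (f z)"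
  shows "P y"
proof -
  have "(x, y) \<in> {(u, f u) | u f. f \<in> fs}\<^sup>*"
    using assms(1) by (simp add: orb_def)
  then have "P y \<and> y \<in> orb fs x"
    by (induction rule: rtrancl_induct) (use assms(2,3) in \<open>auto intro: orb_step\<close>)
  then show ?thesis ..
qed

lemma orb_subset:
  assumes "x \<in> A" "\<And>f z. f \<in> fs \<Longrightarrow> z \<in> A \<Longrightarrow> f z \<in> A"
  shows "orb fs x \<subseteq> A"
proof
  fix y assume "y \<in> orb fs x"
  then show "y \<in> A" by (induction rule: orb_induct) (use assms in auto)
qed

text \<open>Only the values on a closed set \<open>X\<close> matter, so a map may be replaced by one
  that agrees with it there, for instance by its extension with the identity.\<close>

lemma orb_cong:
  assumes "x \<in> X" "\<And>z. z \<in> X \<Longrightarrow> (\<lambda>f. f z) ` fs = (\<lambda>f. f z) ` gs"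
    "\<And>f z. f \<in> fs \<Longrightarrow> z \<in> X \<Longrightarrow> f z \<in> X"
  shows "orb fs x = orb gs x"
proof -
  have gs: "f z \<in> X" if "f \<in> gs" "z \<in> X" for f z
  proof -
    have "f z \<in> (\<lambda>f. f z) ` fs" unfolding assms(2)[OF that(2)] using that by blast
    then obtain h where "h \<in> fs" "f z = h z" by blast
    then show ?thesis using assms(3) that by simp
  qed
  have "orb fs x \<subseteq> orb gs x \<inter> X"
  proof (rule orb_subset)
    fix f z assume f: "f \<in> fs" and z: "z \<in> orb gs x \<inter> X"
    have "f z \<in> (\<lambda>f. f z) ` gs" using assms(2)[of z] z f by blast
    then obtain h where "h \<in> gs" "f z = h z" by blast
    then show "f z \<in> orb gs x \<inter> X" using z f assms(3)[of f z] by (auto intro: orb_step)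
  qed (use assms in auto)
  moreover have "orb gs x \<subseteq> orb fs x \<inter> X"
  proof (rule orb_subset)
    fix f z assume f: "f \<in> gs" and z: "z \<in> orb fs x \<inter> X"
    have "f z \<in> (\<lambda>f. f z) ` fs" using assms(2)[of z] z f by blast
    then obtain h where "h \<in> fs" "f z = h z" by blast
    then show "f z \<in> orb fs x \<inter> X" using z f gs[of f z] by (auto intro: orb_step)
  qed (use assms in auto)
  ultimately show ?thesis by blast
qed

lemma orbits_cong:
  assumes "\<And>z. z \<in> X \<Longrightarrow> (\<lambda>f. f z) ` fs = (\<lambda>f. f z) ` gs"
    "\<And>f z. f \<in> fs \<Longrightarrow> z \<in> X \<Longrightarrow> f z \<in> X"
  shows "orbits fs X = orbits gs X"
  unfolding orbits_orb by (rule image_cong[OF refl], rule orb_cong[where X = X]) (use assms in blast)+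

text \<open>Some positive power of \<open>f\<close> is the identity, and the power before it undoes
  one step. Thus forward reachability is symmetric.\<close>

lemma permutes_back_orb:
  assumes "f permutes X" "finite X"
  shows "x \<in> orb {f} (f x)"
proof -
  have "permutation f" using assms by (auto simp: permutation_permutes)
  then obtain n where n: "f ^^ n = id" "n > 0" using permutation_is_nilpotent by blast
  have "(f ^^ k) (f x) \<in> orb {f} (f x)" for k
    by (induction k) (auto intro: orb_step)
  moreover have "(f ^^ (n - 1)) (f x) = x"
    using n by (metis Suc_pred' comp_apply funpow_Suc_right id_apply)
  ultimately show ?thesis by metis
qed

lemma orb_superset: "gs \<subseteq> fs \<Longrightarrow> orb gs x \<subseteq> orb fs x"
  by (rule orb_subset) (auto intro: orb_step)

lemma orb_sym:
  assumes "\<And>f. f \<in> fs \<Longrightarrow> f permutes X" "finite X" "y \<in> orb fs x"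
  shows "x \<in> orb fs y"
  using assms(3)
proof (induction rule: orb_induct)
  case (step z f)
  have "z \<in> orb fs (f z)"
    using permutes_back_orb[OF assms(1)[OF step.hyps(2)] assms(2)] orb_superset[of "{f}" fs] step.hyps
    by blast
  then show ?case using step.IH orb_trans by metis
qed simp

lemma orb_eq:
  assumes "\<And>f. f \<in> fs \<Longrightarrow> f permutes X" "finite X" "y \<in> orb fs x"
  shows "orb fs y = orb fs x"
  using orb_sym[OF assms] assms(3) by (auto intro: orb_trans)

lemma orb_closed:
  assumes "\<And>f. f \<in> fs \<Longrightarrow> f permutes X" "x \<in> X"
  shows "orb fs x \<subseteq> X"
  by (rule orb_subset) (use assms permutes_in_image in \<open>auto simp: permutes_in_image\<close>)

lemma orbits_card_1:
  assumes "\<And>f. f \<in> fs \<Longrightarrow> f permutes X" "finite X"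
  shows "card (orbits fs X) = 1 \<longleftrightarrow> X \<noteq> {} \<and> (\<forall>x\<in>X. \<forall>y\<in>X. y \<in> orb fs x)"
proof
  assume "card (orbits fs X) = 1"
  then obtain O' where O: "orb fs ` X = {O'}" by (auto simp: orbits_orb card_1_singleton_iff)
  then show "X \<noteq> {} \<and> (\<forall>x\<in>X. \<forall>y\<in>X. y \<in> orb fs x)"
    by (metis image_empty insert_not_empty orb_refl imageI singletonD)
next
  assume r: "X \<noteq> {} \<and> (\<forall>x\<in>X. \<forall>y\<in>X. y \<in> orb fs x)"
  then obtain x where x: "x \<in> X" by auto
  have "orb fs y = orb fs x" if "y \<in> X" for y
  proof (rule orb_eq[where X = X])
    show "y \<in> orb fs x" using r x that by blast
  qed (use assms in blast)+
  then have "orb fs ` X = {orb fs x}" using x by blast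
  then show "card (orbits fs X) = 1" by (simp add: orbits_orb)
qed

text \<open>For the least \<open>k\<close> with \<open>(a ^^ k) x = y\<close>, the arc
  \<open>a x, ..., (a ^^ k) x\<close> misses \<open>x\<close>. The new map sends its last point
  \<open>y\<close> back to \<open>a x\<close>, so the arc has become closed.\<close>

lemma orb_singleton_transpose_same:
  fixes a :: "'a \<Rightarrow> 'a"
  assumes a: "a permutes X" "finite X" and xy: "x \<noteq> y" "y \<in> orb {a} x"
  shows "y \<notin> orb {a \<circ> Transposition.transpose x y} x"
proof -
  let ?a = "a \<circ> Transposition.transpose x y"
  have "\<exists>k. (a ^^ k) x = y"
    using xy(2)
  proof (induction rule: orb_induct)
    case base show ?case by (rule exI[of _ 0]) simp
  next
    case (step z f)
    then obtain k where "(a ^^ k) x = z" by blast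
    then show ?case using step by (intro exI[of _ "Suc k"]) simp
  qed
  then obtain k where k: "(a ^^ k) x = y" "\<And>j. j < k \<Longrightarrow> (a ^^ j) x \<noteq> y"
    using exists_least_iff[of "\<lambda>k. (a ^^ k) x = y"] by blast
  define K where "K = (\<lambda>j. (a ^^ j) x) ` {0<..k}"
  have k0: "k > 0" using k xy by (cases k) auto
  have nx: "x \<notin> K"
  proof
    assume "x \<in> K"
    then obtain j where j: "0 < j" "j \<le> k" "(a ^^ j) x = x" by (auto simp: K_def)
    have "(a ^^ (k - j)) x = (a ^^ (k - j)) ((a ^^ j) x)" by (simp add: j)
    also have "\<dots> = (a ^^ (k - j + j)) x" by (simp only: funpow_add comp_apply)
    also have "\<dots> = (a ^^ k) x" using j by simp
    finally show False using k j by simp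
  qed
  have ax: "a x \<in> K" unfolding K_def by (rule image_eqI[of _ _ 1]) (use k0 in auto)
  have yK: "y \<in> K" using k k0 by (auto simp: K_def)
  have "orb {?a} y \<subseteq> K"
  proof (rule orb_subset)
    fix f z assume "f \<in> {?a}" and z: "z \<in> K"
    then have f: "f = ?a" by simp
    show "f z \<in> K"
    proof (cases "z = y")
      case True then show ?thesis using ax f by simp
    next
      case False
      with z obtain j where j: "0 < j" "j < k" "z = (a ^^ j) x"
        unfolding K_def using k by (auto simp: order_le_less)
      have "z \<noteq> x" using z nx by auto
      then have "f z = (a ^^ Suc j) x" using False f j by simp
      then show ?thesis unfolding K_def using j by (intro image_eqI[of _ _ "Suc j"]) auto
    qed
  qed (rule yK)
  then have "x \<notin> orb {?a} y" using nx by blast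
  moreover have "?a permutes X"
  proof -
    have "x \<in> X \<and> y \<in> X"
    proof (rule ccontr)
      assume n: "\<not> (x \<in> X \<and> y \<in> X)"
      have "x \<in> X"
      proof (rule ccontr)
        assume "x \<notin> X"
        then have "a x = x" using a by (simp add: permutes_def)
        then have "orb {a} x \<subseteq> {x}" by (intro orb_subset) auto
        then show False using xy by auto
      qed
      moreover have "orb {a} x \<subseteq> X" by (rule orb_closed) (use a calculation in auto)
      ultimately show False using n xy by auto
    qed
    then show ?thesis using a by (intro permutes_compose permutes_swap_id) auto
  qed
  ultimately show ?thesis using orb_sym[of "{?a}" X y x] a by blast
qed

text \<open>The new map leaves \<open>y\<close> along the old cycle of \<open>x\<close> and leaves
  \<open>x\<close> along the old cycle of \<open>y\<close>, so the two cycles are run through one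
  after the other.\<close>

lemma orbits_transpose_merge:
  fixes a :: "'a \<Rightarrow> 'a"
  assumes a: "a permutes X" "finite X" and xy: "x \<in> X" "y \<in> X" "y \<notin> orb {a} x"
  shows "card (orbits {a \<circ> Transposition.transpose x y} X) + 1 = card (orbits {a} X)"
proof -
  let ?a = "a \<circ> Transposition.transpose x y"
  have xney: "x \<noteq> y" using xy by auto
  have a': "?a permutes X" using a xy by (intro permutes_compose permutes_swap_id)
  have pa: "f permutes X" if "f \<in> {a}" for f using that a by simp
  have pa': "f permutes X" if "f \<in> {?a}" for f using that a' by simp
  have dis: "orb {a} x \<inter> orb {a} y = {}"
    using xy(3) orb_sym[of "{a}" X] orb_trans[of _ "{a}"] pa a(2) by (metis disjoint_iff)
  have 1: "orb {a} x \<subseteq> orb {?a} y"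
  proof -
    have "orb {a} (a x) \<subseteq> orb {?a} y \<inter> orb {a} x"
    proof (rule orb_subset)
      show "a x \<in> orb {?a} y \<inter> orb {a} x"
        using orb_step[of y "{?a}" y ?a] by (auto intro: orb_step)
      fix f z assume f: "f \<in> {a}" and z: "z \<in> orb {?a} y \<inter> orb {a} x"
      have "z \<noteq> y" using z xy by auto
      moreover have "a x \<in> orb {?a} y" using orb_step[of y "{?a}" y ?a] by simp
      ultimately have "a z \<in> orb {?a} y"
        using z orb_step[of z "{?a}" y ?a] by (cases "z = x") auto
      then show "f z \<in> orb {?a} y \<inter> orb {a} x" using f z by (auto intro: orb_step)
    qed
    moreover have "orb {a} (a x) = orb {a} x"
      by (rule orb_eq[OF pa a(2)]) (auto intro: orb_step)
    ultimately show ?thesis by auto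
  qed
  have 2: "orb {a} y \<subseteq> orb {?a} x"
  proof -
    have "orb {a} (a y) \<subseteq> orb {?a} x \<inter> orb {a} y"
    proof (rule orb_subset)
      show "a y \<in> orb {?a} x \<inter> orb {a} y"
        using orb_step[of x "{?a}" x ?a] by (auto intro: orb_step)
      fix f z assume f: "f \<in> {a}" and z: "z \<in> orb {?a} x \<inter> orb {a} y"
      have "z \<noteq> x" using z dis orb_refl by fastforce
      moreover have "a y \<in> orb {?a} x" using orb_step[of x "{?a}" x ?a] by simp
      ultimately have "a z \<in> orb {?a} x"
        using z orb_step[of z "{?a}" x ?a] by (cases "z = y") auto
      then show "f z \<in> orb {?a} x \<inter> orb {a} y" using f z by (auto intro: orb_step)
    qed
    moreover have "orb {a} (a y) = orb {a} y"
      by (rule orb_eq[OF pa a(2)]) (auto intro: orb_step)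
    ultimately show ?thesis by auto
  qed
  have "x \<in> orb {?a} y" by (rule subsetD[OF 1 orb_refl])
  then have xy': "orb {?a} x = orb {?a} y"
    by (intro orb_eq[where X = X]) (use pa' a in auto)
  have U: "orb {?a} x = orb {a} x \<union> orb {a} y"
  proof
    show "orb {?a} x \<subseteq> orb {a} x \<union> orb {a} y"
    proof (rule orb_subset)
      fix f z assume f: "f \<in> {?a}" and z: "z \<in> orb {a} x \<union> orb {a} y"
      have "Transposition.transpose x y z \<in> orb {a} x \<union> orb {a} y"
        using z by (auto simp: Transposition.transpose_def)
      then show "f z \<in> orb {a} x \<union> orb {a} y" using f by (auto intro: orb_step)
    qed auto
  qed (use 1 2 xy' in auto)
  have same: "orb {?a} z = orb {a} z" if z: "z \<in> X" "z \<notin> orb {a} x" "z \<notin> orb {a} y" for z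
  proof (rule sym, rule orb_cong[where X = "orb {a} z"])
    fix w assume w: "w \<in> orb {a} z"
    have "w \<noteq> x" "w \<noteq> y" using w z orb_sym[OF pa a(2)] by blast+
    then show "(\<lambda>f. f w) ` {a} = (\<lambda>f. f w) ` {?a}" by simp
  qed (auto intro: orb_step)
  let ?Z = "X - orb {a} x - orb {a} y"
  have sub: "orb {a} x \<subseteq> X" "orb {a} y \<subseteq> X"
    by (rule orb_closed; use pa xy in blast)+
  have e: "orb {a} z = orb {a} x" if "z \<in> orb {a} x" for z x
    by (rule orb_eq[OF pa a(2) that])
  have e': "orb {?a} z = orb {?a} x" if "z \<in> orb {?a} x" for z x
    by (rule orb_eq[OF pa' a(2) that])
  have XX: "X = ?Z \<union> orb {a} x \<union> orb {a} y" using sub by auto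
  have im: "f ` X = f ` ?Z \<union> f ` orb {a} x \<union> f ` orb {a} y" for f :: "'a \<Rightarrow> 'a set"
    by (subst XX) (simp only: image_Un)
  have "orb {a} ` orb {a} z = {orb {a} z}" for z
    using e[of _ z] orb_refl[of z "{a}"] by blast
  then have A: "orbits {a} X = insert (orb {a} x) (insert (orb {a} y) (orb {a} ` ?Z))"
    unfolding orbits_orb im by auto
  have "orb {?a} ` (orb {a} x \<union> orb {a} y) = {orb {?a} x}"
    unfolding U[symmetric] using e'[of _ x] orb_refl[of x "{?a}"] by blast
  moreover have "orb {?a} ` ?Z = orb {a} ` ?Z" using same by (intro image_cong) auto
  ultimately have B: "orbits {?a} X = insert (orb {?a} x) (orb {a} ` ?Z)"
    unfolding orbits_orb im by (simp add: image_Un Un_assoc)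
  have nz: "z \<in> O'" if "O' = orb {b} z" for z O' and b :: "'a \<Rightarrow> 'a"
    using that by simp
  have nx: "orb {a} x \<notin> insert (orb {a} y) (orb {a} ` ?Z)"
    using xy nz[of "orb {a} x" a] by blast
  have ny: "orb {a} y \<notin> orb {a} ` ?Z"
    using nz[of "orb {a} y" a] by blast
  have nx': "orb {?a} x \<notin> orb {a} ` ?Z"
    unfolding U using nz[of "orb {a} x \<union> orb {a} y" a] by blast
  have fin: "finite ?Z" using a by auto
  show ?thesis unfolding A B using nx ny nx' fin by (simp add: card_insert_if)
qed

text \<open>Multiplying by the same transposition again restores \<open>a\<close>, so this is the
  merging count read backwards.\<close>

lemma orbits_transpose_split:
  fixes a :: "'a \<Rightarrow> 'a"
  assumes a: "a permutes X" "finite X" and xy: "x \<in> X" "y \<in> X" "x \<noteq> y" "y \<in> orb {a} x"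
  shows "card (orbits {a \<circ> Transposition.transpose x y} X) = card (orbits {a} X) + 1"
proof -
  let ?a = "a \<circ> Transposition.transpose x y"
  have "?a permutes X" using a xy by (intro permutes_compose permutes_swap_id)
  moreover have "y \<notin> orb {?a} x" by (rule orb_singleton_transpose_same) (use assms in auto)
  moreover have "?a \<circ> Transposition.transpose x y = a" by (auto simp: fun_eq_iff)
  ultimately show ?thesis
    using orbits_transpose_merge[of ?a X x y] assms by simp
qed

section \<open>The genus of a pair of permutations\<close>

text \<open>Vertices, edges and faces are the cycles of \<open>a\<close>, \<open>b\<close> and
  \<open>a \<circ> b\<close>. If \<open>b\<close> is a fixed point free involution,
  \<open>card X\<close> is twice the number of edges and the value is twice the sum of the genera of
  the components. For other \<open>b\<close> it is the analogue for hypermaps.\<close>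

definition genus :: "'a set \<Rightarrow> ('a \<Rightarrow> 'a) \<Rightarrow> ('a \<Rightarrow> 'a) \<Rightarrow> int" where
  "genus X a b = 2 * int (card (orbits {a, b} X)) + int (card X) - int (card (orbits {a} X))
     - int (card (orbits {b} X)) - int (card (orbits {a \<circ> b} X))"

lemma orb_funpow:
  assumes "y \<in> orb {f} x"
  shows "\<exists>k. y = (f ^^ k) x"
  using assms
proof (induction rule: orb_induct)
  case base show ?case by (rule exI[of _ 0]) simp
next
  case (step z g)
  then obtain k where "z = (f ^^ k) x" by blast
  then show ?case using step by (intro exI[of _ "Suc k"]) simp
qed

text \<open>Conjugation by \<open>b\<close> moves the transposition to the right, so that a change
  of \<open>a\<close> acts on \<open>a \<circ> b\<close> as a transposition in the form needed for
  counting cycles.\<close>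

lemma transpose_comp_permutes:
  assumes "b permutes X"
  shows "Transposition.transpose x y \<circ> b = b \<circ> Transposition.transpose (inv_into UNIV b x) (inv_into UNIV b y)"
proof
  fix z
  have b: "b (inv_into UNIV b w) = w" "b z = w \<longleftrightarrow> z = inv_into UNIV b w" for w
    using permutes_inverses[OF assms] by metis+
  show "(Transposition.transpose x y \<circ> b) z = (b \<circ> Transposition.transpose (inv_into UNIV b x) (inv_into UNIV b y)) z"
    by (simp add: Transposition.transpose_def b)
qed

lemma transpose_permutes_compose:
  "a permutes X \<Longrightarrow> x \<in> X \<Longrightarrow> y \<in> X \<Longrightarrow> a \<circ> Transposition.transpose x y permutes X"
  by (intro permutes_compose permutes_swap_id)

text \<open>Orbits that avoid \<open>x\<close> and \<open>y\<close> are unaffected. The single old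
  orbit through both points gives way to at most two new ones, and to one if they are still
  connected.\<close>

lemma orbits_pair_transpose:
  assumes a: "a permutes X" "b permutes X" "finite X" and xy: "x \<in> X" "y \<in> X" "y \<in> orb {a} x"
  defines "a' \<equiv> a \<circ> Transposition.transpose x y"
  shows "card (orbits {a', b} X) \<le> card (orbits {a, b} X) + (if y \<in> orb {a', b} x then 0 else 1)"
proof -
  let ?P = "orbits {a, b} X" and ?P' = "orbits {a', b} X"
  have a': "a' permutes X" unfolding a'_def using a xy by (intro transpose_permutes_compose)
  have p: "f permutes X" if "f \<in> {a, b}" for f using that a by auto
  have p': "f permutes X" if "f \<in> {a', b}" for f using that a a' by auto
  have xyo: "y \<in> orb {a, b} x" using xy(3) orb_superset[of "{a}" "{a, b}"] by blast
  have sub: "?P' - {orb {a', b} x, orb {a', b} y} \<subseteq> ?P - {orb {a, b} x}"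
  proof
    fix O' assume "O' \<in> ?P' - {orb {a', b} x, orb {a', b} y}"
    then obtain z where z: "z \<in> X" "O' = orb {a', b} z" "O' \<noteq> orb {a', b} x" "O' \<noteq> orb {a', b} y"
      by (auto simp: orbits_orb)
    have n: "x \<notin> orb {a', b} z" "y \<notin> orb {a', b} z"
      using z orb_eq[of "{a', b}" X, OF p' a(3)] by metis+
    have e: "orb {a', b} z = orb {a, b} z"
    proof (rule orb_cong[where X = "orb {a', b} z"])
      fix w assume "w \<in> orb {a', b} z"
      then have "w \<noteq> x" "w \<noteq> y" using n by blast+
      then show "(\<lambda>f. f w) ` {a', b} = (\<lambda>f. f w) ` {a, b}" by (simp add: a'_def)
    qed (auto intro: orb_step)
    have "orb {a, b} z \<noteq> orb {a, b} x" using n e by (metis orb_refl)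
    then show "O' \<in> ?P - {orb {a, b} x}" using z e by (auto simp: orbits_orb)
  qed
  have fin: "finite ?P" "finite ?P'" using a by (auto simp: orbits_orb)
  have "card ?P' \<le> card (?P' - {orb {a', b} x, orb {a', b} y}) + card {orb {a', b} x, orb {a', b} y}"
    using diff_card_le_card_Diff[of "{orb {a', b} x, orb {a', b} y}" ?P'] by simp
  also have "card (?P' - {orb {a', b} x, orb {a', b} y}) \<le> card (?P - {orb {a, b} x})"
    by (rule card_mono) (use fin sub in auto)
  also have "card (?P - {orb {a, b} x}) = card ?P - 1"
    using xy by (intro card_Diff_singleton) (auto simp: orbits_orb)
  finally have 1: "card ?P' \<le> card ?P - 1 + card {orb {a', b} x, orb {a', b} y}" by simp
  have 2: "card ?P > 0" using fin xy by (auto simp: card_gt_0_iff orbits_orb)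
  have "card {orb {a', b} x, orb {a', b} y} \<le> 1 + (if y \<in> orb {a', b} x then 0 else 1)"
  proof (cases "y \<in> orb {a', b} x")
    case True
    then have "orb {a', b} y = orb {a', b} x"
      by (intro orb_eq[where X = X]) (use a a' in blast)+
    then have "{orb {a', b} x, orb {a', b} y} = {orb {a', b} x}" by blast
    then show ?thesis by simp
  qed (simp add: card_insert_if)
  then show ?thesis using 1 2 by (simp split: if_splits)
qed

lemma orbits_product_transpose:
  assumes a: "a permutes X" "b permutes X" "finite X" and xy: "x \<in> X" "y \<in> X" "x \<noteq> y"
  defines "a' \<equiv> a \<circ> Transposition.transpose x y"
  shows "inv_into UNIV b y \<in> orb {a' \<circ> b} (inv_into UNIV b x) \<Longrightarrow>
      card (orbits {a \<circ> b} X) = card (orbits {a' \<circ> b} X) + 1"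
    and "inv_into UNIV b y \<notin> orb {a' \<circ> b} (inv_into UNIV b x) \<Longrightarrow>
      card (orbits {a' \<circ> b} X) = card (orbits {a \<circ> b} X) + 1"
proof -
  let ?u = "inv_into UNIV b x" and ?v = "inv_into UNIV b y"
  have a': "a' permutes X" unfolding a'_def using a xy by (intro transpose_permutes_compose)
  have ab: "a' \<circ> b permutes X" using a a' by (intro permutes_compose)
  have ib: "inv_into UNIV b permutes X" using a by (intro permutes_inv)
  have uv: "?u \<in> X" "?v \<in> X" "?u \<noteq> ?v"
    using xy permutes_in_image[OF ib] permutes_inj[OF ib] by (auto simp: inj_eq)
  have "a' \<circ> b = a \<circ> b \<circ> Transposition.transpose ?u ?v"
    unfolding a'_def comp_assoc transpose_comp_permutes[OF a(2)] ..
  then have e: "a \<circ> b = a' \<circ> b \<circ> Transposition.transpose ?u ?v"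
    by (simp add: comp_assoc)
  show "?v \<in> orb {a' \<circ> b} ?u \<Longrightarrow> card (orbits {a \<circ> b} X) = card (orbits {a' \<circ> b} X) + 1"
    unfolding e using orbits_transpose_split[OF ab a(3) uv] by simp
  show "?v \<notin> orb {a' \<circ> b} ?u \<Longrightarrow> card (orbits {a' \<circ> b} X) = card (orbits {a \<circ> b} X) + 1"
    unfolding e using orbits_transpose_merge[OF ab a(3) uv(1,2)] by simp
qed

lemma orb_product_inv:
  assumes a: "a permutes X" "b permutes X" "finite X" and xy: "inv_into UNIV b y \<in> orb {a \<circ> b} (inv_into UNIV b x)"
  shows "y \<in> orb {a, b} x"
proof -
  have p: "f permutes X" if "f \<in> {a, b}" for f using that a by auto
  have b: "b (inv_into UNIV b w) = w" for w using permutes_inverses[OF a(2)] by metis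
  have "orb {a \<circ> b} (inv_into UNIV b x) \<subseteq> orb {a, b} (inv_into UNIV b x)"
  proof (rule orb_subset)
    fix f z assume f: "f \<in> {a \<circ> b}" and z: "z \<in> orb {a, b} (inv_into UNIV b x)"
    have "b z \<in> orb {a, b} (inv_into UNIV b x)" using z by (auto intro: orb_step)
    then have "a (b z) \<in> orb {a, b} (inv_into UNIV b x)" by (auto intro: orb_step)
    then show "f z \<in> orb {a, b} (inv_into UNIV b x)" using f by simp
  qed simp
  then have "b (inv_into UNIV b y) \<in> orb {a, b} (inv_into UNIV b x)" using xy by (auto intro: orb_step)
  moreover have "b (inv_into UNIV b x) \<in> orb {a, b} (inv_into UNIV b x)" by (rule orb_step) auto
  then have "inv_into UNIV b x \<in> orb {a, b} x" using orb_sym[of "{a, b}" X, OF p a(3)] b by metis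
  ultimately show ?thesis using b orb_trans by metis
qed

text \<open>There is one vertex more. If the number of faces drops by 1, then \<open>x\<close> and
  \<open>y\<close> remain connected through a face and no component is added. If it rises by 1,
  vertices and faces together pay for at most one new component.\<close>

lemma genus_split_le:
  assumes "a permutes X" "b permutes X" "finite X"
    and "x \<in> X" "y \<in> X" "x \<noteq> y" "y \<in> orb {a} x"
  shows "genus X (a \<circ> Transposition.transpose x y) b \<le> genus X a b"
proof -
  let ?a = "a \<circ> Transposition.transpose x y"
  have a': "?a permutes X" using assms by (intro transpose_permutes_compose)
  have V: "card (orbits {?a} X) = card (orbits {a} X) + 1"
    by (rule orbits_transpose_split) (use assms in auto)
  have C: "card (orbits {?a, b} X) \<le> card (orbits {a, b} X) + (if y \<in> orb {?a, b} x then 0 else 1)"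
    by (rule orbits_pair_transpose) (use assms in auto)
  show ?thesis
  proof (cases "inv_into UNIV b y \<in> orb {?a \<circ> b} (inv_into UNIV b x)")
    case True
    then have "y \<in> orb {?a, b} x" using orb_product_inv[OF a' assms(2,3)] by blast
    moreover have "card (orbits {a \<circ> b} X) = card (orbits {?a \<circ> b} X) + 1"
      using orbits_product_transpose(1)[of a X b x y] True assms by blast
    ultimately show ?thesis using C V unfolding genus_def by simp
  next
    case False
    then have "card (orbits {?a \<circ> b} X) = card (orbits {a \<circ> b} X) + 1"
      using orbits_product_transpose(2)[of a X b x y] assms by blast
    then show ?thesis using C V unfolding genus_def by (simp split: if_splits)
  qed
qed

lemma card_orbits_le: "finite X \<Longrightarrow> card (orbits fs X) \<le> card X"
  unfolding orbits_orb by (rule card_image_le)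

text \<open>Splitting vertices never raises the value and ends with \<open>a = id\<close>, where it
  is 0.\<close>

lemma genus_nonneg:
  assumes "a permutes X" "b permutes X" "finite X"
  shows "genus X a b \<ge> 0"
  using assms(1)
proof (induction "card X - card (orbits {a} X)" arbitrary: a rule: less_induct)
  case less
  show ?case
  proof (cases "\<exists>x\<in>X. a x \<noteq> x")
    case True
    then obtain x where x: "x \<in> X" "a x \<noteq> x" by blast
    let ?a = "a \<circ> Transposition.transpose x (a x)"
    have ax: "a x \<in> X" "a x \<in> orb {a} x"
      using x permutes_in_image[OF less.prems] by (auto intro: orb_step)
    have a': "?a permutes X" using x ax less.prems by (intro transpose_permutes_compose)
    have "card (orbits {?a} X) = card (orbits {a} X) + 1"
      by (rule orbits_transpose_split) (use x ax assms less.prems in auto)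
    moreover have "card (orbits {?a} X) \<le> card X" by (rule card_orbits_le) (rule assms)
    ultimately have "genus X ?a b \<ge> 0" by (intro less.hyps a') linarith
    moreover have "genus X ?a b \<le> genus X a b"
      by (rule genus_split_le) (use x ax assms less.prems in auto)
    ultimately show ?thesis by simp
  next
    case False
    then have [simp]: "a = id" using less.prems by (auto simp: fun_eq_iff permutes_def)
    have "orb {id} x = {x}" for x :: 'a
      using orb_subset[of x "{x}" "{id}"] orb_refl[of x "{id}"] by auto
    then have "card (orbits {id} X) = card X" unfolding orbits_orb by (simp add: card_image)
    moreover have "orb {id, b} x = orb {b} x" for x
      by (intro antisym orb_superset orb_subset) (auto intro: orb_step)
    then have "orbits {id, b} X = orbits {b} X" unfolding orbits_orb by simp
    ultimately show ?thesis by (simp add: genus_def)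
  qed
qed

text \<open>If splitting a vertex of a map of genus 0 does not disconnect it, the two corners that are
  joined by the splitting belong to the same face afterwards.\<close>

lemma genus_0_split_face:
  assumes "a permutes X" "b permutes X" "finite X"
    and "x \<in> X" "y \<in> X" "x \<noteq> y" "y \<in> orb {a} x" and g: "genus X a b = 0"
  defines "a' \<equiv> a \<circ> Transposition.transpose x y"
  assumes con: "y \<in> orb {a', b} x"
  shows "inv_into UNIV b y \<in> orb {a' \<circ> b} (inv_into UNIV b x)"
proof (rule ccontr)
  assume "inv_into UNIV b y \<notin> orb {a' \<circ> b} (inv_into UNIV b x)"
  then have "card (orbits {a' \<circ> b} X) = card (orbits {a \<circ> b} X) + 1"
    using orbits_product_transpose(2)[of a X b x y] assms(1-6) unfolding a'_def by blast
  moreover have "card (orbits {a'} X) = card (orbits {a} X) + 1"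
    unfolding a'_def by (rule orbits_transpose_split) (use assms in auto)
  moreover have "card (orbits {a', b} X) \<le> card (orbits {a, b} X)"
    using orbits_pair_transpose[of a X b x y] con assms(1-7) unfolding a'_def by auto
  moreover have "genus X a' b \<ge> 0"
    unfolding a'_def by (intro genus_nonneg transpose_permutes_compose) (use assms in auto)
  ultimately show False using g unfolding genus_def by linarith
qed

section \<open>Checkerboard colourings\<close>

text \<open>Conjugation by \<open>b\<close> inverts \<open>a \<circ> b\<close>. An equation
  \<open>b x = ((a \<circ> b) ^^ k) x\<close> can therefore be pulled back to the midpoint
  \<open>y\<close> of the path, where \<open>b\<close> fixes \<open>y\<close> (\<open>k\<close>
  even) or \<open>a\<close> fixes \<open>b y\<close> (\<open>k\<close> odd).\<close>

lemma involutions_product_orb: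
  assumes p: "a permutes X" "b permutes X" "finite X"
    and inv: "\<And>x. x \<in> X \<Longrightarrow> a (a x) = x" "\<And>x. x \<in> X \<Longrightarrow> b (b x) = x"
    and fpf: "\<And>x. x \<in> X \<Longrightarrow> a x \<noteq> x" "\<And>x. x \<in> X \<Longrightarrow> b x \<noteq> x" and x: "x \<in> X"
  shows "b x \<notin> orb {a \<circ> b} x"
proof
  let ?f = "a \<circ> b"
  have aX: "a z \<in> X" and bX: "b z \<in> X" if "z \<in> X" for z
    using that permutes_in_image[OF p(1)] permutes_in_image[OF p(2)] by simp_all
  have fX: "(?f ^^ k) z \<in> X" if "z \<in> X" for k z
    by (induction k) (use that aX bX in auto)
  have inj: "inj (?f ^^ k)" for k
    using p by (intro inj_fn inj_compose permutes_inj)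
  have r: "(?f ^^ k) (b ((?f ^^ k) z)) = b z" if z: "z \<in> X" for k z
  proof (induction k)
    case (Suc k)
    let ?w = "(?f ^^ k) z"
    have w: "?w \<in> X" using z fX by blast
    have e: "?f (b (?f ?w)) = b ?w" using w aX bX inv by simp
    have e1: "(?f ^^ Suc k) u = (?f ^^ k) (?f u)" for u
      by (simp only: funpow_Suc_right) (simp only: comp_apply)
    have e2: "(?f ^^ Suc k) z = ?f ?w" by simp
    show ?case by (subst e2, subst e1, subst e, rule Suc)
  qed simp
  assume "b x \<in> orb {?f} x"
  then obtain k where k: "b x = (?f ^^ k) x" using orb_funpow by metis
  define j where "j = k div 2"
  define y where "y = (?f ^^ j) x"
  have y: "y \<in> X" unfolding y_def using fX x by blast
  have ry: "b x = (?f ^^ j) (b y)" unfolding y_def using r[OF x] by simp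
  consider "k = j + j" | "k = j + Suc j" unfolding j_def by linarith
  then show False
  proof cases
    case 1
    then have "(?f ^^ j) y = (?f ^^ j) (b y)" using k ry by (simp add: y_def funpow_add)
    then show False using inj[of j] fpf(2)[OF y] by (metis injD)
  next
    case 2
    have "b x = (?f ^^ j) ((?f ^^ Suc j) x)"
      using k unfolding 2 by (simp only: funpow_add) (simp only: comp_apply)
    moreover have "(?f ^^ Suc j) x = ?f y" by (simp add: y_def)
    ultimately have "(?f ^^ j) (?f y) = (?f ^^ j) (b y)" using ry by (simp only:)
    then have "a (b y) = b y" using inj[of j] by (metis injD comp_apply)
    then show False using fpf(1)[OF bX[OF y]] by blast
  qed
qed

text \<open>Each orbit of both involutions consists of two cycles of \<open>a \<circ> b\<close>,
  which \<open>a\<close> and \<open>b\<close> interchange. The colour records whether a point lies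
  in the cycle that contains a chosen point of its orbit.\<close>

lemma involutions_colouring:
  assumes p: "a permutes X" "b permutes X" "finite X"
    and inv: "\<And>x. x \<in> X \<Longrightarrow> a (a x) = x" "\<And>x. x \<in> X \<Longrightarrow> b (b x) = x"
    and fpf: "\<And>x. x \<in> X \<Longrightarrow> a x \<noteq> x" "\<And>x. x \<in> X \<Longrightarrow> b x \<noteq> x"
  shows "\<exists>c. \<forall>x\<in>X. c (a x) \<noteq> c x \<and> c (b x) \<noteq> (c x :: bool)"
proof -
  let ?f = "a \<circ> b"
  have f: "?f permutes X" using p by (intro permutes_compose)
  have pf: "g permutes X" if "g \<in> {?f}" for g using that f by auto
  have pab: "g permutes X" if "g \<in> {a, b}" for g using that p by auto
  have aX: "a z \<in> X" and bX: "b z \<in> X" if "z \<in> X" for z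
    using that permutes_in_image[OF p(1)] permutes_in_image[OF p(2)] by simp_all
  \<comment> \<open>The choice depends on the orbit only as a set, so all points of an orbit share
    it.\<close>
  define r where "r x = (SOME z. z \<in> orb {a, b} x)" for x
  define c where "c x \<longleftrightarrow> r x \<in> orb {?f} x" for x
  have fa: "a x \<in> orb {?f} (b x)" if "x \<in> X" for x
    using orb_step[of "b x" "{?f}" "b x" ?f] that inv by simp
  have two: "orb {a, b} x \<subseteq> orb {?f} x \<union> orb {?f} (b x)" if x: "x \<in> X" for x
  proof -
    have "orb {a, b} x \<subseteq> X \<inter> (orb {?f} x \<union> orb {?f} (b x))"
    proof (rule orb_subset)
      fix g z assume g: "g \<in> {a, b}" and z: "z \<in> X \<inter> (orb {?f} x \<union> orb {?f} (b x))"
      have bz: "b z \<in> orb {?f} (b w)" if "z \<in> orb {?f} w" "w \<in> X" for w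
      proof -
        have "b z \<in> orb {?f} (b w) \<and> z \<in> X" using that(1)
        proof (induction rule: orb_induct)
          case (step u g)
          then have "?f (b (?f u)) = b u" using aX bX inv by simp
          then have "b (?f u) \<in> orb {?f} (b u)"
            using permutes_back_orb[OF f p(3), of "b (?f u)"] by metis
          then have "b (?f u) \<in> orb {?f} (b w)" by (rule orb_trans[OF conjunct1[OF step.IH]])
          moreover have "?f u \<in> X" using step.IH aX bX by simp
          moreover have "g = ?f" using step.hyps by blast
          ultimately show ?case by blast
        qed (use that in auto)
        then show ?thesis ..
      qed
      have "b z \<in> orb {?f} x \<union> orb {?f} (b x)"
        using bz[of x] bz[of "b x"] z x bX inv by auto
      moreover have "a z \<in> orb {?f} x \<union> orb {?f} (b x)"
        using calculation fa[of z] z by (auto intro: orb_trans)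
      ultimately show "g z \<in> X \<inter> (orb {?f} x \<union> orb {?f} (b x))" using g z aX bX by auto
    qed (use x in auto)
    then show ?thesis by blast
  qed
  have one: "z \<in> orb {?f} x \<longleftrightarrow> z \<notin> orb {?f} (b x)" if x: "x \<in> X" and z: "z \<in> orb {a, b} x" for x z
  proof -
    have "b x \<notin> orb {?f} x" by (rule involutions_product_orb) (use assms x in auto)
    then have "\<not> (z \<in> orb {?f} x \<and> z \<in> orb {?f} (b x))"
      using orb_sym[of "{?f}" X, OF pf p(3)] orb_trans[of _ "{?f}"] by blast
    then show ?thesis using two[OF x] z by blast
  qed
  have ro: "r x \<in> orb {a, b} x" for x
    unfolding r_def by (rule someI[of _ x]) simp
  have rr: "r (g x) = r x" if "g \<in> {a, b}" for g x
  proof -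
    have "orb {a, b} (g x) = orb {a, b} x"
      by (rule orb_eq[OF pab p(3)]) (use that in \<open>auto intro: orb_step\<close>)
    then show ?thesis by (simp add: r_def)
  qed
  have cb: "c (b x) \<noteq> c x" if "x \<in> X" for x
    unfolding c_def using one[OF that ro] rr[of b x] by simp
  have ca: "c (a x) \<noteq> c x" if x: "x \<in> X" for x
  proof -
    have "orb {?f} (a x) = orb {?f} (b x)" by (rule orb_eq[OF pf p(3) fa[OF x]])
    then have "c (a x) = c (b x)" unfolding c_def using rr[of a x] rr[of b x] by simp
    then show ?thesis using cb[OF x] by simp
  qed
  show ?thesis using ca cb by blast
qed

text \<open>The colouring \<open>ca\<close> says that all cycles of \<open>a\<close> are even.
  Cutting off the 2-cycles of \<open>a x\<close> and \<open>a (a x)\<close> keeps this and ends with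
  an involution, where a colouring exists. When a cut is undone, a colouring survives as soon as
  \<open>x\<close> and \<open>a (a x)\<close> have the same colour.\<close>

lemma genus_0_colouring:
  fixes ca :: "'a \<Rightarrow> bool"
  assumes p: "a permutes X" "b permutes X" "finite X"
    and inv: "\<And>x. x \<in> X \<Longrightarrow> b (b x) = x" and fpf: "\<And>x. x \<in> X \<Longrightarrow> b x \<noteq> x"
    and alt: "\<And>x. x \<in> X \<Longrightarrow> ca (a x) \<noteq> ca x" and g: "genus X a b = 0"
  shows "\<exists>c. \<forall>x\<in>X. c (a x) \<noteq> c x \<and> c (b x) \<noteq> (c x :: bool)"
  using p(1) alt g
proof (induction "card X - card (orbits {a} X)" arbitrary: a rule: less_induct)
  case less
  note pa = less.prems(1)
  show ?case
  proof (cases "\<exists>x\<in>X. a (a x) \<noteq> x")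
    case True
    then obtain x where x: "x \<in> X" "a (a x) \<noteq> x" by blast
    let ?y = "a (a x)"
    have aX: "a z \<in> X" and bX: "b z \<in> X" if "z \<in> X" for z
      using that permutes_in_image[OF pa] permutes_in_image[OF p(2)] by simp_all
    let ?a = "a \<circ> Transposition.transpose x ?y"
    have y: "?y \<in> X" "x \<noteq> ?y" using x aX by auto
    have yo: "?y \<in> orb {a} x" by (intro orb_step[of _ _ _ a]) auto
    have a': "?a permutes X" using x y pa by (intro transpose_permutes_compose)
    have "card (orbits {?a} X) = card (orbits {a} X) + 1"
      by (rule orbits_transpose_split) (use x y yo p pa in auto)
    moreover have "card (orbits {?a} X) \<le> card X" by (rule card_orbits_le) (rule p)
    ultimately have lt: "card X - card (orbits {?a} X) < card X - card (orbits {a} X)" by linarith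
    have cxy: "ca ?y = ca x" using less.prems(2) x aX by blast
    have alt': "ca (?a z) \<noteq> ca z" if "z \<in> X" for z
      using that x y cxy less.prems(2) by (auto simp: Transposition.transpose_def)
    have "genus X ?a b \<le> genus X a b"
      by (rule genus_split_le) (use x y yo p pa in auto)
    moreover have "genus X ?a b \<ge> 0" by (rule genus_nonneg) (use a' p in auto)
    ultimately have "genus X ?a b = 0" using less.prems(3) by simp
    from less.hyps[OF lt a' alt' this] obtain c :: "'a \<Rightarrow> bool"
      where c: "\<And>z. z \<in> X \<Longrightarrow> c (?a z) \<noteq> c z" "\<And>z. z \<in> X \<Longrightarrow> c (b z) \<noteq> c z" by blast
    have fix_a: "c (a z) \<noteq> c z" if z: "z \<in> X" and e: "c x = c ?y"
      and c: "\<And>z. z \<in> X \<Longrightarrow> c (?a z) \<noteq> c z" for z and c :: "'a \<Rightarrow> bool"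
      using c[of z] c[of "Transposition.transpose x ?y z"] e z x y
      by (auto simp: Transposition.transpose_def split: if_splits)
    \<comment> \<open>If \<open>x\<close> and \<open>?y\<close> are still connected, genus 0 puts
      their corners on one face, along which the colour is constant since each step of
      \<open>?a \<circ> b\<close> changes it twice. If they are not, the component of
      \<open>x\<close> can be recoloured independently.\<close>
    show ?thesis
    proof (cases "?y \<in> orb {?a, b} x")
      case True
      have "inv_into UNIV b ?y \<in> orb {?a \<circ> b} (inv_into UNIV b x)"
        by (rule genus_0_split_face) (use p pa x y yo less.prems True in auto)
      moreover have ib: "inv_into UNIV b z = b z" if "z \<in> X" for z
        using inv[OF that] p by (metis permutes_inverses(2))
      ultimately have "b ?y \<in> orb {?a \<circ> b} (b x)" using x y by simp
      then have "c (b ?y) = c (b x) \<and> b ?y \<in> X"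
      proof (induction rule: orb_induct)
        case (step z f)
        then have "c (?a (b z)) \<noteq> c (b z)" "c (b z) \<noteq> c z" "?a (b z) \<in> X"
          using c bX permutes_in_image[OF a'] by blast+
        then show ?case using step by auto
      qed (use x bX in auto)
      then have "c x = c ?y" using c(2) x y by blast
      then show ?thesis using fix_a[of _ c] c by blast
    next
      case False
      show ?thesis
      proof (cases "c x = c ?y")
        case True
        then show ?thesis using fix_a[of _ c] c by blast
      next
        case neq: False
        define c' where "c' z = (if z \<in> orb {?a, b} x then \<not> c z else c z)" for z
        have st: "f z \<in> orb {?a, b} x \<longleftrightarrow> z \<in> orb {?a, b} x" if "f \<in> {?a, b}" for f z
        proof -
          have "f permutes X" using that a' p by auto
          then have "z \<in> orb {?a, b} (f z)"
            using permutes_back_orb[OF _ p(3)] orb_superset[of "{f}" "{?a, b}"] that by blast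
          then show ?thesis using that by (auto intro: orb_step orb_trans)
        qed
        have "c' (?a z) \<noteq> c' z" if "z \<in> X" for z
          using c(1)[OF that] st[of ?a z] by (simp add: c'_def)
        moreover have "c' (b z) \<noteq> c' z" if "z \<in> X" for z
          using c(2)[OF that] st[of b z] by (simp add: c'_def)
        moreover have "c' x = c' ?y" using False neq by (simp add: c'_def)
        ultimately show ?thesis using fix_a[of _ c'] by blast
      qed
    qed
  next
    case False
    then have "a (a x) = x" if "x \<in> X" for x using that by blast
    moreover have "a x \<noteq> x" if "x \<in> X" for x using less.prems(2)[OF that] by metis
    ultimately show ?thesis using involutions_colouring[OF pa p(2,3)] inv fpf by blast
  qed
qed

section \<open>Determinants over a finite index set\<close>

definition enum :: "'a set \<Rightarrow> nat \<Rightarrow> 'a" where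
  "enum X = (SOME h. bij_betw h {0..<card X} X)"

lemma enum_bij: "finite X \<Longrightarrow> bij_betw (enum X) {0..<card X} X"
  unfolding enum_def by (rule someI_ex[OF ex_bij_betw_nat_finite])

text \<open>Rows and columns are numbered by the same arbitrary enumeration, so the choice does not
  affect the determinant.\<close>

definition sdet_mat :: "'a set \<Rightarrow> ('a \<Rightarrow> 'a \<Rightarrow> complex) \<Rightarrow> complex mat" where
  "sdet_mat X r = Matrix.mat (card X) (card X) (\<lambda>(i, j). r (enum X i) (enum X j))"

definition sdet :: "'a set \<Rightarrow> ('a \<Rightarrow> 'a \<Rightarrow> complex) \<Rightarrow> complex" where
  "sdet X r = Determinant.det (sdet_mat X r)"

lemma sdet_mat_carrier [simp]: "sdet_mat X r \<in> carrier_mat (card X) (card X)"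
  by (simp add: sdet_mat_def)

lemma sdet_mat_index:
  "i < card X \<Longrightarrow> j < card X \<Longrightarrow> sdet_mat X r $$ (i, j) = r (enum X i) (enum X j)"
  by (simp add: sdet_mat_def)

lemma sum_enum: "finite X \<Longrightarrow> (\<Sum>i<card X. F (enum X i)) = (\<Sum>x\<in>X. F x)"
  using sum.reindex_bij_betw[OF enum_bij, of X F] by (simp add: atLeast0LessThan)

lemma enum_mem: "finite X \<Longrightarrow> i < card X \<Longrightarrow> enum X i \<in> X"
  using enum_bij[of X] by (auto simp: bij_betw_def)

lemma enum_eq_iff: "finite X \<Longrightarrow> i < card X \<Longrightarrow> j < card X \<Longrightarrow> enum X i = enum X j \<longleftrightarrow> i = j"
  using enum_bij[of X] by (auto simp: bij_betw_def inj_on_def)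

lemma enum_surj: "finite X \<Longrightarrow> x \<in> X \<Longrightarrow> \<exists>i<card X. x = enum X i"
  using enum_bij[of X] by (auto simp: bij_betw_def image_iff) (metis atLeastLessThan_iff imageE)

lemma sdet_cong:
  assumes "finite X" "\<And>x. x \<in> X \<Longrightarrow> r x = r' x"
  shows "sdet X r = sdet X r'"
proof -
  have "sdet_mat X r = sdet_mat X r'"
    by (rule eq_matI) (use assms(2)[OF enum_mem[OF assms(1)]] in \<open>auto simp: sdet_mat_def\<close>)
  then show ?thesis by (simp add: sdet_def)
qed

text \<open>The cofactors of row \<open>l\<close> do not involve that row, so one family serves for
  all replacements \<open>v\<close>. The second equation is the product of the adjugate with the
  matrix.\<close>

lemma sdet_cofactors:
  assumes X: "finite X"
  obtains cof where "\<And>l v. l \<in> X \<Longrightarrow> sdet X (r(l := v)) = (\<Sum>k\<in>X. v k * cof l k)"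
    and "\<And>k j. k \<in> X \<Longrightarrow> j \<in> X \<Longrightarrow> (\<Sum>l\<in>X. cof l k * r l j) = (if k = j then sdet X r else 0)"
proof -
  let ?n = "card X"
  let ?A = "sdet_mat X"
  define ix where "ix x = inv_into {0..<?n} (enum X) x" for x
  have ix: "ix (enum X i) = i" if "i < ?n" for i
    unfolding ix_def using enum_bij[OF X] that by (intro inv_into_f_f) (auto simp: bij_betw_def)
  define cof where "cof l k = cofactor (?A r) (ix l) (ix k)" for l k
  have 1: "sdet X (r(l := v)) = (\<Sum>k\<in>X. v k * cof l k)" if l: "l \<in> X" for l v
  proof -
    obtain i where i: "i < ?n" "l = enum X i" using enum_surj[OF X l] by blast
    have "cofactor (?A (r(l := v))) i j = cofactor (?A r) i j" for j
    proof -
      have "mat_delete (?A (r(l := v))) i j = mat_delete (?A r) i j"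
      proof (rule eq_matI)
        fix i' j' assume ij: "i' < dim_row (mat_delete (?A r) i j)" "j' < dim_col (mat_delete (?A r) i j)"
        let ?i = "if i' < i then i' else Suc i'" and ?j = "if j' < j then j' else Suc j'"
        have b: "i' < ?n - 1" "j' < ?n - 1" using ij by (auto simp: sdet_mat_def)
        then have b': "?i < ?n" "?i \<noteq> i" "?j < ?n" by auto
        then have "enum X ?i \<noteq> l" using i enum_eq_iff[OF X] by metis
        then have "?A (r(l := v)) $$ (?i, ?j) = ?A r $$ (?i, ?j)"
          using b' by (simp only: sdet_mat_index fun_upd_apply if_False)
        then show "mat_delete (?A (r(l := v))) i j $$ (i', j') = mat_delete (?A r) i j $$ (i', j')"
          using b by (simp add: mat_delete_def sdet_mat_def)
      qed (simp_all add: sdet_mat_def)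
      then show ?thesis by (simp add: cofactor_def)
    qed
    then have "sdet X (r(l := v)) = (\<Sum>j<?n. v (enum X j) * cofactor (?A r) i j)"
      unfolding sdet_def laplace_expansion_row[OF sdet_mat_carrier i(1)]
      using i by (intro sum.cong) (auto simp: sdet_mat_index)
    also have "\<dots> = (\<Sum>j<?n. v (enum X j) * cof l (enum X j))"
      using i by (intro sum.cong) (auto simp: cof_def ix)
    also have "\<dots> = (\<Sum>k\<in>X. v k * cof l k)" by (rule sum_enum[OF X])
    finally show ?thesis .
  qed
  have 2: "(\<Sum>l\<in>X. cof l k * r l j) = (if k = j then sdet X r else 0)" if kj: "k \<in> X" "j \<in> X" for k j
  proof -
    obtain a b where a: "a < ?n" "k = enum X a" and b: "b < ?n" "j = enum X b"
      using enum_surj[OF X] kj by metis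
    have "(\<Sum>l\<in>X. cof l k * r l j) = (\<Sum>i<?n. cof (enum X i) k * r (enum X i) j)"
      by (rule sum_enum[OF X, symmetric])
    also have "\<dots> = (\<Sum>i<?n. adj_mat (?A r) $$ (a, i) * ?A r $$ (i, b))"
      using a b by (intro sum.cong) (auto simp: cof_def ix adj_mat_def sdet_mat_def)
    also have "\<dots> = (adj_mat (?A r) * ?A r) $$ (a, b)"
      using a b adj_mat(1)[OF sdet_mat_carrier, of X r]
      by (auto simp: atLeast0LessThan[symmetric] scalar_prod_def sdet_mat_def adj_mat_def
          intro!: sum.cong)
    also have "\<dots> = (if k = j then sdet X r else 0)"
      unfolding adj_mat(3)[OF sdet_mat_carrier] using a b enum_eq_iff[OF X] by (auto simp: sdet_def)
    finally show ?thesis .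
  qed
  show thesis by (rule that[OF 1 2])
qed

lemma sdet_row_linear:
  assumes "finite X" "l \<in> X"
  obtains C where "\<And>v. sdet X (r(l := v)) = (\<Sum>k\<in>X. v k * C k)"
proof -
  obtain cof where "\<And>l v. l \<in> X \<Longrightarrow> sdet X (r(l := v)) = (\<Sum>k\<in>X. v k * cof l k)"
    by (rule sdet_cofactors[OF assms(1), of r]) blast
  from this[OF assms(2)] show thesis by (rule that)
qed

lemma sdet_row_add:
  assumes "finite X" "l \<in> X"
  shows "sdet X (r(l := \<lambda>j. a * u j + b * v j)) = a * sdet X (r(l := u)) + b * sdet X (r(l := v))"
proof -
  obtain C where C: "\<And>v. sdet X (r(l := v)) = (\<Sum>k\<in>X. v k * C k)"
    by (rule sdet_row_linear[OF assms, of r]) blast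
  show ?thesis unfolding C by (simp add: sum_distrib_left sum.distrib algebra_simps)
qed

lemma sdet_identical_rows:
  assumes X: "finite X" "k \<in> X" "l \<in> X" "k \<noteq> l" "r k = r l"
  shows "sdet X r = 0"
proof -
  obtain i j where ij: "i < card X" "j < card X" "k = enum X i" "l = enum X j"
    using enum_surj[OF X(1)] X by metis
  have "row (sdet_mat X r) i = row (sdet_mat X r) j"
    using ij X by (intro eq_vecI) (auto simp: sdet_mat_def)
  then show ?thesis unfolding sdet_def
    by (intro det_identical_rows[OF sdet_mat_carrier, of i j]) (use ij X in auto)
qed

lemma sdet_add_row:
  assumes X: "finite X" "k \<in> X" "l \<in> X" "k \<noteq> l"
  shows "sdet X (r(l := \<lambda>j. r l j + r k j)) = sdet X r"
proof -
  have "sdet X (r(l := \<lambda>j. 1 * r l j + 1 * r k j)) = sdet X (r(l := r l)) + sdet X (r(l := r k))"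
    by (subst sdet_row_add[OF X(1,3)]) simp
  moreover have "sdet X (r(l := r k)) = 0"
    by (rule sdet_identical_rows[of _ k l]) (use X in auto)
  ultimately show ?thesis by simp
qed

lemma sdet_swap_rows:
  assumes X: "finite X" "k \<in> X" "l \<in> X" "k \<noteq> l"
  shows "sdet X (r(k := u, l := v)) = - sdet X (r(k := v, l := u))"
proof -
  let ?D = "\<lambda>u v. sdet X (r(k := u, l := v))"
  have z: "?D w w = 0" for w
    by (rule sdet_identical_rows[of _ k l]) (use X in auto)
  have 1: "?D (\<lambda>j. 1 * u j + 1 * v j) w = ?D u w + ?D v w" for u v w
    unfolding fun_upd_twist[OF X(4)] by (subst sdet_row_add[OF X(1,2)]) simp
  have 2: "?D w (\<lambda>j. 1 * u j + 1 * v j) = ?D w u + ?D w v" for u v w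
    by (subst sdet_row_add[OF X(1,3)]) simp
  have "?D u u + ?D v u + (?D u v + ?D v v) = 0"
    using z[of "\<lambda>j. 1 * u j + 1 * v j"] unfolding 1 2 by (simp add: algebra_simps)
  then show ?thesis by (simp add: z add_eq_0_iff)
qed

text \<open>By Cramer's rule \<open>D a b\<close> times the vector \<open>c\<close> is a combination
  of the rows of \<open>?s\<close>. Apply the linear form that sends \<open>v\<close> to
  \<open>D v d\<close>: rows other than those at \<open>k\<close> and \<open>l\<close> then occur
  twice in the determinant and contribute 0.\<close>

lemma sdet_plucker:
  fixes r :: "'a \<Rightarrow> 'a \<Rightarrow> complex"
  assumes X: "finite X" "k \<in> X" "l \<in> X" "k \<noteq> l"
  defines "D \<equiv> \<lambda>u v. sdet X (r(k := u, l := v))"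
  shows "D a c * D b d - D a d * D b c = D a b * D c d"
proof -
  let ?s = "r(k := a, l := b)"
  obtain cof where cof: "\<And>m v. m \<in> X \<Longrightarrow> sdet X (?s(m := v)) = (\<Sum>i\<in>X. v i * cof m i)"
    "\<And>i j. i \<in> X \<Longrightarrow> j \<in> X \<Longrightarrow> (\<Sum>m\<in>X. cof m i * ?s m j) = (if i = j then sdet X ?s else 0)"
    by (rule sdet_cofactors[OF X(1), of ?s]) blast
  obtain C where C: "\<And>v. sdet X ((r(l := d))(k := v)) = (\<Sum>j\<in>X. v j * C j)"
    by (rule sdet_row_linear[OF X(1,2), of "r(l := d)"]) blast
  have D: "D v d = (\<Sum>j\<in>X. v j * C j)" for v
    unfolding D_def C[symmetric] using X(4) by (simp add: fun_upd_twist)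
  have cramer: "(\<Sum>m\<in>X. sdet X (?s(m := c)) * ?s m j) = sdet X ?s * c j" if j: "j \<in> X" for j
  proof -
    have "(\<Sum>m\<in>X. sdet X (?s(m := c)) * ?s m j) = (\<Sum>m\<in>X. \<Sum>i\<in>X. c i * (cof m i * ?s m j))"
      by (intro sum.cong refl) (simp only: cof(1) sum_distrib_right mult.assoc)
    also have "\<dots> = (\<Sum>i\<in>X. c i * (\<Sum>m\<in>X. cof m i * ?s m j))"
      by (subst sum.swap) (simp only: sum_distrib_left)
    also have "\<dots> = (\<Sum>i\<in>X. c i * (if i = j then sdet X ?s else 0))"
      by (intro sum.cong refl arg_cong2[where f = "(*)"] cof(2)) (use j in auto)
    also have "\<dots> = sdet X ?s * c j" using j X by (simp add: sum.delta if_distrib cong: if_cong)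
    finally show ?thesis .
  qed
  have "D a b * D c d = (\<Sum>j\<in>X. sdet X ?s * c j * C j)"
    unfolding D by (simp add: D_def sum_distrib_left mult.assoc)
  also have "\<dots> = (\<Sum>j\<in>X. \<Sum>m\<in>X. sdet X (?s(m := c)) * ?s m j * C j)"
    by (intro sum.cong refl) (simp only: cramer[symmetric] sum_distrib_right)
  also have "\<dots> = (\<Sum>m\<in>X. sdet X (?s(m := c)) * D (?s m) d)"
    unfolding D by (subst sum.swap) (simp only: sum_distrib_left mult.assoc)
  also have "\<dots> = (\<Sum>m\<in>{k, l}. sdet X (?s(m := c)) * D (?s m) d)"
  proof (rule sum.mono_neutral_right)
    show "\<forall>m\<in>X - {k, l}. sdet X (?s(m := c)) * D (?s m) d = 0"
    proof
      fix m assume m: "m \<in> X - {k, l}"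
      have "D (?s m) d = 0" unfolding D_def
        by (rule sdet_identical_rows[of _ k m]) (use X m in auto)
      then show "sdet X (?s(m := c)) * D (?s m) d = 0" by simp
    qed
  qed (use X in auto)
  also have "\<dots> = D c b * D a d + D a c * D b d"
    using X(4) by (simp add: D_def fun_upd_twist)
  also have "D c b = - D b c" unfolding D_def by (rule sdet_swap_rows) (use X in auto)
  finally show ?thesis by simp
qed

lemma sdet_eq_0_iff:
  assumes X: "finite X"
  shows "sdet X r = 0 \<longleftrightarrow> (\<exists>x. (\<exists>y\<in>X. x y \<noteq> 0) \<and> (\<forall>k\<in>X. (\<Sum>j\<in>X. r k j * x j) = 0))"
proof -
  let ?n = "card X"
  let ?A = "sdet_mat X r"
  have mv: "vec_index (?A *\<^sub>v v) i = (\<Sum>j\<in>X. r (enum X i) j * vec_index v (inv_into {0..<?n} (enum X) j))"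
    if "v \<in> carrier_vec ?n" "i < ?n" for v i
  proof -
    have "vec_index (?A *\<^sub>v v) i = (\<Sum>j<?n. r (enum X i) (enum X j) * vec_index v j)"
      using that by (auto simp: scalar_prod_def sdet_mat_def atLeast0LessThan intro!: sum.cong)
    also have "\<dots> = (\<Sum>j<?n. r (enum X i) (enum X j) * vec_index v (inv_into {0..<?n} (enum X) (enum X j)))"
      using enum_bij[OF X] by (intro sum.cong refl) (auto simp: bij_betw_def inv_into_f_f)
    also have "\<dots> = (\<Sum>j\<in>X. r (enum X i) j * vec_index v (inv_into {0..<?n} (enum X) j))"
      by (rule sum_enum[OF X])
    finally show ?thesis .
  qed
  show ?thesis
    unfolding sdet_def det_0_iff_vec_prod_zero_field[OF sdet_mat_carrier]
  proof
    assume "\<exists>v. v \<in> carrier_vec ?n \<and> v \<noteq> 0\<^sub>v ?n \<and> ?A *\<^sub>v v = 0\<^sub>v ?n"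
    then obtain v where v: "v \<in> carrier_vec ?n" "v \<noteq> 0\<^sub>v ?n" "?A *\<^sub>v v = 0\<^sub>v ?n" by blast
    define x where "x j = vec_index v (inv_into {0..<?n} (enum X) j)" for j
    have xe: "x (enum X i) = vec_index v i" if "i < ?n" for i
      unfolding x_def using enum_bij[OF X] that by (subst inv_into_f_f) (auto simp: bij_betw_def)
    have "\<exists>i<?n. vec_index v i \<noteq> 0"
    proof (rule ccontr)
      assume "\<not> ?thesis"
      then have "v = 0\<^sub>v ?n" using v(1) by (intro eq_vecI) auto
      then show False using v(2) by simp
    qed
    then have "\<exists>y\<in>X. x y \<noteq> 0" using xe enum_mem[OF X] by metis
    moreover have "(\<Sum>j\<in>X. r k j * x j) = 0" if k: "k \<in> X" for k
    proof -
      obtain i where i: "i < ?n" "k = enum X i" using enum_surj[OF X k] by blast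
      then show ?thesis using mv[OF v(1) i(1)] v(3) by (simp add: x_def)
    qed
    ultimately show "\<exists>x. (\<exists>y\<in>X. x y \<noteq> 0) \<and> (\<forall>k\<in>X. (\<Sum>j\<in>X. r k j * x j) = 0)" by blast
  next
    assume "\<exists>x. (\<exists>y\<in>X. x y \<noteq> 0) \<and> (\<forall>k\<in>X. (\<Sum>j\<in>X. r k j * x j) = 0)"
    then obtain x y where x: "y \<in> X" "x y \<noteq> 0" "\<And>k. k \<in> X \<Longrightarrow> (\<Sum>j\<in>X. r k j * x j) = 0" by blast
    define v where "v = Matrix.vec ?n (\<lambda>i. x (enum X i))"
    have v: "v \<in> carrier_vec ?n" by (simp add: v_def)
    obtain i where i: "i < ?n" "y = enum X i" using enum_surj[OF X x(1)] by blast
    have "v \<noteq> 0\<^sub>v ?n" using x(2) i by (auto simp: v_def dest!: arg_cong[of _ _ "\<lambda>v. vec_index v i"])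
    moreover have "?A *\<^sub>v v = 0\<^sub>v ?n"
    proof (rule eq_vecI)
      fix i assume "i < dim_vec (0\<^sub>v ?n :: complex vec)"
      then have i: "i < ?n" by simp
      have "vec_index (?A *\<^sub>v v) i = (\<Sum>j\<in>X. r (enum X i) j * x j)"
        unfolding mv[OF v i]
      proof (intro sum.cong refl)
        fix j assume "j \<in> X"
        then obtain b where "b < ?n" "j = enum X b" using enum_surj[OF X] by blast
        then show "r (enum X i) j * vec_index v (inv_into {0..<?n} (enum X) j) = r (enum X i) j * x j"
          using enum_bij[OF X] by (auto simp: bij_betw_def inv_into_f_f v_def)
      qed
      then show "vec_index (?A *\<^sub>v v) i = vec_index (0\<^sub>v ?n) i" using x(3)[OF enum_mem[OF X i]] i by simp
    qed (simp add: sdet_mat_def)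
    ultimately show "\<exists>v. v \<in> carrier_vec ?n \<and> v \<noteq> 0\<^sub>v ?n \<and> ?A *\<^sub>v v = 0\<^sub>v ?n" using v by blast
  qed
qed

lemma sdet_Ints:
  assumes X: "finite X" and "\<And>i j. i \<in> X \<Longrightarrow> j \<in> X \<Longrightarrow> r i j \<in> \<int>"
  shows "sdet X r \<in> \<int>"
  unfolding sdet_def det_def'[OF sdet_mat_carrier]
proof (intro Ints_sum Ints_mult Ints_prod)
  fix p i assume "p \<in> {p. p permutes {0..<card X}}" "i \<in> {0..<card X}"
  moreover have "p i < card X" using calculation permutes_in_image[of p "{0..<card X}" i] by simp
  ultimately show "sdet_mat X r $$ (i, p i) \<in> \<int>"
    using assms(2) enum_mem[OF X] by (simp add: sdet_mat_index)
qed (auto simp: sign_def)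

text \<open>In the Leibniz formula below only the identity contributes: a permutation that moves some
  point \<open>x\<close> has to move all points of the orbit of \<open>x\<close>, in particular \<open>k\<close>.\<close>

lemma sdet_permutation:
  assumes X: "finite X" "p permutes X" "k \<in> X"
  defines "r \<equiv> \<lambda>x j. (if j = x then 1 else 0) - (if x \<noteq> k \<and> j = p x then 1 else 0 :: complex)"
  shows "sdet X r = (if card (orbits {p} X) = 1 then 1 else 0)"
proof -
  have pp: "g permutes X" if "g \<in> {p}" for g using that X by auto
  have c1: "card (orbits {p} X) = 1 \<longleftrightarrow> (\<forall>x\<in>X. \<forall>y\<in>X. y \<in> orb {p} x)"
    using orbits_card_1[of "{p}" X, OF pp X(1)] X(3) by blast
  have pX: "p x \<in> X \<longleftrightarrow> x \<in> X" for x by (rule permutes_in_image[OF X(2)])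
  show ?thesis
  proof (cases "\<forall>x\<in>X. k \<in> orb {p} x")
    case True
    have pn: "p x \<noteq> x" if x: "x \<in> X" "x \<noteq> k" for x
    proof
      assume "p x = x"
      then have "orb {p} x \<subseteq> {x}" by (intro orb_subset) auto
      then show False using True x by auto
    qed
    let ?n = "card X" and ?h = "enum X"
    have "Determinant.det (sdet_mat X r)
        = (\<Sum>q\<in>{q. q permutes {0..<?n}}. signof q * (\<Prod>i = 0..<?n. r (?h i) (?h (q i))))"
      unfolding det_def'[OF sdet_mat_carrier]
    proof (intro sum.cong refl arg_cong2[where f = "(*)"] prod.cong)
      fix q i assume "q \<in> {q. q permutes {0..<?n}}" "i \<in> {0..<?n}"
      moreover have "q i < ?n" using calculation permutes_in_image[of q "{0..<?n}" i] by simp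
      ultimately show "sdet_mat X r $$ (i, q i) = r (?h i) (?h (q i))" by (simp add: sdet_mat_index)
    qed
    also have "\<dots> = (\<Sum>q\<in>{id}. signof q * (\<Prod>i = 0..<?n. r (?h i) (?h (q i))))"
    proof (rule sum.mono_neutral_right)
      show "\<forall>q\<in>{q. q permutes {0..<?n}} - {id}. signof q * (\<Prod>i = 0..<?n. r (?h i) (?h (q i))) = 0"
      proof (rule ballI, rule ccontr)
        fix q assume q: "q \<in> {q. q permutes {0..<?n}} - {id}"
          and nz: "signof q * (\<Prod>i = 0..<?n. r (?h i) (?h (q i))) \<noteq> 0"
        have qn: "q i < ?n \<longleftrightarrow> i < ?n" for i using q permutes_in_image[of q "{0..<?n}" i] by simp
        have qi: "q i = q j \<longleftrightarrow> i = j" for i j using q permutes_inj[of q] by (auto simp: inj_eq)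
        have r: "r (?h i) (?h (q i)) \<noteq> 0" if "i < ?n" for i
          using nz that by (auto simp: prod_zero_iff)
        have move: "?h i \<noteq> k \<and> ?h (q i) = p (?h i)" if i: "i < ?n" "q i \<noteq> i" for i
        proof -
          have "?h (q i) \<noteq> ?h i" using i qn enum_eq_iff[OF X(1)] by simp
          then show ?thesis using r[OF i(1)] by (auto simp: r_def split: if_splits)
        qed
        have "\<exists>i. q i \<noteq> i" using q by (auto simp: fun_eq_iff)
        then obtain i where i: "q i \<noteq> i" by blast
        then have i': "i < ?n" using q permutes_not_in[of q "{0..<?n}" i] by fastforce
        have "orb {p} (?h i) \<subseteq> {?h j | j. j < ?n \<and> q j \<noteq> j}"
        proof (rule orb_subset)
          fix g z assume g: "g \<in> {p}" and "z \<in> {?h j | j. j < ?n \<and> q j \<noteq> j}"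
          then obtain j where j: "z = ?h j" "j < ?n" "q j \<noteq> j" by blast
          then have "p z = ?h (q j)" "q (q j) \<noteq> q j" "q j < ?n" using move qi qn by auto
          then show "g z \<in> {?h j | j. j < ?n \<and> q j \<noteq> j}" using g by blast
        qed (use i i' in blast)
        then have "k \<in> {?h j | j. j < ?n \<and> q j \<noteq> j}"
          using True enum_mem[OF X(1) i'] by blast
        then show False using move by blast
      qed
    qed (auto simp: permutes_id finite_permutations)
    also have "\<dots> = 1"
    proof -
      have "r x x = 1" if "x \<in> X" for x using pn[OF that] by (auto simp: r_def)
      then have "(\<Prod>i = 0..<?n. r (?h i) (?h i)) = 1"
        by (intro prod.neutral) (use enum_mem[OF X(1)] in auto)
      then show ?thesis by simp
    qed
    finally have "sdet X r = 1" unfolding sdet_def .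
    moreover have "card (orbits {p} X) = 1"
      unfolding c1 using True orb_sym[of "{p}" X, OF pp X(1)] orb_trans[of _ "{p}"] by metis
    ultimately show ?thesis by simp
  next
    case False
    then obtain y where y: "y \<in> X" "k \<notin> orb {p} y" by blast
    \<comment> \<open>The indicator of a cycle avoiding \<open>k\<close> is constant along
      \<open>p\<close> and 0 at \<open>k\<close>, so it is annihilated by every row.\<close>
    define x where "x z = (if z \<in> orb {p} y then 1 else 0 :: complex)" for z
    have st: "p z \<in> orb {p} y \<longleftrightarrow> z \<in> orb {p} y" for z
      using orb_step[of z "{p}" y p] permutes_back_orb[OF X(2,1), of z] orb_trans[of "p z" "{p}" y z] by blast
    have "sdet X r = 0"
      unfolding sdet_eq_0_iff[OF X(1)]
    proof (intro exI conjI ballI)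
      show "\<exists>y\<in>X. x y \<noteq> 0" using y by (intro bexI[of _ y]) (auto simp: x_def)
      fix z assume z: "z \<in> X"
      have "(\<Sum>j\<in>X. r z j * x j) = (\<Sum>j\<in>X. (if j = z then x j else 0))
          - (\<Sum>j\<in>X. (if j = p z then if z \<noteq> k then x j else 0 else 0))"
        unfolding sum_subtractf[symmetric] by (intro sum.cong) (auto simp: r_def)
      also have "\<dots> = x z - (if z \<noteq> k then x (p z) else 0)"
        using X z pX by (simp add: sum.delta)
      also have "\<dots> = 0" using y st by (auto simp: x_def)
      finally show "(\<Sum>j\<in>X. r z j * x j) = 0" .
    qed
    moreover have "card (orbits {p} X) \<noteq> 1" unfolding c1 using y X(3) by blast
    ultimately show ?thesis by simp
  qed
qed

section \<open>Closures of a pairing of strand ends\<close>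

text \<open>A node \<open>c\<close> has the incoming points \<open>g c\<close>, \<open>h c\<close> and the outgoing points
  \<open>f (g c)\<close>, \<open>f (h c)\<close>. At the nodes in \<open>W\<close> the connections are exchanged. The nodes in
  \<open>K\<close> are the crossings, \<open>out\<close> and \<open>inn\<close> stand for the two holes.\<close>

locale node_system =
  fixes X :: "'a set" and f :: "'a \<Rightarrow> 'a" and I K :: "'b set" and out inn :: 'b
    and g h :: "'b \<Rightarrow> 'a"
  assumes I: "I = insert out (insert inn K)"
    and K: "finite K" "out \<notin> K" "inn \<notin> K" "out \<noteq> inn"
    and inj: "inj_on g I" "inj_on h I" and disj: "g ` I \<inter> h ` I = {}"
    and X: "X = g ` I \<union> h ` I" and f: "f permutes X"
begin

text \<open>Swapping the two incoming points of a node before \<open>f\<close> is applied realizes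
  the other way of joining them to the outgoing points.\<close>

definition exchange :: "'b set \<Rightarrow> 'a \<Rightarrow> 'a" where
  "exchange W x = (if x \<in> g ` W then h (inv_into I g x) else if x \<in> h ` W then g (inv_into I h x) else x)"

definition strand :: "'b set \<Rightarrow> 'a \<Rightarrow> 'a" where
  "strand W = f \<circ> exchange W"

definition cyclic :: "'b set \<Rightarrow> int" where
  "cyclic W = (if card (orbits {strand W} X) = 1 then 1 else 0)"

lemma finite_I [simp]: "finite I" and finite_X [simp]: "finite X"
  using K by (auto simp: X I)

lemma node_mem [simp]: "out \<in> I" "inn \<in> I" "c \<in> K \<Longrightarrow> c \<in> I"
  by (auto simp: I)

lemma gX [simp]: "c \<in> I \<Longrightarrow> g c \<in> X" and hX [simp]: "c \<in> I \<Longrightarrow> h c \<in> X"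
  by (auto simp: X)

lemma g_eq: "c \<in> I \<Longrightarrow> d \<in> I \<Longrightarrow> g c = g d \<longleftrightarrow> c = d"
  and h_eq: "c \<in> I \<Longrightarrow> d \<in> I \<Longrightarrow> h c = h d \<longleftrightarrow> c = d"
  using inj by (meson inj_onD)+

lemma g_neq_h: "c \<in> I \<Longrightarrow> d \<in> I \<Longrightarrow> g c \<noteq> h d"
  using disj by blast

lemma inv_g: "c \<in> I \<Longrightarrow> inv_into I g (g c) = c" and inv_h: "c \<in> I \<Longrightarrow> inv_into I h (h c) = c"
  using inj by (auto intro: inv_into_f_f)

lemma g_image: "c \<in> I \<Longrightarrow> W \<subseteq> I \<Longrightarrow> g c \<in> g ` W \<longleftrightarrow> c \<in> W"
  and h_image: "c \<in> I \<Longrightarrow> W \<subseteq> I \<Longrightarrow> h c \<in> h ` W \<longleftrightarrow> c \<in> W"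
  using inj by (auto simp: inj_on_image_mem_iff)

lemma g_h_image: "c \<in> I \<Longrightarrow> W \<subseteq> I \<Longrightarrow> g c \<notin> h ` W"
  and h_g_image: "c \<in> I \<Longrightarrow> W \<subseteq> I \<Longrightarrow> h c \<notin> g ` W"
  using g_neq_h by (metis imageE subsetD)+

lemma X_cases [consumes 1]:
  assumes "x \<in> X"
  obtains c where "c \<in> I" "x = g c" | c where "c \<in> I" "x = h c"
  using assms unfolding X by blast

lemma exchange_g: "W \<subseteq> I \<Longrightarrow> c \<in> I \<Longrightarrow> exchange W (g c) = (if c \<in> W then h c else g c)"
  and exchange_h: "W \<subseteq> I \<Longrightarrow> c \<in> I \<Longrightarrow> exchange W (h c) = (if c \<in> W then g c else h c)"
  by (simp_all add: exchange_def inv_g inv_h g_image h_image g_h_image h_g_image)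

lemma exchange_outside: "W \<subseteq> I \<Longrightarrow> x \<notin> X \<Longrightarrow> exchange W x = x"
  by (auto simp: exchange_def X)

lemma exchange_exchange:
  assumes "W \<subseteq> I"
  shows "exchange W (exchange W x) = x"
proof (cases "x \<in> X")
  case True
  then show ?thesis by (cases rule: X_cases) (use assms in \<open>auto simp: exchange_g exchange_h\<close>)
next
  case False
  then show ?thesis using assms by (simp add: exchange_outside)
qed

lemma exchange_permutes:
  assumes W: "W \<subseteq> I"
  shows "exchange W permutes X"
proof (rule bij_imp_permutes)
  have "exchange W x \<in> X" if "x \<in> X" for x
    using that by (cases rule: X_cases) (use W in \<open>auto simp: exchange_g exchange_h\<close>)
  then show "bij_betw (exchange W) X X"
    by (intro bij_betw_byWitness[where f' = "exchange W"]) (use W in \<open>auto simp: exchange_exchange\<close>)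
qed (rule exchange_outside[OF W])

lemma strand_permutes: "W \<subseteq> I \<Longrightarrow> strand W permutes X"
  unfolding strand_def by (intro permutes_compose exchange_permutes f)

lemma strand_g: "W \<subseteq> I \<Longrightarrow> c \<in> I \<Longrightarrow> strand W (g c) = f (if c \<in> W then h c else g c)"
  and strand_h: "W \<subseteq> I \<Longrightarrow> c \<in> I \<Longrightarrow> strand W (h c) = f (if c \<in> W then g c else h c)"
  by (simp_all add: strand_def exchange_g exchange_h)

lemma exchange_insert:
  assumes "W \<subseteq> I" "c \<in> I" "c \<notin> W"
  shows "exchange (insert c W) = exchange W \<circ> Transposition.transpose (g c) (h c)"
proof
  fix x
  have W: "insert c W \<subseteq> I" using assms by simp
  show "exchange (insert c W) x = (exchange W \<circ> Transposition.transpose (g c) (h c)) x"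
  proof (cases "x \<in> X")
    case True
    then show ?thesis
    proof (cases rule: X_cases)
      case (1 d)
      then show ?thesis using assms W
        by (cases "d = c") (auto simp: exchange_g exchange_h Transposition.transpose_def g_eq g_neq_h)
    next
      case (2 d)
      then show ?thesis using assms W
        by (cases "d = c") (auto simp: exchange_g exchange_h Transposition.transpose_def h_eq
            g_neq_h[symmetric])
    qed
  next
    case False
    then have "x \<noteq> g c" "x \<noteq> h c" using assms by auto
    then show ?thesis using False W assms by (simp add: exchange_outside)
  qed
qed

lemma even_orbits_strand:
  assumes "W \<subseteq> I"
  shows "even (card (orbits {strand W} X) + card W + card (orbits {f} X))"
proof -
  have "finite W" using assms finite_I by (rule finite_subset)
  then show ?thesis using assms
  proof (induction W)
    case empty
    have "exchange {} = id" by (auto simp: exchange_def)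
    then show ?case by (simp add: strand_def)
  next
    case (insert c W)
    then have W: "W \<subseteq> I" "c \<in> I" by auto
    have e: "strand (insert c W) = strand W \<circ> Transposition.transpose (g c) (h c)"
      unfolding strand_def exchange_insert[OF W(1,2) insert(2)] by (simp add: comp_assoc)
    have gh: "g c \<in> X" "h c \<in> X" "g c \<noteq> h c" using W g_neq_h by auto
    have "card (orbits {strand (insert c W)} X) = card (orbits {strand W} X) + 1
      \<or> card (orbits {strand (insert c W)} X) + 1 = card (orbits {strand W} X)"
      using orbits_transpose_merge[OF strand_permutes[OF W(1)] finite_X gh(1,2)]
        orbits_transpose_split[OF strand_permutes[OF W(1)] finite_X gh] unfolding e by blast
    moreover have "even (card (orbits {strand W} X) + card W + card (orbits {f} X))"
      by (rule insert.IH) (rule W)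
    moreover have "even (z' + Suc w + b)" if "z' = z + 1 \<or> z' + 1 = z" "even (z + w + b)" for z z' w b :: nat
      using that by presburger
    ultimately show ?case using insert.hyps by (metis card_insert_disjoint)
  qed
qed

lemma cyclic_parity:
  assumes "W \<subseteq> I" "cyclic W \<noteq> 0"
  shows "odd (card W + card (orbits {f} X))"
  using even_orbits_strand[OF assms(1)] assms(2) unfolding cyclic_def
  by (auto split: if_splits)

section \<open>One determinant for all states and closures, linear in one row per node\<close>

definition unit :: "'a \<Rightarrow> 'a \<Rightarrow> complex" where
  "unit x j = (if j = x then 1 else 0)"

definition link :: "bool \<Rightarrow> 'b \<Rightarrow> 'a \<Rightarrow> complex" where
  "link b c j = unit (g c) j - unit (f (if b then h c else g c)) j"

definition balance :: "'b \<Rightarrow> 'a \<Rightarrow> complex" where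
  "balance c j = unit (g c) j + unit (h c) j - unit (f (g c)) j - unit (f (h c)) j"

text \<open>The balance rows of all nodes add up to 0, so the one of \<open>out\<close> is redundant. It is replaced by
  a unit vector.\<close>

definition rows :: "('b \<Rightarrow> 'a \<Rightarrow> complex) \<Rightarrow> 'a \<Rightarrow> 'a \<Rightarrow> complex" where
  "rows u x = (if x = h out then unit x else if x \<in> g ` I then u (inv_into I g x)
     else balance (inv_into I h x))"

definition node_det :: "('b \<Rightarrow> 'a \<Rightarrow> complex) \<Rightarrow> complex" where
  "node_det u = sdet X (rows u)"

definition flat :: "'b set \<Rightarrow> 'b \<Rightarrow> 'a \<Rightarrow> complex" where
  "flat W c = link (c \<in> W) c"

lemma rows_g: "c \<in> I \<Longrightarrow> rows u (g c) = u c"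
  using g_neq_h[of c out] by (simp add: rows_def inv_g)

lemma rows_h:
  assumes "c \<in> I" "c \<noteq> out"
  shows "rows u (h c) = balance c"
proof -
  have "h c \<noteq> h out" "h c \<notin> g ` I" using assms h_eq h_g_image by auto
  then show ?thesis using assms by (simp add: rows_def inv_h)
qed

lemma rows_ho: "rows u (h out) = unit (h out)"
  by (simp add: rows_def)

lemma rows_upd:
  assumes "c \<in> I" "x \<in> X"
  shows "rows (u(c := w)) x = ((rows u)(g c := w)) x"
  using assms(2)
proof (cases rule: X_cases)
  case (1 d)
  then show ?thesis using assms by (simp add: rows_g g_eq)
next
  case (2 d)
  then show ?thesis using assms g_neq_h[of c d]
    by (cases "d = out") (auto simp: rows_h rows_ho)
qed

lemma node_det_upd: "c \<in> I \<Longrightarrow> node_det (u(c := w)) = sdet X ((rows u)(g c := w))"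
  unfolding node_det_def by (rule sdet_cong) (simp_all add: rows_upd)

lemma node_det_linear:
  assumes "c \<in> I"
  shows "node_det (u(c := \<lambda>j. a * v j + b * w j)) = a * node_det (u(c := v)) + b * node_det (u(c := w))"
  unfolding node_det_upd[OF assms] using assms by (intro sdet_row_add) auto

lemma node_det_flat:
  assumes W: "W \<subseteq> I"
  shows "node_det (flat W) = of_int (cyclic W)"
proof -
  define r where "r = (\<lambda>x j. (if j = x then 1 else 0) - (if x \<noteq> h out \<and> j = strand W x then 1 else 0 :: complex))"
  \<comment> \<open>\<open>J\<close> lists the nodes where the row at \<open>g c\<close> has already
    been added to the row at \<open>h c\<close>. All nodes except \<open>out\<close> are treated in
    this way, one after the other.\<close>
  define R where "R J x = (if x \<in> h ` J then balance (inv_into I h x) else r x)" for J x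
  have rg: "r (g c) = flat W c" if "c \<in> I" for c
    unfolding r_def flat_def link_def unit_def strand_g[OF W that] using g_neq_h[OF that, of out]
    by (simp add: fun_eq_iff)
  have rh: "r (h c) j + r (g c) j = balance c j" if "c \<in> I" "c \<noteq> out" for c j
    unfolding rg[OF that(1)]
    unfolding flat_def link_def balance_def r_def unit_def strand_h[OF W that(1)]
    using that h_eq[OF that(1), of out] by simp
  have Rg: "R J (g c) = r (g c)" if "c \<in> I" "J \<subseteq> I" for J c
  proof -
    have "g c \<notin> h ` J" using that g_neq_h[OF that(1)] by blast
    then show ?thesis by (simp add: R_def)
  qed
  have Rh: "R J (h c) = (if c \<in> J then balance c else r (h c))" if "c \<in> I" "J \<subseteq> I" for J c
  proof -
    have "h c \<in> h ` J \<longleftrightarrow> c \<in> J" using that h_eq[OF that(1)] by blast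
    then show ?thesis using inv_into_f_f[OF inj(2) that(1)] by (simp add: R_def)
  qed
  have "sdet X (R J) = sdet X r" if "J \<subseteq> I - {out}" for J
  proof -
    have "finite J" using that finite_subset[of J I] by auto
    then show ?thesis using that
    proof (induction J)
      case empty
      show ?case by (simp add: R_def)
    next
      case (insert c J)
      then have J: "J \<subseteq> I" "c \<in> I" "c \<noteq> out" "insert c J \<subseteq> I" by auto
      have "R (insert c J) x = ((R J)(h c := \<lambda>j. R J (h c) j + R J (g c) j)) x" if x: "x \<in> X" for x
      proof (cases "x = h c")
        case True
        have "R J (h c) = r (h c)" "R (insert c J) (h c) = balance c"
          using J insert.hyps by (simp_all add: Rh)
        then show ?thesis using True rh[OF J(2,3)] Rg[OF J(2,1)] by (simp add: fun_eq_iff)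
      next
        case False
        then show ?thesis by (simp add: R_def)
      qed
      then have "sdet X (R (insert c J)) = sdet X ((R J)(h c := \<lambda>j. R J (h c) j + R J (g c) j))"
        by (intro sdet_cong) auto
      also have "\<dots> = sdet X (R J)"
        by (rule sdet_add_row) (use J g_neq_h in auto)
      also have "\<dots> = sdet X r" using insert by auto
      finally show ?case .
    qed
  qed
  then have "sdet X (R (I - {out})) = sdet X r" by blast
  moreover have "rows (flat W) x = R (I - {out}) x" if "x \<in> X" for x
    using that
  proof (cases rule: X_cases)
    case (1 c)
    then show ?thesis by (simp only: rows_g Rg[of c "I - {out}"] rg Diff_subset)
  next
    case (2 c)
    have Rr: "r (h out) = unit (h out)" by (auto simp: r_def unit_def)
    show ?thesis
      by (cases "c = out") (use 2 Rr Rh[of c "I - {out}"] in \<open>auto simp: rows_h rows_ho\<close>)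
  qed
  then have "node_det (flat W) = sdet X (R (I - {out}))"
    unfolding node_det_def by (intro sdet_cong) auto
  moreover have "sdet X r = (if card (orbits {strand W} X) = 1 then 1 else 0)"
    unfolding r_def by (rule sdet_permutation) (use strand_permutes[OF W] in auto)
  ultimately show ?thesis by (simp add: cyclic_def)
qed

text \<open>Multilinearity: the term of \<open>W\<close> takes the exchanged row at exactly the
  nodes of \<open>W\<close>, each with a factor \<open>w\<close>. The remaining rows are the same
  for all states.\<close>

lemma node_det_expand:
  assumes "J \<subseteq> I"
  shows "node_det (\<lambda>c. if c \<in> J then \<lambda>j. link False c j + w * link True c j else u c)
    = (\<Sum>W\<in>Pow J. w ^ card W * node_det (\<lambda>c. if c \<in> J then flat W c else u c))"
proof -
  have "finite J" using assms finite_I by (rule finite_subset)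
  then show ?thesis using assms
  proof (induction J arbitrary: u)
    case (insert d J)
    let ?v = "\<lambda>b. u(d := link b d)"
    have d: "d \<in> I" "J \<subseteq> I" using insert.prems by auto
    have fin: "finite W" if "W \<in> Pow J" for W using that insert.hyps finite_subset by auto
    let ?m = "\<lambda>u c. if c \<in> J then \<lambda>j. link False c j + w * link True c j else u c"
    have "node_det (\<lambda>c. if c \<in> insert d J then \<lambda>j. link False c j + w * link True c j else u c)
        = node_det ((?m u)(d := \<lambda>j. 1 * link False d j + w * link True d j))"
      by (intro arg_cong[of _ _ node_det]) auto
    also have "\<dots> = 1 * node_det ((?m u)(d := link False d)) + w * node_det ((?m u)(d := link True d))"
      by (rule node_det_linear[OF d(1)])
    finally have 1: "node_det (\<lambda>c. if c \<in> insert d J then \<lambda>j. link False c j + w * link True c j else u c)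
        = 1 * node_det ((?m u)(d := link False d)) + w * node_det ((?m u)(d := link True d))" .
    have 2: "(?m u)(d := link b d) = ?m (?v b)" for b
      using insert.hyps by auto
    let ?F = "\<lambda>W. w ^ card W * node_det (\<lambda>c. if c \<in> insert d J then flat W c else u c)"
    have 3: "node_det (?m (?v False)) = (\<Sum>W\<in>Pow J. ?F W)"
      unfolding insert.IH[OF d(2)]
    proof (intro sum.cong refl)
      fix W assume "W \<in> Pow J"
      then have "d \<notin> W" using insert.hyps by auto
      then have "(\<lambda>c. if c \<in> J then flat W c else ?v False c)
          = (\<lambda>c. if c \<in> insert d J then flat W c else u c)"
        using insert.hyps by (auto simp: flat_def)
      then show "w ^ card W * node_det (\<lambda>c. if c \<in> J then flat W c else ?v False c) = ?F W" by simp
    qed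
    have 4: "w * node_det (?m (?v True)) = (\<Sum>W\<in>Pow J. ?F (insert d W))"
      unfolding insert.IH[OF d(2)] sum_distrib_left
    proof (intro sum.cong refl)
      fix W assume W: "W \<in> Pow J"
      then have "d \<notin> W" "finite W" using insert.hyps fin by auto
      then have "card (insert d W) = Suc (card W)" by simp
      moreover have "(\<lambda>c. if c \<in> J then flat W c else ?v True c)
          = (\<lambda>c. if c \<in> insert d J then flat (insert d W) c else u c)"
      proof
        fix c show "(if c \<in> J then flat W c else ?v True c)
            = (if c \<in> insert d J then flat (insert d W) c else u c)"
          using insert.hyps by (cases "c = d") (auto simp: flat_def)
      qed
      ultimately show "w * (w ^ card W * node_det (\<lambda>c. if c \<in> J then flat W c else ?v True c))
          = ?F (insert d W)" by simp
    qed
    have 5: "(\<Sum>W\<in>Pow J. ?F (insert d W)) = (\<Sum>W\<in>insert d ` Pow J. ?F W)"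
      using insert.hyps by (subst sum.reindex) (auto simp: inj_on_def insert_ident)
    have 6: "(\<Sum>W\<in>Pow (insert d J). ?F W) = (\<Sum>W\<in>Pow J. ?F W) + (\<Sum>W\<in>insert d ` Pow J. ?F W)"
      unfolding Pow_insert using insert.hyps by (intro sum.union_disjoint) auto
    show ?case unfolding 1 2 6 5[symmetric] 3[symmetric] 4[symmetric] by simp
  qed simp
qed

lemma node_det_cong: "(\<And>c. c \<in> I \<Longrightarrow> u c = v c) \<Longrightarrow> node_det u = node_det v"
  unfolding node_det_def
proof (rule sdet_cong)
  fix x assume "x \<in> X" and uv: "\<And>c. c \<in> I \<Longrightarrow> u c = v c"
  then show "rows u x = rows v x"
  proof (cases rule: X_cases)
    case (2 c)
    then show ?thesis by (cases "c = out") (auto simp: rows_h rows_ho)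
  qed (simp add: rows_g uv)
qed simp

text \<open>The rows at \<open>g out\<close> and \<open>g inn\<close> may receive arbitrary vectors,
  in particular two rows that belong to the same hole. Such a determinant does not come from a
  closure; this is how the two factors arise.\<close>

lemma node_det_plucker:
  defines "D \<equiv> \<lambda>u a b. node_det (u(out := a, inn := b))"
  shows "D u a c * D u b d - D u a d * D u b c = D u a b * D u c d"
proof -
  have "D u a b = sdet X ((rows u)(g out := a, g inn := b))" for a b
    unfolding D_def node_det_upd[OF node_mem(2)]
    by (rule sdet_cong) (simp_all add: rows_upd)
  moreover have "g out \<noteq> g inn" using K g_eq by simp
  ultimately show ?thesis using sdet_plucker[of X "g out" "g inn" "rows u"] by simp
qed

section \<open>Kernel vectors and the vanishing of the two factors\<close>

definition invariant :: "'b set \<Rightarrow> ('a \<Rightarrow> complex) \<Rightarrow> bool" where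
  "invariant W x \<longleftrightarrow> (\<forall>c\<in>K. x (strand W (g c)) = x (g c) \<and> x (strand W (h c)) = x (h c))"

definition Ends :: "'b \<Rightarrow> 'a set" where
  "Ends c = {g c, h c, f (g c), f (h c)}"

text \<open>This is the kernel condition for the factor that uses both rows of the hole
  \<open>c\<close>, in a form that treats the holes alike although \<open>rows\<close> distinguishes
  \<open>out\<close>.\<close>

definition degenerate :: "'b set \<Rightarrow> 'b \<Rightarrow> bool" where
  "degenerate W c \<longleftrightarrow> (\<exists>x. (\<exists>y\<in>X. x y \<noteq> 0) \<and> invariant W x \<and> (\<forall>y\<in>Ends c. x y = 0))"

lemma sum_unit [simp]: "y \<in> X \<Longrightarrow> (\<Sum>j\<in>X. unit y j * x j) = x y"
  by (simp add: unit_def if_distrib[of "\<lambda>a. a * _"] cong: if_cong)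

lemma fX [simp]: "f y \<in> X \<longleftrightarrow> y \<in> X"
  by (rule permutes_in_image[OF f])

lemma sum_link [simp]: "c \<in> I \<Longrightarrow>
    (\<Sum>j\<in>X. link b c j * x j) = x (g c) - x (f (if b then h c else g c))"
  by (simp add: link_def left_diff_distrib sum_subtractf)

lemma sum_balance [simp]: "c \<in> I \<Longrightarrow>
    (\<Sum>j\<in>X. balance c j * x j) = x (g c) + x (h c) - x (f (g c)) - x (f (h c))"
  by (simp add: balance_def left_diff_distrib distrib_right sum_subtractf sum.distrib)

text \<open>As \<open>f\<close> permutes \<open>X\<close>, the balances of all nodes add up to 0,
  and invariance makes those of the crossings vanish separately.\<close>

lemma balance_total:
  assumes W: "W \<subseteq> K" and x: "invariant W x"
  shows "x (g out) + x (h out) - x (f (g out)) - x (f (h out))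
    + (x (g inn) + x (h inn) - x (f (g inn)) - x (f (h inn))) = 0"
proof -
  have split: "(\<Sum>y\<in>X. x y) = (\<Sum>c\<in>I. x (g c) + x (h c))" for x :: "'a \<Rightarrow> complex"
    unfolding X using disj inj by (subst sum.union_disjoint) (auto simp: sum.reindex sum.distrib)
  have "(\<Sum>y\<in>X. x y) = (\<Sum>y\<in>X. x (f y))"
    using sum.permute[OF f, of x] by (simp add: comp_def)
  then have "(\<Sum>c\<in>I. x (g c) + x (h c) - x (f (g c)) - x (f (h c))) = 0"
    unfolding split by (simp add: sum.distrib sum_subtractf algebra_simps)
  moreover have "x (g c) + x (h c) - x (f (g c)) - x (f (h c)) = 0" if c: "c \<in> K" for c
  proof -
    have "W \<subseteq> I" using W by auto
    then show ?thesis using x c by (auto simp: invariant_def strand_g strand_h split: if_splits)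
  qed
  ultimately show ?thesis using K by (simp add: I)
qed

text \<open>The zero rows at the holes are placeholders, to be overwritten by the two rows under
  consideration.\<close>

definition base :: "'b set \<Rightarrow> 'b \<Rightarrow> 'a \<Rightarrow> complex" where
  "base W c = (if c \<in> K then flat W c else (\<lambda>_. 0))"

lemma node_det_eq_0_iff:
  assumes W: "W \<subseteq> K"
  shows "node_det ((base W)(out := a, inn := b)) = 0 \<longleftrightarrow>
    (\<exists>x. (\<exists>y\<in>X. x y \<noteq> 0) \<and> x (h out) = 0 \<and> invariant W x
       \<and> x (g inn) + x (h inn) - x (f (g inn)) - x (f (h inn)) = 0
       \<and> (\<Sum>j\<in>X. a j * x j) = 0 \<and> (\<Sum>j\<in>X. b j * x j) = 0)"
proof -
  have WI: "W \<subseteq> I" using W by auto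
  let ?u = "(base W)(out := a, inn := b)"
  have "(\<forall>k\<in>X. (\<Sum>j\<in>X. rows ?u k j * x j) = 0) \<longleftrightarrow>
      x (h out) = 0 \<and> invariant W x \<and> x (g inn) + x (h inn) - x (f (g inn)) - x (f (h inn)) = 0
       \<and> (\<Sum>j\<in>X. a j * x j) = 0 \<and> (\<Sum>j\<in>X. b j * x j) = 0" (is "?L \<longleftrightarrow> ?R") for x
  proof -
    have "?L \<longleftrightarrow> (\<forall>c\<in>I. (\<Sum>j\<in>X. rows ?u (g c) j * x j) = 0 \<and> (\<Sum>j\<in>X. rows ?u (h c) j * x j) = 0)"
      unfolding X by blast
    also have "\<dots> \<longleftrightarrow> ((\<Sum>j\<in>X. a j * x j) = 0 \<and> x (h out) = 0) \<and> ((\<Sum>j\<in>X. b j * x j) = 0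
        \<and> x (g inn) + x (h inn) - x (f (g inn)) - x (f (h inn)) = 0) \<and>
        (\<forall>c\<in>K. (\<Sum>j\<in>X. rows ?u (g c) j * x j) = 0 \<and> (\<Sum>j\<in>X. rows ?u (h c) j * x j) = 0)"
    proof -
      have "(\<forall>c\<in>I. P c) \<longleftrightarrow> P out \<and> P inn \<and> (\<forall>c\<in>K. P c)" for P
        unfolding I by simp
      moreover have "rows ?u (g out) = a" "rows ?u (h out) = unit (h out)"
        "rows ?u (g inn) = b" "rows ?u (h inn) = balance inn"
        using K by (simp_all add: rows_g rows_h rows_ho)
      ultimately show ?thesis by simp
    qed
    also have "(\<forall>c\<in>K. (\<Sum>j\<in>X. rows ?u (g c) j * x j) = 0 \<and> (\<Sum>j\<in>X. rows ?u (h c) j * x j) = 0)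
        \<longleftrightarrow> invariant W x"
      unfolding invariant_def
    proof (rule ball_cong[OF refl])
      fix c assume c: "c \<in> K"
      then have "c \<in> I" "c \<noteq> out" "c \<noteq> inn" using K by auto
      then show "((\<Sum>j\<in>X. rows ?u (g c) j * x j) = 0 \<and> (\<Sum>j\<in>X. rows ?u (h c) j * x j) = 0)
          \<longleftrightarrow> (x (strand W (g c)) = x (g c) \<and> x (strand W (h c)) = x (h c))"
        using c WI by (simp add: rows_g rows_h base_def flat_def strand_g strand_h)
          (auto simp: algebra_simps)
    qed
    finally show ?thesis by blast
  qed
  then show ?thesis unfolding node_det_def sdet_eq_0_iff[OF finite_X] by simp
qed

text \<open>The balance at \<open>out\<close> is not among the rows but follows from
  \<open>balance_total\<close>. With the two link rows it makes \<open>x\<close> equal at all four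
  ends of \<open>out\<close>, and the unit row makes this value 0.\<close>

lemma node_det_out_eq_0_iff:
  assumes W: "W \<subseteq> K"
  shows "node_det ((base W)(out := link False out, inn := link True out)) = 0 \<longleftrightarrow> degenerate W out"
proof -
  have "(x (h out) = 0 \<and> invariant W x \<and> x (g inn) + x (h inn) - x (f (g inn)) - x (f (h inn)) = 0
    \<and> (\<Sum>j\<in>X. link False out j * x j) = 0 \<and> (\<Sum>j\<in>X. link True out j * x j) = 0)
    \<longleftrightarrow> (invariant W x \<and> (\<forall>y\<in>Ends out. x y = 0))" for x
    using balance_total[OF W, of x] by (auto simp: Ends_def)
  then show ?thesis unfolding node_det_eq_0_iff[OF W] degenerate_def by simp
qed

lemma invariant_shift: "invariant W x \<Longrightarrow> invariant W (\<lambda>y. x y - a)"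
  by (simp add: invariant_def)

text \<open>Here the rows only make \<open>x\<close> constant on the ends of \<open>inn\<close>,
  while the unit row normalizes it at \<open>h out\<close>. Since constants are invariant, the
  normalization can be moved from one hole to the other by a shift.\<close>

lemma node_det_inn_eq_0_iff:
  assumes W: "W \<subseteq> K"
  shows "node_det ((base W)(out := link False inn, inn := link True inn)) = 0 \<longleftrightarrow> degenerate W inn"
  unfolding node_det_eq_0_iff[OF W] degenerate_def
proof
  assume "\<exists>x. (\<exists>y\<in>X. x y \<noteq> 0) \<and> x (h out) = 0 \<and> invariant W x
    \<and> x (g inn) + x (h inn) - x (f (g inn)) - x (f (h inn)) = 0
    \<and> (\<Sum>j\<in>X. link False inn j * x j) = 0 \<and> (\<Sum>j\<in>X. link True inn j * x j) = 0"
  then obtain x z where x: "z \<in> X" "x z \<noteq> 0" "x (h out) = 0" "invariant W x"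
    "x (g inn) + x (h inn) - x (f (g inn)) - x (f (h inn)) = 0"
    "(\<Sum>j\<in>X. link False inn j * x j) = 0" "(\<Sum>j\<in>X. link True inn j * x j) = 0" by blast
  let ?y = "\<lambda>j. x j - x (g inn)"
  have "\<exists>j\<in>X. ?y j \<noteq> 0"
  proof (rule ccontr)
    assume "\<not> ?thesis"
    then have n: "x j - x (g inn) = 0" if "j \<in> X" for j using that by blast
    show False using n[OF x(1)] n[of "h out"] x(2,3) by simp
  qed
  moreover have "\<forall>j\<in>Ends inn. ?y j = 0" using x by (auto simp: Ends_def)
  ultimately show "\<exists>x. (\<exists>y\<in>X. x y \<noteq> 0) \<and> invariant W x \<and> (\<forall>y\<in>Ends inn. x y = 0)"
    using invariant_shift[OF x(4), of "x (g inn)"] by (intro exI[of _ ?y] conjI)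
next
  assume "\<exists>x. (\<exists>y\<in>X. x y \<noteq> 0) \<and> invariant W x \<and> (\<forall>y\<in>Ends inn. x y = 0)"
  then obtain x z where x: "z \<in> X" "x z \<noteq> 0" "invariant W x" "\<forall>y\<in>Ends inn. x y = 0" by blast
  let ?y = "\<lambda>j. x j - x (h out)"
  have e: "x (g inn) = 0" "x (h inn) = 0" "x (f (g inn)) = 0" "x (f (h inn)) = 0"
    using x(4) by (auto simp: Ends_def)
  have "\<exists>j\<in>X. ?y j \<noteq> 0"
  proof (rule ccontr)
    assume "\<not> ?thesis"
    then have n: "x j - x (h out) = 0" if "j \<in> X" for j using that by blast
    show False using n[OF x(1)] n[of "g inn"] x(2) e(1) by simp
  qed
  moreover have "(\<Sum>j\<in>X. link False inn j * ?y j) = 0" "(\<Sum>j\<in>X. link True inn j * ?y j) = 0"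
    using e by simp_all
  ultimately show "\<exists>x. (\<exists>y\<in>X. x y \<noteq> 0) \<and> x (h out) = 0 \<and> invariant W x
    \<and> x (g inn) + x (h inn) - x (f (g inn)) - x (f (h inn)) = 0
    \<and> (\<Sum>j\<in>X. link False inn j * x j) = 0 \<and> (\<Sum>j\<in>X. link True inn j * x j) = 0"
    using invariant_shift[OF x(3), of "x (h out)"] e by (intro exI[of _ ?y]) simp
qed

text \<open>The connections at the crossings form four paths from the outgoing to the incoming ends of the
  two holes, together with some cycles. Degeneracy at \<open>b\<close> says that some path or cycle does not
  reach \<open>b\<close>. If all of them do, then the two paths that start at \<open>a\<close> end at \<open>b\<close>, so that all
  paths reach \<open>a\<close> as well.\<close>

lemma degenerate_exchange:
  assumes W: "W \<subseteq> K" and ab: "{a, b} = {out, inn}" and deg: "degenerate W a"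
  shows "degenerate W b"
proof (rule ccontr)
  assume nb: "\<not> degenerate W b"
  have WI: "W \<subseteq> I" using W by auto
  have ab': "a \<in> I" "b \<in> I" "a \<notin> K" "b \<notin> K" "a \<noteq> b" "a \<notin> W" "b \<notin> W"
    using ab K W by (auto simp: doubleton_eq_iff)
  have Iab: "I = insert a (insert b K)" using ab by (auto simp: I doubleton_eq_iff)
  let ?s = "strand W"
  have s: "?s permutes X" by (rule strand_permutes[OF WI])
  have sinj: "?s u = ?s v \<longleftrightarrow> u = v" for u v using permutes_inj[OF s] by (auto simp: inj_eq)
  have sX: "?s u \<in> X \<longleftrightarrow> u \<in> X" for u by (rule permutes_in_image[OF s])
  define P where "P = g ` K \<union> h ` K"
  define S where "S c = {g c, h c}" for c
  have X_split: "X = P \<union> S a \<union> S b" unfolding X P_def S_def Iab by auto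
  have nP: "u \<notin> P" if "u \<in> S a \<union> S b" for u
  proof -
    have KI: "K \<subseteq> I" by auto
    have "g c \<notin> P" "h c \<notin> P" if c: "c \<in> I" "c \<notin> K" for c
      using c(2) g_image[OF c(1) KI] g_h_image[OF c(1) KI] h_image[OF c(1) KI] h_g_image[OF c(1) KI]
      by (simp_all only: P_def Un_iff simp_thms)
    from this[OF ab'(1,3)] this[OF ab'(2,4)] that show ?thesis
      unfolding S_def by (elim UnE insertE emptyE) simp_all
  qed
  have Sd: "S a \<inter> S b = {}"
    using ab'(5) g_eq[OF ab'(1,2)] h_eq[OF ab'(1,2)] g_neq_h[OF ab'(1,2)] g_neq_h[OF ab'(2,1)]
    by (auto simp: S_def)
  have Ends: "Ends c = S c \<union> ?s ` S c" if "c = a \<or> c = b" for c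
    using that ab' WI by (auto simp: Ends_def S_def strand_g strand_h)
  have inv_iff: "invariant W x \<longleftrightarrow> (\<forall>u\<in>P. x (?s u) = x u)" for x
    by (auto simp: invariant_def P_def)
  \<comment> \<open>The indicator of a union of whole strands is invariant. If it missed all ends of
    \<open>b\<close>, it would show degeneracy at \<open>b\<close>.\<close>
  have reach: "\<exists>u\<in>L \<inter> X. u \<in> Ends b"
    if L: "z \<in> L" "z \<in> X" "\<And>u. u \<in> P \<Longrightarrow> ?s u \<in> L \<longleftrightarrow> u \<in> L" for L z
  proof (rule ccontr)
    assume n: "\<not> ?thesis"
    have EX: "Ends b \<subseteq> X" using ab' by (auto simp: Ends_def)
    let ?x = "\<lambda>u. if u \<in> L then 1 else 0 :: complex"
    have "\<exists>y\<in>X. ?x y \<noteq> 0" using L by auto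
    moreover have "invariant W ?x" unfolding inv_iff using L by simp
    moreover have "\<forall>y\<in>Ends b. ?x y = 0" using n EX by auto
    ultimately have "degenerate W b" unfolding degenerate_def by (intro exI[of _ ?x] conjI)
    then show False using nb by blast
  qed
  \<comment> \<open>Following \<open>nxt\<close> traces a strand through the crossings and stops at
    the first incoming end of a hole.\<close>
  define nxt where "nxt u = (if u \<in> P then ?s u else u)" for u
  define path where "path t = orb {nxt} t" for t
  have path_step: "nxt u \<in> path t" if "u \<in> path t" for u t
    using that by (auto simp: path_def intro: orb_step)
  have path_back: "u = t \<or> (\<exists>v\<in>path t \<inter> P. u = ?s v)" if "u \<in> path t" for u t
    using that unfolding path_def
  proof (induction rule: orb_induct)
    case (step z k)
    show ?case
    proof (cases "z \<in> P")
      case True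
      then have "k z = ?s z" using step.hyps by (simp add: nxt_def)
      then show ?thesis using step.hyps True by blast
    next
      case False
      then have "k z = z" using step.hyps by (simp add: nxt_def)
      then show ?thesis using step.IH by (simp only:)
    qed
  qed simp
  have source: "t \<noteq> ?s v" if "t \<in> ?s ` S a" "v \<in> P" for t v
    using that nP sinj by auto
  have path_closed: "?s u \<in> path t \<longleftrightarrow> u \<in> path t" if t: "t \<in> ?s ` S a" and u: "u \<in> P" for t u
  proof
    assume "?s u \<in> path t"
    then obtain v where "v \<in> path t" "?s u = ?s v" using path_back source[OF t u] by blast
    then show "u \<in> path t" using sinj by simp
  next
    assume "u \<in> path t"
    then show "?s u \<in> path t" using path_step[of u t] u by (simp add: nxt_def)
  qed
  have path_end: "\<exists>u\<in>path t. u \<in> S b" if t: "t \<in> ?s ` S a" for t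
  proof -
    obtain w where w: "w \<in> S a" "t = ?s w" using t by blast
    then have "w \<in> X" unfolding X_split by blast
    then have "t \<in> X" unfolding w(2) sX .
    moreover have "t \<in> path t" by (simp add: path_def)
    ultimately obtain u where u: "u \<in> path t" "u \<in> Ends b"
      using reach[of t "path t"] path_closed[OF t] by blast
    \<comment> \<open>An outgoing end of \<open>b\<close> has an incoming end of \<open>b\<close> as
      its predecessor, whereas every point of the path is its start or has a predecessor at a
      crossing.\<close>
    have "u \<notin> ?s ` S b"
    proof
      assume "u \<in> ?s ` S b"
      then obtain v where v: "v \<in> S b" "u = ?s v" by blast
      from path_back[OF u(1)] show False
      proof
        assume "u = t"
        then have "v = w" using v(2) w(2) sinj by simp
        then show False using v(1) w(1) Sd by blast
      next
        assume "\<exists>w\<in>path t \<inter> P. u = ?s w"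
        then have "v \<in> P" using v(2) sinj by auto
        then show False using nP v(1) by blast
      qed
    qed
    then show ?thesis using u Ends by blast
  qed
  have path_disjoint: "u \<notin> path t'" if t: "t \<in> ?s ` S a" "t' \<in> ?s ` S a" "t \<noteq> t'" and u: "u \<in> path t" for t t' u
    using u unfolding path_def[of t]
  proof (induction rule: orb_induct)
    case base
    show ?case using path_back[of t t'] t source[OF t(1)] by blast
  next
    case (step z k)
    then show ?case using path_closed[OF t(2), of z] by (cases "z \<in> P") (auto simp: nxt_def)
  qed
  obtain x z where x: "z \<in> X" "x z \<noteq> 0" "invariant W x" "\<forall>y\<in>Ends a. x y = (0::complex)"
    using deg unfolding degenerate_def by blast
  have x0: "x u = 0" if t: "t \<in> ?s ` S a" and u: "u \<in> path t" for t u
    using u unfolding path_def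
  proof (induction rule: orb_induct)
    case base
    show ?case using x(4) t Ends by blast
  next
    case (step z k)
    then show ?case using x(3) unfolding inv_iff by (auto simp: nxt_def)
  qed
  have "x u = 0" if u: "u \<in> S b" for u
  proof -
    have t: "?s (g a) \<in> ?s ` S a" "?s (h a) \<in> ?s ` S a" "?s (g a) \<noteq> ?s (h a)"
      using ab' g_neq_h sinj by (auto simp: S_def)
    obtain v w where v: "v \<in> path (?s (g a))" "v \<in> S b" and w: "w \<in> path (?s (h a))" "w \<in> S b"
      using path_end t by meson
    have "v \<noteq> w" using path_disjoint[OF t v(1)] w(1) by blast
    then have "u = v \<or> u = w" using u v(2) w(2) by (auto simp: S_def)
    then show ?thesis using x0[OF t(1) v(1)] x0[OF t(2) w(1)] by blast
  qed
  moreover have "x u = 0" if "u \<in> S a" for u using that x(4) Ends by blast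
  ultimately have xS: "x u = 0" if "u \<in> S a \<union> S b" for u using that by blast
  \<comment> \<open>The rest of the support lies at crossings only and is permuted by
    \<open>?s\<close>, so it cannot contain an outgoing end of \<open>b\<close>, whose predecessor
    is at the hole.\<close>
  define L where "L = {u\<in>X. x u \<noteq> 0}"
  have LP: "L \<subseteq> P" using xS unfolding L_def X_split by blast
  have "?s ` L \<subseteq> L" using LP x(3) sX unfolding inv_iff L_def by auto
  moreover have "finite L" by (simp add: L_def)
  moreover have "inj_on ?s L" using sinj by (auto simp: inj_on_def)
  ultimately have sL: "?s ` L = L" by (simp add: endo_inj_surj)
  have xE: "x u = 0" if "u \<in> Ends b" for u
  proof (rule ccontr)
    assume nz: "x u \<noteq> 0"
    then have "u \<notin> S b" using xS[of u] by auto
    moreover have "Ends b = S b \<union> ?s ` S b" by (rule Ends) simp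
    ultimately have "u \<in> ?s ` S b" using that by simp
    then obtain v where v: "v \<in> S b" "u = ?s v" by (rule imageE)
    have "v \<in> X" using v(1) unfolding X_split by blast
    then have "u \<in> L" using nz v(2) sX by (simp add: L_def)
    then obtain w where "w \<in> L" "u = ?s w" using sL by blast
    then have "v \<in> P" using v(2) sinj LP by auto
    then show False using nP v(1) by blast
  qed
  have "degenerate W b" unfolding degenerate_def
    by (intro exI[of _ x] conjI bexI[of _ z] ballI x xE)
  then show False using nb by blast
qed

section \<open>The factorization of the determinant of the four closures\<close>

lemma unit_Ints: "unit y j \<in> \<int>"
  by (simp add: unit_def)

lemma node_det_Ints:
  assumes "\<And>c j. c \<in> I \<Longrightarrow> u c j \<in> \<int>"
  shows "node_det u \<in> \<int>"
  unfolding node_det_def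
proof (rule sdet_Ints)
  fix i j assume "i \<in> X"
  then show "rows u i j \<in> \<int>"
  proof (cases rule: X_cases)
    case (2 c)
    then show ?thesis by (cases "c = out") (auto simp: rows_h rows_ho balance_def intro!: unit_Ints Ints_add Ints_diff)
  qed (simp add: rows_g assms)
qed simp

text \<open>For a diagram without loops and \<open>w = - \<i>\<close>, this is the bracket of a
  closure up to a power of \<open>A\<close>. The set \<open>E\<close> contains the holes where the
  reference filling is exchanged.\<close>

definition closure_sum :: "complex \<Rightarrow> 'b set \<Rightarrow> complex" where
  "closure_sum w E = (\<Sum>W\<in>Pow K. w ^ card W * of_int (cyclic (W \<union> E)))"

text \<open>The Pluecker relation is applied to each single state and, with rows
  \<open>link False c + w * link True c\<close> at the crossings, to all states at once. The same
  \<open>p\<close> and \<open>p'\<close> occur in both, so the two factors can be compared term by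
  term.\<close>

theorem closure_sums_product:
  obtains p p' :: "'b set \<Rightarrow> int"
  where "\<And>W. W \<subseteq> K \<Longrightarrow> p W * p' W
      = cyclic W * cyclic (W \<union> {out, inn}) - cyclic (W \<union> {inn}) * cyclic (W \<union> {out})"
    and "\<And>W. W \<subseteq> K \<Longrightarrow> p W = 0 \<longleftrightarrow> p' W = 0"
    and "\<And>w. closure_sum w {} * closure_sum w {out, inn} - closure_sum w {inn} * closure_sum w {out}
      = (\<Sum>W\<in>Pow K. w ^ card W * of_int (p W)) * (\<Sum>W\<in>Pow K. w ^ card W * of_int (p' W))"
proof -
  \<comment> \<open>The families \<open>v\<close> and \<open>v'\<close> list the two rows of
    \<open>out\<close> and of \<open>inn\<close>. One row of each gives a closure; \<open>p\<close>
    uses both rows of \<open>out\<close>, \<open>p'\<close> both rows of \<open>inn\<close>.\<close>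
  define G where "G W a b = node_det ((base W)(out := a, inn := b))" for W a b
  define v where "v b = link b out" for b
  define v' where "v' b = link b inn" for b
  have Gint: "G W a b \<in> \<int>" if "\<And>j. a j \<in> \<int>" "\<And>j. b j \<in> \<int>" for W a b
    unfolding G_def by (rule node_det_Ints)
      (use that in \<open>auto simp: base_def flat_def link_def intro!: unit_Ints Ints_diff\<close>)
  have vint: "v b j \<in> \<int>" "v' b j \<in> \<int>" for b j
    by (auto simp: v_def v'_def link_def intro!: unit_Ints Ints_diff)
  have "\<exists>p. \<forall>W. G W (v False) (v True) = of_int (p W)"
    using Gint vint by (intro choice) (metis Ints_cases)
  then obtain p where p: "\<And>W. G W (v False) (v True) = of_int (p W)" by blast
  have "\<exists>p. \<forall>W. G W (v' False) (v' True) = of_int (p W)"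
    using Gint vint by (intro choice) (metis Ints_cases)
  then obtain p' where p': "\<And>W. G W (v' False) (v' True) = of_int (p' W)" by blast
  have cyc: "G W (v a) (v' b) = of_int (cyclic (W \<union> ((if a then {out} else {}) \<union> (if b then {inn} else {}))))"
    if W: "W \<subseteq> K" for W a b
  proof -
    let ?E = "(if a then {out} else {}) \<union> (if b then {inn} else {})"
    have n: "out \<notin> W" "inn \<notin> W" using W K by auto
    have "W \<union> ?E \<subseteq> I" using W by auto
    then have "of_int (cyclic (W \<union> ?E)) = node_det (flat (W \<union> ?E))"
      by (rule node_det_flat[symmetric])
    also have "\<dots> = G W (v a) (v' b)"
      unfolding G_def using K
      by (intro node_det_cong) (auto simp: n I flat_def base_def v_def v'_def)
    finally show ?thesis ..
  qed
  define mixed where "mixed w c = (if c \<in> K then \<lambda>j. link False c j + w * link True c j else (\<lambda>_. 0))" for w c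
  have expand: "node_det ((mixed w)(out := a, inn := b)) = (\<Sum>W\<in>Pow K. w ^ card W * G W a b)" for w a b
  proof -
    let ?u = "(\<lambda>_ _. 0)(out := a, inn := b)"
    have KI: "K \<subseteq> I" by auto
    have "(mixed w)(out := a, inn := b)
        = (\<lambda>c. if c \<in> K then \<lambda>j. link False c j + w * link True c j else ?u c)"
      using K by (auto simp: mixed_def fun_eq_iff)
    then have "node_det ((mixed w)(out := a, inn := b))
        = (\<Sum>W\<in>Pow K. w ^ card W * node_det (\<lambda>c. if c \<in> K then flat W c else ?u c))"
      by (simp only: node_det_expand[OF KI])
    moreover have "(\<lambda>c. if c \<in> K then flat W c else ?u c) = (base W)(out := a, inn := b)" for W
      using K by (auto simp: base_def fun_eq_iff)
    ultimately show ?thesis by (simp add: G_def)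
  qed
  have pl: "G W (v False) (v' False) * G W (v True) (v' True) - G W (v False) (v' True) * G W (v True) (v' False)
      = G W (v False) (v True) * G W (v' False) (v' True)" for W
    unfolding G_def by (rule node_det_plucker)
  show thesis
  proof (rule that)
    fix W assume W: "W \<subseteq> K"
    have "complex_of_int (p W * p' W)
      = of_int (cyclic W * cyclic (W \<union> {out, inn}) - cyclic (W \<union> {inn}) * cyclic (W \<union> {out}))"
      using pl[of W] unfolding cyc[OF W] p p' by (simp add: insert_commute)
    then show "p W * p' W
      = cyclic W * cyclic (W \<union> {out, inn}) - cyclic (W \<union> {inn}) * cyclic (W \<union> {out})"
      by (simp only: of_int_eq_iff)
    have "p W = 0 \<longleftrightarrow> degenerate W out"
      using node_det_out_eq_0_iff[OF W] p[of W] by (simp add: G_def v_def)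
    also have "\<dots> \<longleftrightarrow> degenerate W inn"
      using degenerate_exchange[OF W] by blast
    also have "\<dots> \<longleftrightarrow> p' W = 0"
      using node_det_inn_eq_0_iff[OF W] p'[of W] by (simp add: G_def v'_def)
    finally show "p W = 0 \<longleftrightarrow> p' W = 0" .
  next
    fix w
    have e: "node_det ((mixed w)(out := v a, inn := v' b))
        = closure_sum w ((if a then {out} else {}) \<union> (if b then {inn} else {}))" for a b
      unfolding expand closure_sum_def by (intro sum.cong refl) (simp only: cyc PowD)
    have "closure_sum w {} * closure_sum w {out, inn} - closure_sum w {inn} * closure_sum w {out}
        = node_det ((mixed w)(out := v False, inn := v' False)) * node_det ((mixed w)(out := v True, inn := v' True))
        - node_det ((mixed w)(out := v False, inn := v' True)) * node_det ((mixed w)(out := v True, inn := v' False))"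
      unfolding e by (simp add: insert_commute)
    also have "\<dots> = node_det ((mixed w)(out := v False, inn := v True))
        * node_det ((mixed w)(out := v' False, inn := v' True))"
      by (rule node_det_plucker)
    also have "\<dots> = (\<Sum>W\<in>Pow K. w ^ card W * of_int (p W)) * (\<Sum>W\<in>Pow K. w ^ card W * of_int (p' W))"
      unfolding expand p p' ..
    finally show "closure_sum w {} * closure_sum w {out, inn} - closure_sum w {inn} * closure_sum w {out}
      = (\<Sum>W\<in>Pow K. w ^ card W * of_int (p W)) * (\<Sum>W\<in>Pow K. w ^ card W * of_int (p' W))" .
  qed
qed

end

section \<open>Pairs of fixed point free involutions\<close>

text \<open>The maps of a diagram matter only on its darts, but \<open>permutes\<close> requires the
  identity elsewhere.\<close>

definition on_set :: "'a set \<Rightarrow> ('a \<Rightarrow> 'a) \<Rightarrow> 'a \<Rightarrow> 'a" where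
  "on_set D f x = (if x \<in> D then f x else x)"

lemma on_set_in [simp]: "x \<in> D \<Longrightarrow> on_set D f x = f x"
  by (simp add: on_set_def)

lemma on_set_permutes:
  assumes "finite D" "\<And>x. x \<in> D \<Longrightarrow> f x \<in> D" "inj_on f D"
  shows "on_set D f permutes D"
proof (rule bij_imp_permutes)
  have "f ` D = D" using assms by (intro endo_inj_surj) auto
  then have "bij_betw f D D" using assms(3) by (simp add: bij_betw_def)
  then show "bij_betw (on_set D f) D D" by (subst bij_betw_cong[where g = f]) simp_all
qed (simp add: on_set_def)

lemma orbits_on_set:
  assumes "\<And>f x. f \<in> fs \<Longrightarrow> x \<in> D \<Longrightarrow> f x \<in> D"
  shows "orbits (on_set D ` fs) D = orbits fs D"
  by (rule orbits_cong[symmetric]) (use assms in \<open>auto simp: image_iff\<close>)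

lemma card_orbits_involution:
  assumes a: "a permutes X" "finite X" and inv: "\<And>x. x \<in> X \<Longrightarrow> a (a x) = x" "\<And>x. x \<in> X \<Longrightarrow> a x \<noteq> x"
  shows "card X = 2 * card (orbits {a} X)"
proof -
  have p: "f permutes X" if "f \<in> {a}" for f using that a by simp
  have o: "orb {a} x = {x, a x}" if x: "x \<in> X" for x
  proof
    show "orb {a} x \<subseteq> {x, a x}" by (rule orb_subset) (use inv x in auto)
    show "{x, a x} \<subseteq> orb {a} x" by (auto intro: orb_step)
  qed
  have U: "\<Union> (orbits {a} X) = X"
    using o permutes_in_image[OF a(1)] by (auto simp: orbits_orb)
  have "2 * card (orbits {a} X) = card (\<Union> (orbits {a} X))"
  proof (rule card_partition)
    show "finite (orbits {a} X)" using a by (simp add: orbits_orb)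
    show "finite (\<Union> (orbits {a} X))" using a U by simp
    show "card c = 2" if c: "c \<in> orbits {a} X" for c
    proof -
      obtain x where x: "x \<in> X" "c = {x, a x}" using c o by (auto simp: orbits_orb)
      then have "x \<noteq> a x" using inv(2)[of x] by metis
      then show ?thesis using x(2) by simp
    qed
    show "c1 \<inter> c2 = {}" if c12: "c1 \<in> orbits {a} X" "c2 \<in> orbits {a} X" "c1 \<noteq> c2" for c1 c2
    proof (rule ccontr)
      assume "c1 \<inter> c2 \<noteq> {}"
      then obtain z where z: "z \<in> c1" "z \<in> c2" by blast
      obtain x y where xy: "c1 = orb {a} x" "c2 = orb {a} y" using c12 by (auto simp: orbits_orb)
      have "orb {a} z = c1" "orb {a} z = c2"
        unfolding xy by (rule orb_eq[where X = X]; use a z xy in blast)+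
      then show False using c12 by simp
    qed
  qed
  then show ?thesis using U by simp
qed

text \<open>The cycle of \<open>x\<close> under \<open>a \<circ> b\<close> together with its image
  under \<open>b\<close> is closed under both involutions, and that image has the opposite colour
  throughout.\<close>

lemma alternating_connected:
  fixes c :: "'a \<Rightarrow> bool"
  assumes a: "a permutes D" "b permutes D" "finite D"
    and inv: "\<And>x. x \<in> D \<Longrightarrow> a (a x) = x" "\<And>x. x \<in> D \<Longrightarrow> b (b x) = x"
    and col: "\<And>x. x \<in> D \<Longrightarrow> c (a x) \<noteq> c x" "\<And>x. x \<in> D \<Longrightarrow> c (b x) \<noteq> c x"
    and x: "x \<in> D" and y: "y \<in> orb {a, b} x" "c y = c x"
  shows "y \<in> orb {a \<circ> b} x"
proof -
  let ?f = "a \<circ> b"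
  have aD: "a z \<in> D" and bD: "b z \<in> D" if "z \<in> D" for z
    using that permutes_in_image[OF a(1)] permutes_in_image[OF a(2)] by simp_all
  have f: "?f permutes D" using a by (intro permutes_compose)
  have same: "z \<in> D \<and> c z = c x" if "z \<in> orb {?f} x" for z
    using that
  proof (induction rule: orb_induct)
    case (step z g)
    then show ?case using aD bD col by auto
  qed (use x in simp)
  let ?Z = "orb {?f} x"
  have "orb {a, b} x \<subseteq> ?Z \<union> b ` ?Z"
  proof (rule orb_subset)
    fix g z assume g: "g \<in> {a, b}" and z: "z \<in> ?Z \<union> b ` ?Z"
    show "g z \<in> ?Z \<union> b ` ?Z"
    proof (cases "z \<in> ?Z")
      case True
      obtain w where w: "w \<in> ?Z" "z = ?f w"
      proof -
        have "z \<in> ?f ` ?Z"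
        proof -
          have "?f ` ?Z = ?Z"
          proof (rule endo_inj_surj)
            show "finite ?Z" using same a(3) finite_subset[of ?Z D] by blast
            show "?f ` ?Z \<subseteq> ?Z" by (intro image_subsetI orb_step[where f = ?f] insertI1)
            show "inj_on ?f ?Z" using permutes_inj[OF f] by (rule inj_on_subset) simp
          qed
          then show ?thesis using True by simp
        qed
        then show thesis using that by blast
      qed
      have "a z = b w" using w same inv bD by simp
      then have "a z \<in> b ` ?Z" using w by simp
      moreover have "b z \<in> b ` ?Z" using True by simp
      ultimately show ?thesis using g by blast
    next
      case False
      then obtain w where w: "w \<in> ?Z" "z = b w" using z by blast
      have "b z = w" using w same inv by simp
      moreover have "?f w \<in> ?Z" by (rule orb_step[OF w(1) singletonI])
      then have "a z \<in> ?Z" using w by simp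
      ultimately show ?thesis using g w by blast
    qed
  qed simp
  then show ?thesis using y same col by blast
qed

lemma card_orbits_alternating:
  fixes c :: "'a \<Rightarrow> bool"
  assumes a: "a permutes D" "b permutes D" "finite D"
    and inv: "\<And>x. x \<in> D \<Longrightarrow> a (a x) = x" "\<And>x. x \<in> D \<Longrightarrow> b (b x) = x"
    and col: "\<And>x. x \<in> D \<Longrightarrow> c (a x) \<noteq> c x" "\<And>x. x \<in> D \<Longrightarrow> c (b x) \<noteq> c x"
    and g: "g permutes {x \<in> D. c x}" "\<And>x. x \<in> D \<Longrightarrow> c x \<Longrightarrow> g x = a (b x)"
  shows "card (orbits {a, b} D) = 1 \<longleftrightarrow> card (orbits {g} {x \<in> D. c x}) = 1"
proof -
  let ?X = "{x \<in> D. c x}"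
  have aD: "a z \<in> D" and bD: "b z \<in> D" if "z \<in> D" for z
    using that permutes_in_image[OF a(1)] permutes_in_image[OF a(2)] by simp_all
  have pab: "f permutes D" if "f \<in> {a, b}" for f using that a by auto
  have pg: "f permutes ?X" if "f \<in> {g}" for f using that g by auto
  have e: "orb {g} x = orb {a \<circ> b} x" if "x \<in> ?X" for x
  proof (rule orb_cong[OF that])
    show "(\<lambda>f. f z) ` {g} = (\<lambda>f. f z) ` {a \<circ> b}" if "z \<in> ?X" for z using that g by simp
    show "f z \<in> ?X" if "f \<in> {g}" "z \<in> ?X" for f z
      using that permutes_in_image[OF g(1), of z] by simp
  qed
  have sub: "orb {a \<circ> b} x \<subseteq> orb {a, b} x" for x
  proof (rule orb_subset)
    fix f z assume f: "f \<in> {a \<circ> b}" and z: "z \<in> orb {a, b} x"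
    have "b z \<in> orb {a, b} x" by (rule orb_step[OF z]) simp
    then have "a (b z) \<in> orb {a, b} x" by (rule orb_step) simp
    then show "f z \<in> orb {a, b} x" using f by simp
  qed simp
  have n: "D \<noteq> {} \<longleftrightarrow> ?X \<noteq> {}" using aD col by blast
  have "(\<forall>x\<in>D. \<forall>y\<in>D. y \<in> orb {a, b} x) \<longleftrightarrow> (\<forall>x\<in>?X. \<forall>y\<in>?X. y \<in> orb {g} x)"
  proof (intro iffI ballI)
    fix x y assume conn: "\<forall>x\<in>D. \<forall>y\<in>D. y \<in> orb {a, b} x" and xy: "x \<in> ?X" "y \<in> ?X"
    have "y \<in> orb {a \<circ> b} x"
      by (rule alternating_connected[where c = c and D = D]) (use assms conn xy in auto)
    then show "y \<in> orb {g} x" using e xy by simp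
  next
    fix x y assume conn: "\<forall>x\<in>?X. \<forall>y\<in>?X. y \<in> orb {g} x" and xy: "x \<in> D" "y \<in> D"
    have ex: "\<exists>x'\<in>?X. x' \<in> orb {a, b} x" if "x \<in> D" for x
      using that aD[OF that] col[OF that] orb_step[of x "{a, b}" x a] by (cases "c x") auto
    obtain x' y' where x': "x' \<in> ?X" "x' \<in> orb {a, b} x" and y': "y' \<in> ?X" "y' \<in> orb {a, b} y"
      using ex xy by meson
    have "y' \<in> orb {g} x'" using conn x' y' by blast
    then have "y' \<in> orb {a, b} x'" unfolding e[OF x'(1)] by (rule subsetD[OF sub])
    moreover have "y \<in> orb {a, b} y'"
      by (rule orb_sym[where X = D]) (use a y'(2) in blast)+
    ultimately show "y \<in> orb {a, b} x" using x'(2) orb_trans by metis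
  qed
  moreover have "card (orbits {a, b} D) = 1 \<longleftrightarrow> D \<noteq> {} \<and> (\<forall>x\<in>D. \<forall>y\<in>D. y \<in> orb {a, b} x)"
    by (rule orbits_card_1) (use a in blast)+
  moreover have "card (orbits {g} ?X) = 1 \<longleftrightarrow> ?X \<noteq> {} \<and> (\<forall>x\<in>?X. \<forall>y\<in>?X. y \<in> orb {g} x)"
    by (rule orbits_card_1) (use g(1) a(3) in auto)
  ultimately show ?thesis using n by (simp only:)
qed

section \<open>Spherical tangle diagrams\<close>

fun smoothing :: "nat set \<Rightarrow> 2 \<Rightarrow> 2 \<Rightarrow> endpoint dart \<Rightarrow> endpoint dart" where
  "smoothing W j k (Cross m e) = Cross m (split_crossing (if m \<in> W then B_type else A_type) e)"
| "smoothing W j k (End p) = End (closing_arcs j k p)"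

lemma split_crossing_involution [simp]: "split_crossing s (split_crossing s e) = e"
  by (cases s; cases e) simp_all

lemma split_crossing_neq [simp]: "split_crossing s e \<noteq> e"
  by (cases s; cases e) simp_all

lemma closing_arcs_involution [simp]: "closing_arcs j k (closing_arcs j k p) = p"
proof (cases p)
  case (Outer q) then show ?thesis by (cases q) simp_all
next
  case (Inner q) then show ?thesis by (cases q) simp_all
qed

lemma closing_arcs_neq [simp]: "closing_arcs j k p \<noteq> p"
proof (cases p)
  case (Outer q) then show ?thesis by (cases q) simp_all
next
  case (Inner q) then show ?thesis by (cases q) simp_all
qed

lemma smoothing_involution [simp]: "smoothing W j k (smoothing W j k x) = x"
  by (cases x) simp_all

lemma smoothing_neq [simp]: "smoothing W j k x \<noteq> x"
  by (cases x) simp_all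

text \<open>Interpolates between \<open>rot\<close> and a state in which only the two holes are left
  as vertices of degree 4.\<close>

fun partial_smoothing :: "nat set \<Rightarrow> nat set \<Rightarrow> endpoint dart \<Rightarrow> endpoint dart" where
  "partial_smoothing W J (Cross m e) = Cross m
     (if m \<in> J then split_crossing (if m \<in> W then B_type else A_type) e else ccw_end e)"
| "partial_smoothing W J (End p) = rot (End p)"

lemma rot_4 [simp]: "rot (rot (rot (rot x))) = x"
proof (cases x)
  case (Cross m e) then show ?thesis by (cases e) simp_all
next
  case (End p)
  then show ?thesis
  proof (cases p)
    case (Outer q) then show ?thesis using End by (cases q) simp_all
  next
    case (Inner q) then show ?thesis using End by (cases q) simp_all
  qed
qed

lemma inj_rot: "inj rot"
  by (rule injI) (metis rot_4)

lemma partial_smoothing_empty: "partial_smoothing W {} = rot"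
proof
  fix x show "partial_smoothing W {} x = rot x" by (cases x) simp_all
qed

text \<open>Alternates around each vertex, regardless of the arcs; it witnesses that all vertices
  have even degree.\<close>

fun vertex_colour :: "endpoint dart \<Rightarrow> bool" where
  "vertex_colour (Cross m e) \<longleftrightarrow> e \<in> {U1, U2}"
| "vertex_colour (End (Outer p)) \<longleftrightarrow> p \<in> {NW, SE}"
| "vertex_colour (End (Inner p)) \<longleftrightarrow> p \<in> {NW, SE}"

lemma vertex_colour_rot: "vertex_colour (rot x) \<noteq> vertex_colour x"
proof (cases x)
  case (Cross m e) then show ?thesis by (cases e) simp_all
next
  case (End p)
  then show ?thesis
  proof (cases p)
    case (Outer q) then show ?thesis using End by (cases q) simp_all
  next
    case (Inner q) then show ?thesis using End by (cases q) simp_all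
  qed
qed

lemma UNIV_strand_end: "(UNIV :: strand_end set) = {U1, O1, U2, O2}"
  using strand_end.exhaust by blast

lemma UNIV_corner: "(UNIV :: corner set) = {NW, NE, SE, SW}"
  using corner.exhaust by blast

lemma UNIV_endpoint: "(UNIV :: endpoint set) = range Outer \<union> range Inner"
  using endpoint.exhaust by blast

lemma finite_darts: "finite (darts (S :: tangle))"
proof -
  have "darts S = (\<lambda>(m, e). Cross m e) ` ({..<crossings S} \<times> UNIV) \<union> range End"
    by (auto simp: darts_def)
  moreover have "finite (UNIV :: strand_end set)" by (simp add: UNIV_strand_end)
  moreover have "finite (UNIV :: endpoint set)" by (simp add: UNIV_endpoint UNIV_corner)
  ultimately show ?thesis by simp
qed

lemma Cross_darts [simp]: "Cross m e \<in> darts S \<longleftrightarrow> m < crossings S" and End_darts [simp]: "End p \<in> darts S"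
  by (auto simp: darts_def)

lemma smoothing_darts [simp]: "smoothing W j k x \<in> darts S \<longleftrightarrow> x \<in> darts S"
  by (cases x) simp_all

lemma partial_smoothing_darts [simp]: "partial_smoothing W J x \<in> darts S \<longleftrightarrow> x \<in> darts S"
proof (cases x)
  case (End p) then show ?thesis by (cases p) simp_all
qed simp

lemma tangle_arcs:
  assumes "spherical_tangle_diagram S"
  shows "on_set (darts S) (arcs S) permutes darts S"
    and "x \<in> darts S \<Longrightarrow> arcs S x \<in> darts S" "x \<in> darts S \<Longrightarrow> arcs S (arcs S x) = x"
    and "x \<in> darts S \<Longrightarrow> arcs S x \<noteq> x"
proof -
  have a: "arcs S x \<in> darts S" "arcs S x \<noteq> x" "arcs S (arcs S x) = x" if "x \<in> darts S" for x
    using assms that by (auto simp: spherical_tangle_diagram_def)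
  then show "x \<in> darts S \<Longrightarrow> arcs S x \<in> darts S" "x \<in> darts S \<Longrightarrow> arcs S (arcs S x) = x"
    "x \<in> darts S \<Longrightarrow> arcs S x \<noteq> x" by auto
  show "on_set (darts S) (arcs S) permutes darts S"
    by (rule on_set_permutes[OF finite_darts]) (use a in \<open>auto simp: inj_on_def, metis\<close>)
qed

lemma rot_darts [simp]: "rot x \<in> darts S \<longleftrightarrow> x \<in> darts S"
  using partial_smoothing_darts[of "{}" "{}" x S] by (simp add: partial_smoothing_empty)

lemma rot_permutes: "on_set (darts S) rot permutes darts (S :: tangle)"
  by (rule on_set_permutes[OF finite_darts]) (use inj_rot in \<open>auto simp: inj_on_def inj_def\<close>)

text \<open>The arcs pair the darts, so \<open>card D\<close> minus the number of edges is again the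
  number of edges, and the Euler relation of the definition turns into genus 0.\<close>

lemma genus_tangle:
  assumes "spherical_tangle_diagram S"
  shows "genus (darts S) (on_set (darts S) rot) (on_set (darts S) (arcs S)) = 0"
proof -
  let ?D = "darts S" and ?a = "on_set (darts S) (arcs S)" and ?r = "on_set (darts S) rot"
  note a = tangle_arcs[OF assms]
  have "card ?D = 2 * card (orbits {?a} ?D)"
    by (rule card_orbits_involution[OF a(1) finite_darts]) (use a in auto)
  moreover have "orbits (on_set ?D ` fs) ?D = orbits fs ?D" if "fs \<subseteq> {rot, arcs S}" for fs
    by (rule orbits_on_set) (use a that in auto)
  from this[of "{arcs S}"] this[of "{rot}"] this[of "{rot, arcs S}"]
  have "orbits {?a} ?D = orbits {arcs S} ?D" "orbits {?r} ?D = orbits {rot} ?D"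
    "orbits {?r, ?a} ?D = orbits {rot, arcs S} ?D" by simp_all
  moreover have "orbits {?r \<circ> ?a} ?D = orbits {rot \<circ> arcs S} ?D"
    by (rule orbits_cong) (use a in auto)
  ultimately show ?thesis
    using assms unfolding genus_def spherical_tangle_diagram_def by simp
qed

lemma darts_nonempty: "darts (S :: tangle) \<noteq> {}"
  by (metis End_darts empty_iff)

section \<open>Tangles with a checkerboard colouring\<close>

locale coloured_tangle =
  fixes S :: tangle and c :: "endpoint dart \<Rightarrow> bool"
  assumes spherical: "spherical_tangle_diagram S"
    and c_rot: "\<And>x. x \<in> darts S \<Longrightarrow> c (rot x) \<noteq> c x"
    and c_arcs: "\<And>x. x \<in> darts S \<Longrightarrow> c (arcs S x) \<noteq> c x"
begin

abbreviation "D \<equiv> darts S"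
abbreviation "\<alpha> \<equiv> on_set D (arcs S)"

lemmas arcs = tangle_arcs[OF spherical]

abbreviation "n \<equiv> crossings S"

lemma smoothing_permutes: "on_set D (smoothing W j k) permutes D"
  by (rule on_set_permutes[OF finite_darts]) (auto simp: inj_on_def, metis smoothing_involution)

lemma c_cross: "m < n \<Longrightarrow> c (Cross m O1) = (\<not> c (Cross m U1)) \<and> c (Cross m U2) = c (Cross m U1)
    \<and> c (Cross m O2) = (\<not> c (Cross m U1))"
  using c_rot[of "Cross m U1"] c_rot[of "Cross m O1"] c_rot[of "Cross m U2"] by auto

lemma c_outer: "c (End (Outer NE)) = (\<not> c (End (Outer NW))) \<and> c (End (Outer SE)) = c (End (Outer NW))
    \<and> c (End (Outer SW)) = (\<not> c (End (Outer NW)))"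
  using c_rot[of "End (Outer NW)"] c_rot[of "End (Outer NE)"] c_rot[of "End (Outer SE)"] by auto

lemma c_inner: "c (End (Inner NE)) = (\<not> c (End (Inner NW))) \<and> c (End (Inner SE)) = c (End (Inner NW))
    \<and> c (End (Inner SW)) = (\<not> c (End (Inner NW)))"
  using c_rot[of "End (Inner NW)"] c_rot[of "End (Inner NE)"] c_rot[of "End (Inner SE)"] by auto

lemma c_smoothing: "x \<in> D \<Longrightarrow> c (smoothing W j k x) \<noteq> c x"
proof (cases x)
  case (Cross m e)
  assume "x \<in> D"
  then have "m < n" using Cross by simp
  then show ?thesis using Cross c_cross[of m] by (cases e) auto
next
  case (End p)
  then show ?thesis
  proof (cases p)
    case (Outer q) then show ?thesis using End c_outer by (cases q) auto
  next
    case (Inner q) then show ?thesis using End c_inner by (cases q) auto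
  qed
qed

text \<open>The transposed darts are opposite ends at the crossing: those of the over-strand for
  A-type, those of the under-strand for B-type. So a splitting divides a vertex of degree 4 into
  two, and the genus cannot rise.\<close>

lemma partial_smoothing_insert:
  assumes "m \<notin> J" "m < n"
  shows "on_set D (partial_smoothing W (insert m J)) = on_set D (partial_smoothing W J) \<circ>
    Transposition.transpose (Cross m (if m \<in> W then U1 else O1)) (Cross m (if m \<in> W then U2 else O2))"
proof
  fix x
  show "on_set D (partial_smoothing W (insert m J)) x = (on_set D (partial_smoothing W J) \<circ>
    Transposition.transpose (Cross m (if m \<in> W then U1 else O1)) (Cross m (if m \<in> W then U2 else O2))) x"
  proof (cases x)
    case (Cross m' e)
    show ?thesis
    proof (cases "m' = m")
      case True
      then show ?thesis using Cross assms
        by (cases "m \<in> W"; cases e) (simp_all add: Transposition.transpose_def on_set_def)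
    next
      case False
      then show ?thesis using Cross assms by (simp add: Transposition.transpose_def on_set_def)
    qed
  next
    case (End p)
    then show ?thesis by (simp add: Transposition.transpose_def on_set_def)
  qed
qed

lemma partial_smoothing_genus:
  assumes "J \<subseteq> {..<n}"
  shows "on_set D (partial_smoothing W J) permutes D \<and>
    genus D (on_set D (partial_smoothing W J)) \<alpha> \<le> 0"
proof -
  have "finite J" using assms finite_subset by auto
  then show ?thesis using assms
  proof (induction J)
    case empty
    show ?case using rot_permutes[of S] genus_tangle[OF spherical] by (simp add: partial_smoothing_empty)
  next
    case (insert m J)
    let ?r = "on_set D (partial_smoothing W J)"
    let ?x = "Cross m (if m \<in> W then U1 else O1)" and ?y = "Cross m (if m \<in> W then U2 else O2)"
    have r: "?r permutes D" "genus D ?r \<alpha> \<le> 0" using insert by auto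
    have xy: "?x \<in> D" "?y \<in> D" "?x \<noteq> ?y" using insert.prems by auto
    have "?r (?r ?x) = ?y" using insert xy by (cases "m \<in> W") auto
    moreover have "?r (?r ?x) \<in> orb {?r} ?x" by (intro orb_step[where f = ?r] singletonI) simp
    ultimately have o: "?y \<in> orb {?r} ?x" by simp
    show ?case
      unfolding partial_smoothing_insert[OF insert(2), of W, OF insert.prems[unfolded insert_subset, THEN conjunct1, unfolded lessThan_iff]]
      using transpose_permutes_compose[OF r(1) xy(1,2)]
        genus_split_le[OF r(1) arcs(1) finite_darts xy o] r(2) by linarith
  qed
qed

text \<open>Filling a hole likewise divides its vertex by transposing two opposite ends, and the
  choice of the pair selects the filling.\<close>

lemma smoothing_transpose:
  defines "x \<equiv> \<lambda>k. End (Inner (if k = (1 :: 2) then SW else NW))"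
    and "y \<equiv> \<lambda>k. End (Inner (if k = (1 :: 2) then NE else SE))"
  shows "on_set D (smoothing W 1 k) = on_set D (partial_smoothing W {..<n})
    \<circ> Transposition.transpose (End (Outer NE)) (End (Outer SW)) \<circ> Transposition.transpose (x k) (y k)"
proof
  fix z
  show "on_set D (smoothing W 1 k) z = (on_set D (partial_smoothing W {..<n})
    \<circ> Transposition.transpose (End (Outer NE)) (End (Outer SW)) \<circ> Transposition.transpose (x k) (y k)) z"
  proof (cases z)
    case (Cross m e)
    then show ?thesis by (simp add: x_def y_def Transposition.transpose_def on_set_def)
  next
    case (End p)
    show ?thesis
    proof (cases p)
      case (Outer q)
      then show ?thesis using End
        by (cases q) (simp_all add: x_def y_def Transposition.transpose_def on_set_def)
    next
      case (Inner q)
      then show ?thesis using End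
        by (cases q; cases "k = 1") (simp_all add: x_def y_def Transposition.transpose_def on_set_def)
    qed
  qed
qed

lemma card_orbits_smoothing:
  "card (orbits {on_set D (smoothing W 1 k)} D) = card (orbits {on_set D (partial_smoothing W {..<n})} D) + 2"
proof -
  let ?r = "on_set D (partial_smoothing W {..<n})"
  let ?p = "End (Outer NE)" and ?q = "End (Outer SW)"
  define x y :: "endpoint dart" where "x = End (Inner (if k = 1 then SW else NW))"
    and "y = End (Inner (if k = 1 then NE else SE))"
  let ?r' = "?r \<circ> Transposition.transpose ?p ?q"
  have r: "?r permutes D" using partial_smoothing_genus[of "{..<n}"] by simp
  then have r': "?r' permutes D" by (intro transpose_permutes_compose) auto
  have two: "g (g z) \<in> orb {g} z" for g :: "endpoint dart \<Rightarrow> endpoint dart" and z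
    by (intro orb_step[where f = g] singletonI) simp
  have "?r (?r ?p) = ?q" by simp
  then have 1: "card (orbits {?r'} D) = card (orbits {?r} D) + 1"
    using orbits_transpose_split[OF r finite_darts, of ?p ?q] two[of ?r ?p] by simp
  have "?r' (?r' x) = y" by (cases "k = 1") (simp_all add: x_def y_def Transposition.transpose_def)
  then have "y \<in> orb {?r'} x" using two[of ?r' x] by metis
  then have 2: "card (orbits {?r' \<circ> Transposition.transpose x y} D) = card (orbits {?r'} D) + 1"
    by (intro orbits_transpose_split[OF r' finite_darts]) (auto simp: x_def y_def)
  show ?thesis using 1 2 unfolding smoothing_transpose x_def y_def by simp
qed

definition same_colour :: bool where
  "same_colour \<longleftrightarrow> c (End (Outer NW)) = c (End (Inner NW))"

text \<open>On alternate ends of a hole \<open>rot\<close> agrees with one filling, on the other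
  ends with the complementary one. \<open>rot\<close> turns in opposite senses at the two circles,
  and \<open>same_colour\<close> tells which fillings belong to the same colour class.\<close>

lemma partial_smoothing_eq:
  assumes "x \<in> D"
  shows "partial_smoothing W {..<n} x =
    (if c x = c (End (Outer NW)) then smoothing W 1 (if same_colour then 1 else 2) x
     else smoothing W 2 (if same_colour then 2 else 1) x)"
proof (cases x)
  case (Cross m e)
  then show ?thesis using assms by simp
next
  case (End p)
  show ?thesis
  proof (cases p)
    case (Outer q)
    then show ?thesis using End c_outer by (cases q) auto
  next
    case (Inner q)
    then show ?thesis using End c_inner by (cases q) (auto simp: same_colour_def)
  qed
qed

text \<open>If all crossings are smoothed, but both holes are kept as vertices, then the faces are the
  circles of two complementary closures. In genus 0 there would have to be four of them.\<close>

lemma not_both_connected: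
  assumes 1: "card (orbits {\<alpha>, on_set D (smoothing W 1 (if same_colour then 1 else 2))} D) = 1"
    and 2: "card (orbits {\<alpha>, on_set D (smoothing W 2 (if same_colour then 2 else 1))} D) = 1"
  shows False
proof -
  let ?r = "on_set D (partial_smoothing W {..<n})"
  let ?s = "on_set D (smoothing W 1 (if same_colour then 1 else 2))"
  let ?s' = "on_set D (smoothing W 2 (if same_colour then 2 else 1))"
  let ?v = "c (End (Outer NW))"
  have r: "?r permutes D" "genus D ?r \<alpha> \<le> 0" using partial_smoothing_genus[of "{..<n}"] by simp_all
  have faces: "orb {?r \<circ> \<alpha>} x = {y \<in> D. c y = c x}" if x: "x \<in> D" for x
  proof -
    \<comment> \<open>When \<open>?r\<close> acts, \<open>\<alpha>\<close> has already changed the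
      colour, so the smoothing belonging to the other colour class is the right one.\<close>
    define t where "t = (if c x = ?v then ?s' else ?s)"
    have t: "t permutes D" "\<And>z. z \<in> D \<Longrightarrow> t (t z) = z" "\<And>z. z \<in> D \<Longrightarrow> c (t z) \<noteq> c z"
      unfolding t_def using smoothing_permutes c_smoothing by auto
    have tr: "t (\<alpha> z) = ?r (\<alpha> z)" if z: "z \<in> {y \<in> D. c y = c x}" for z
    proof -
      have "\<alpha> z \<in> D" "c (\<alpha> z) \<noteq> c x" using z arcs(2) c_arcs by auto
      then show ?thesis using partial_smoothing_eq[of "\<alpha> z" W] by (auto simp: t_def)
    qed
    have closed: "t (\<alpha> z) \<in> {y \<in> D. c y = c x}" if z: "z \<in> {y \<in> D. c y = c x}" for z
    proof -
      have a: "\<alpha> z \<in> D" "c (\<alpha> z) \<noteq> c x" using z arcs(2) c_arcs by auto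
      then show ?thesis using t(3)[OF a(1)] permutes_in_image[OF t(1), of "\<alpha> z"] by auto
    qed
    have "orb {?r \<circ> \<alpha>} x = orb {t \<circ> \<alpha>} x"
    proof (rule orb_cong[where X = "{y \<in> D. c y = c x}"])
      show "(\<lambda>f. f z) ` {?r \<circ> \<alpha>} = (\<lambda>f. f z) ` {t \<circ> \<alpha>}" if "z \<in> {y \<in> D. c y = c x}" for z
        using tr[OF that] by (simp only: image_insert image_empty comp_apply)
      show "f z \<in> {y \<in> D. c y = c x}" if "f \<in> {?r \<circ> \<alpha>}" "z \<in> {y \<in> D. c y = c x}" for f z
        using tr[OF that(2)] closed[OF that(2)] that(1) by (simp only: singleton_iff comp_apply)
    qed (use x in simp)
    also have "\<dots> = {y \<in> D. c y = c x}"
    proof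
      show "orb {t \<circ> \<alpha>} x \<subseteq> {y \<in> D. c y = c x}"
        by (rule orb_subset) (use x closed in \<open>simp_all only: singleton_iff comp_apply mem_Collect_eq simp_thms\<close>)
      show "{y \<in> D. c y = c x} \<subseteq> orb {t \<circ> \<alpha>} x"
      proof
        fix y assume y: "y \<in> {y \<in> D. c y = c x}"
        have p: "f permutes D" if "f \<in> {t, \<alpha>}" for f using that t(1) arcs(1) by auto
        have "{t, \<alpha>} = {\<alpha>, t}" by blast
        then have "card (orbits {t, \<alpha>} D) = 1" using 1 2 by (simp add: t_def)
        then have "y \<in> orb {t, \<alpha>} x"
          using orbits_card_1[of "{t, \<alpha>}" D, OF p finite_darts] x y by blast
        then show "y \<in> orb {t \<circ> \<alpha>} x"
          by (intro alternating_connected[where c = c and D = D])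
            (use t arcs c_arcs x y finite_darts in auto)
      qed
    qed
    finally show ?thesis .
  qed
  let ?p = "End (Outer NW)"
  have "orbits {?r \<circ> \<alpha>} D = {{y \<in> D. c y}, {y \<in> D. \<not> c y}}"
  proof
    show "orbits {?r \<circ> \<alpha>} D \<subseteq> {{y \<in> D. c y}, {y \<in> D. \<not> c y}}"
      unfolding orbits_orb using faces by (auto simp del: on_set_in)
    have "{y \<in> D. c y = c x} \<in> orbits {?r \<circ> \<alpha>} D" if "x \<in> D" for x
      unfolding orbits_orb using faces[OF that] that by blast
    from this[of ?p] this[of "\<alpha> ?p"] c_arcs[of ?p] arcs(2)[of ?p]
    show "{{y \<in> D. c y}, {y \<in> D. \<not> c y}} \<subseteq> orbits {?r \<circ> \<alpha>} D"
      by (cases "c ?p") simp_all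
  qed
  moreover have "{y \<in> D. c y} \<noteq> {y \<in> D. \<not> c y}"
  proof
    assume e: "{y \<in> D. c y} = {y \<in> D. \<not> c y}"
    have "?p \<in> {y \<in> D. c y} \<longleftrightarrow> ?p \<in> {y \<in> D. \<not> c y}" by (simp only: e)
    then show False by simp
  qed
  ultimately have F: "card (orbits {?r \<circ> \<alpha>} D) = 2" by simp
  \<comment> \<open>With 2 faces and 2 vertices fewer than edges the Euler characteristic is 0, but
    genus 0 requires twice the positive number of components.\<close>
  have E: "card D = 2 * card (orbits {\<alpha>} D)"
    by (rule card_orbits_involution[OF arcs(1) finite_darts]) (use arcs in auto)
  have "card D = 2 * card (orbits {?s} D)"
    by (rule card_orbits_involution[OF smoothing_permutes finite_darts]) auto
  then have V: "card D = 2 * (card (orbits {?r} D) + 2)" by (simp only: card_orbits_smoothing)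
  have "orbits {?r, \<alpha>} D \<noteq> {}" "finite (orbits {?r, \<alpha>} D)"
    using darts_nonempty finite_darts[of S] by (auto simp: orbits_orb)
  then have "card (orbits {?r, \<alpha>} D) > 0" by (simp add: card_gt_0_iff)
  then have "int (card (orbits {?r, \<alpha>} D)) > 0" by simp
  moreover have "int (card D) = 2 * int (card (orbits {\<alpha>} D))" using E by simp
  moreover have "int (card D) = 2 * int (card (orbits {?r} D)) + 4" using V by simp
  moreover have "int (card (orbits {?r \<circ> \<alpha>} D)) = 2" using F by simp
  ultimately have "genus D ?r \<alpha> > 0" unfolding genus_def by linarith
  then show False using r(2) by simp
qed

text \<open>At each vertex \<open>g m\<close> and \<open>h m\<close> are the two opposite darts of
  colour \<open>c\<close>. The nodes \<open>n\<close> and \<open>Suc n\<close> are the outer and the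
  inner hole.\<close>

definition g :: "nat \<Rightarrow> endpoint dart" where
  "g m = (if m < n then Cross m (if c (Cross m U1) then U1 else O1)
     else if m = n then End (Outer (if c (End (Outer NW)) then NW else NE))
     else End (Inner (if c (End (Inner NW)) then NW else NE)))"

definition h :: "nat \<Rightarrow> endpoint dart" where
  "h m = (if m < n then Cross m (if c (Cross m U1) then U2 else O2)
     else if m = n then End (Outer (if c (End (Outer NW)) then SE else SW))
     else End (Inner (if c (End (Inner NW)) then SE else SW)))"

definition X :: "endpoint dart set" where
  "X = {x \<in> D. c x}"

text \<open>The reference state has A-type splittings at all crossings and belongs to the closure
  \<open>S_11\<close>.\<close>

definition f :: "endpoint dart \<Rightarrow> endpoint dart" where
  "f = on_set X (\<lambda>x. arcs S (smoothing {} 1 1 x))"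

lemma X_image: "X = g ` {..<n + 2} \<union> h ` {..<n + 2}"
proof
  have I: "m \<in> {..<n + 2} \<longleftrightarrow> m < n \<or> m = n \<or> m = Suc n" for m by auto
  have D: "g m \<in> D \<and> h m \<in> D" for m by (auto simp: g_def h_def)
  show "g ` {..<n + 2} \<union> h ` {..<n + 2} \<subseteq> X"
    using D c_cross c_outer c_inner by (auto simp: X_def g_def h_def)
  show "X \<subseteq> g ` {..<n + 2} \<union> h ` {..<n + 2}"
  proof
    fix x assume x: "x \<in> X"
    have "\<exists>m\<in>{..<n + 2}. x = g m \<or> x = h m"
    proof (cases x)
      case (Cross m e)
      then have "m < n" "c x" using x by (auto simp: X_def)
      then show ?thesis using Cross c_cross[of m]
        by (intro bexI[of _ m]) (cases e; auto simp: g_def h_def)+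
    next
      case (End p)
      have cx: "c x" using x by (simp add: X_def)
      show ?thesis
      proof (cases p)
        case (Outer q)
        then show ?thesis using End cx c_outer
          by (intro bexI[of _ n]) (cases q; auto simp: g_def h_def)+
      next
        case (Inner q)
        then show ?thesis using End cx c_inner
          by (intro bexI[of _ "Suc n"]) (cases q; auto simp: g_def h_def)+
      qed
    qed
    then show "x \<in> g ` {..<n + 2} \<union> h ` {..<n + 2}" by blast
  qed
qed

lemma smoothing_arcs_X:
  assumes "x \<in> X"
  shows "arcs S (smoothing W j k x) \<in> X"
  using assms c_smoothing[of x W j k] c_arcs[of "smoothing W j k x"] arcs(2)[of "smoothing W j k x"]
  by (auto simp: X_def)

lemma f_permutes: "f permutes X"
  unfolding f_def
proof (rule on_set_permutes)
  show "finite X" using finite_darts by (simp add: X_def)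
  show "inj_on (\<lambda>x. arcs S (smoothing {} 1 1 x)) X"
  proof (rule inj_onI)
    fix x y assume xy: "x \<in> X" "y \<in> X" "arcs S (smoothing {} 1 1 x) = arcs S (smoothing {} 1 1 y)"
    have "arcs S (arcs S (smoothing {} 1 1 z)) = smoothing {} 1 1 z" if "z \<in> X" for z
      by (rule arcs(3)) (use that in \<open>simp add: X_def\<close>)
    from this[OF xy(1)] this[OF xy(2)] have "smoothing {} 1 1 x = smoothing {} 1 1 y"
      unfolding xy(3) by (rule trans[OF sym])
    then show "x = y" by (metis smoothing_involution)
  qed
qed (rule smoothing_arcs_X)

sublocale nodes: node_system X f "{..<n + 2}" "{..<n}" n "Suc n" g h
proof
  show "{..<n + 2} = insert n (insert (Suc n) {..<n})" by auto
  show "inj_on g {..<n + 2}" "inj_on h {..<n + 2}"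
    by (auto simp: inj_on_def g_def h_def split: if_splits)
  show "g ` {..<n + 2} \<inter> h ` {..<n + 2} = {}"
    by (auto simp: g_def h_def split: if_splits)
  show "X = g ` {..<n + 2} \<union> h ` {..<n + 2}" by (rule X_image)
qed (auto intro: f_permutes)

text \<open>Both splittings of a crossing join its coloured ends to the same two uncoloured ends, in
  opposite order, and so do both fillings of a hole. Exchanging the coloured ends thus turns one
  into the other.\<close>

lemma strand_smoothing:
  assumes W: "W \<subseteq> {..<n}" and E: "E \<subseteq> {n, Suc n}" and x: "x \<in> X"
  shows "nodes.strand (W \<union> E) x = arcs S (smoothing W (if n \<in> E then 2 else 1) (if Suc n \<in> E then 2 else 1) x)"
proof -
  have WE: "W \<union> E \<subseteq> {..<n + 2}" using W E by auto
  have mem: "m \<in> W \<union> E \<longleftrightarrow> (if m < n then m \<in> W else m \<in> E)" for m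
    using W E by auto
  from x show ?thesis
  proof (cases rule: nodes.X_cases)
    case (1 m)
    then have X: "g m \<in> X" "h m \<in> X" by simp_all
    consider "m < n" | "m = n" | "m = Suc n" using 1 by force
    then show ?thesis
      unfolding 1(2) nodes.strand_g[OF WE 1(1)] using X mem[of m]
      by cases (auto simp: f_def g_def h_def)
  next
    case (2 m)
    then have X: "g m \<in> X" "h m \<in> X" by simp_all
    consider "m < n" | "m = n" | "m = Suc n" using 2 by force
    then show ?thesis
      unfolding 2(2) nodes.strand_h[OF WE 2(1)] using X mem[of m]
      by cases (auto simp: f_def g_def h_def)
  qed
qed

lemma cyclic_smoothing:
  assumes W: "W \<subseteq> {..<n}" and E: "E \<subseteq> {n, Suc n}"
  shows "nodes.cyclic (W \<union> E) =
    (if card (orbits {\<alpha>, on_set D (smoothing W (if n \<in> E then 2 else 1) (if Suc n \<in> E then 2 else 1))} D) = 1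
     then 1 else 0)"
proof -
  let ?s = "smoothing W (if n \<in> E then 2 else 1) (if Suc n \<in> E then 2 else 1)"
  have WE: "W \<union> E \<subseteq> {..<n + 2}" using W E by auto
  have "card (orbits {\<alpha>, on_set D ?s} D) = 1 \<longleftrightarrow> card (orbits {nodes.strand (W \<union> E)} {x \<in> D. c x}) = 1"
  proof (rule card_orbits_alternating[OF arcs(1) smoothing_permutes finite_darts])
    show "nodes.strand (W \<union> E) permutes {x \<in> D. c x}"
      using nodes.strand_permutes[OF WE] by (simp add: X_def)
    show "nodes.strand (W \<union> E) x = \<alpha> (on_set D ?s x)" if "x \<in> D" "c x" for x
      using strand_smoothing[OF W E, of x] that by (simp add: X_def)
  qed (use arcs c_arcs c_smoothing in auto)
  then show ?thesis unfolding X_def[symmetric] nodes.cyclic_def by simp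
qed

text \<open>The darts at the boundary always produce at least one circle, so a loop rules out states
  with exactly one.\<close>

lemma circles_closure:
  assumes W: "W = {m. m < n \<and> \<sigma> m = B_type}"
  shows "circles (closure_diagram S j k) \<sigma> = 1 \<longleftrightarrow>
    loops S = 0 \<and> card (orbits {\<alpha>, on_set D (smoothing W j k)} D) = 1"
proof -
  let ?L = "closure_diagram S j k"
  have D: "darts ?L = D" by (simp add: darts_def closure_diagram_def)
  have r: "reconnect ?L \<sigma> x = smoothing W j k x" if "x \<in> D" for x
  proof (cases x)
    case (Cross m e)
    then have "(if m \<in> W then B_type else A_type) = \<sigma> m"
      using that W by (cases "\<sigma> m") auto
    then show ?thesis using Cross by simp
  qed (simp add: closure_diagram_def)
  have "orbits {arcs S, reconnect ?L \<sigma>} D = orbits {\<alpha>, on_set D (smoothing W j k)} D"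
    by (rule orbits_cong) (use r arcs in auto)
  moreover have "card (orbits {\<alpha>, on_set D (smoothing W j k)} D) \<noteq> 0"
    using darts_nonempty finite_darts[of S] by (auto simp: orbits_orb)
  ultimately show ?thesis
    unfolding circles_def D by (auto simp: closure_diagram_def)
qed

section \<open>Brackets as closure sums\<close>

definition A :: complex where
  "A = exp (\<i> * of_real pi / 4)"

lemma A_nonzero: "A \<noteq> 0"
  by (simp add: A_def)

lemma A_power2: "A ^ 2 = \<i>"
proof -
  have "A ^ 2 = exp (\<i> * of_real pi / 2)"
    unfolding A_def by (simp add: exp_of_nat_mult[symmetric])
  also have "\<dots> = cis (pi / 2)" by (simp add: cis_conv_exp)
  finally show ?thesis by (simp add: cis_pi_half)
qed

lemma A_power8: "A ^ 8 = 1"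
proof -
  have "A ^ 8 = (A ^ 2) ^ 4" by (simp flip: power_mult)
  then show ?thesis by (simp add: A_power2)
qed

lemma A_weight:
  assumes "w \<le> n"
  shows "A powi (int (n - w) - int w) = A ^ n * (- \<i>) ^ w"
proof -
  have "A powi (int (n - w) - int w) = A ^ (n - w) / A ^ w"
    by (simp add: power_int_diff A_nonzero)
  also have "\<dots> = A ^ n / (A ^ w * A ^ w)"
    using assms A_nonzero by (simp add: power_diff)
  also have "A ^ w * A ^ w = (A ^ 2) ^ w"
    by (simp add: power2_eq_square power_mult_distrib)
  also have "\<dots> = \<i> ^ w" by (simp add: A_power2)
  also have "A ^ n / \<i> ^ w = A ^ n * (- \<i>) ^ w"
    by (simp add: divide_inverse flip: power_inverse)
  finally show ?thesis .
qed

lemma bracket_closure: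
  assumes "E \<subseteq> {n, Suc n}" "j = (if n \<in> E then 2 else 1)" "k = (if Suc n \<in> E then 2 else 1)"
  shows "bracket (closure_diagram S j k)
    = (if loops S = 0 then A ^ n * nodes.closure_sum (- \<i>) E else 0)"
proof -
  let ?L = "closure_diagram S j k"
  define W where "W \<sigma> = {m. m < n \<and> \<sigma> m = B_type}" for \<sigma> :: "nat \<Rightarrow> splitting"
  have L: "crossings ?L = n" by (simp add: closure_diagram_def)
  have st: "states ?L = {..<n} \<rightarrow>\<^sub>E UNIV" by (simp add: states_def L)
  have "finite (UNIV :: splitting set)"
    by (rule finite_subset[of _ "{A_type, B_type}"]) (use splitting.exhaust in blast, simp)
  then have fin: "finite (states ?L)" unfolding st by (intro finite_PiE) auto
  have sp: "splittings ?L \<sigma> B_type = card (W \<sigma>)" "splittings ?L \<sigma> A_type = n - card (W \<sigma>)"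
    "card (W \<sigma>) \<le> n" for \<sigma>
  proof -
    show B: "splittings ?L \<sigma> B_type = card (W \<sigma>)" by (simp add: splittings_def L W_def)
    have "{m. m < n \<and> \<sigma> m = A_type} = {..<n} - W \<sigma>"
    proof (rule Set.set_eqI)
      fix m show "m \<in> {m. m < n \<and> \<sigma> m = A_type} \<longleftrightarrow> m \<in> {..<n} - W \<sigma>"
        by (cases "\<sigma> m") (auto simp: W_def)
    qed
    moreover have "W \<sigma> \<subseteq> {..<n}" by (auto simp: W_def)
    ultimately show "splittings ?L \<sigma> A_type = n - card (W \<sigma>)"
      by (simp add: splittings_def L card_Diff_subset finite_subset)
    show "card (W \<sigma>) \<le> n"
      using card_mono[of "{..<n}" "W \<sigma>"] \<open>W \<sigma> \<subseteq> {..<n}\<close> by simp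
  qed
  have Wn: "W \<sigma> \<subseteq> {..<n}" for \<sigma> by (auto simp: W_def)
  have "bracket ?L = (\<Sum>\<sigma>\<in>states ?L. if circles ?L \<sigma> = 1
      then A powi (int (splittings ?L \<sigma> A_type) - int (splittings ?L \<sigma> B_type)) else 0)"
    unfolding bracket_def A_def using fin by (rule sum.inter_filter)
  also have "\<dots> = (\<Sum>\<sigma>\<in>states ?L. if loops S = 0
      then A ^ n * ((- \<i>) ^ card (W \<sigma>) * of_int (nodes.cyclic (W \<sigma> \<union> E))) else 0)"
  proof (intro sum.cong refl)
    fix \<sigma>
    show "(if circles ?L \<sigma> = 1
      then A powi (int (splittings ?L \<sigma> A_type) - int (splittings ?L \<sigma> B_type)) else 0)
      = (if loops S = 0 then A ^ n * ((- \<i>) ^ card (W \<sigma>) * of_int (nodes.cyclic (W \<sigma> \<union> E))) else 0)"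
      unfolding sp(1,2) A_weight[OF sp(3)] circles_closure[OF W_def]
      unfolding cyclic_smoothing[OF Wn assms(1)] assms(2,3)[symmetric] by simp
  qed
  also have "\<dots> = (if loops S = 0 then A ^ n *
      (\<Sum>\<sigma>\<in>states ?L. (- \<i>) ^ card (W \<sigma>) * of_int (nodes.cyclic (W \<sigma> \<union> E))) else 0)"
    by (simp add: sum_distrib_left)
  also have "(\<Sum>\<sigma>\<in>states ?L. (- \<i>) ^ card (W \<sigma>) * of_int (nodes.cyclic (W \<sigma> \<union> E)))
      = nodes.closure_sum (- \<i>) E"
    unfolding nodes.closure_sum_def
  proof (rule sum.reindex_bij_witness[where j = W
        and i = "\<lambda>W. \<lambda>m\<in>{..<n}. if m \<in> W then B_type else A_type"])
    show "W (\<lambda>m\<in>{..<n}. if m \<in> V then B_type else A_type) = V" if "V \<in> Pow {..<n}" for V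
      using that by (auto simp: W_def split: if_splits)
    show "(\<lambda>m\<in>{..<n}. if m \<in> W \<sigma> then B_type else A_type) = \<sigma>" if "\<sigma> \<in> states ?L" for \<sigma>
    proof
      fix m
      show "(\<lambda>m\<in>{..<n}. if m \<in> W \<sigma> then B_type else A_type) m = \<sigma> m"
        using that by (cases "\<sigma> m") (auto simp: W_def st PiE_def extensional_def)
    qed
  qed (auto simp: W_def st)
  finally show ?thesis .
qed

end

lemma tangle_colouring:
  assumes "spherical_tangle_diagram S"
  obtains c where "coloured_tangle S c"
proof -
  let ?D = "darts S" and ?a = "on_set (darts S) (arcs S)" and ?r = "on_set (darts S) rot"
  note a = tangle_arcs[OF assms]
  have "\<exists>c. \<forall>x\<in>?D. c (?r x) \<noteq> c x \<and> c (?a x) \<noteq> (c x :: bool)"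
    by (rule genus_0_colouring[OF rot_permutes a(1) finite_darts, of vertex_colour])
      (use a vertex_colour_rot genus_tangle[OF assms] in auto)
  then obtain c where "\<forall>x\<in>?D. c (?r x) \<noteq> c x \<and> c (?a x) \<noteq> (c x :: bool)" by blast
  then have "coloured_tangle S c"
    by unfold_locales (use assms in auto)
  then show thesis by (rule that)
qed

no_notation Matrix.vec_index (infixl "$" 100)

section \<open>Parities, integrality and the square\<close>

lemma imaginary_power_parity:
  assumes "even (a + b)"
  shows "\<exists>s. (s = 1 \<or> s = - 1) \<and> (- \<i>) ^ a = (- \<i>) ^ b * of_int s"
proof -
  have sq: "(- \<i>) ^ (2 * k) = of_int ((- 1) ^ k)" for k by (simp add: power_mult)
  have s: "((- 1) ^ k :: int) = 1 \<or> ((- 1) ^ k :: int) = - 1" for k :: nat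
    by (cases "even k") auto
  obtain e a' b' where "a = 2 * a' + e" "b = 2 * b' + e"
  proof (cases "even a")
    case True
    then show ?thesis using assms that[of "a div 2" 0 "b div 2"] by auto
  next
    case False
    then show ?thesis using assms that[of "a div 2" 1 "b div 2"] by (auto elim!: oddE)
  qed
  then have "(- \<i>) ^ a = (- \<i>) ^ b * of_int ((- 1) ^ a' * (- 1) ^ b')"
    by (simp add: power_add sq flip: power_mult_distrib)
  moreover have "((- 1) ^ a' * (- 1) ^ b' :: int) = 1 \<or> ((- 1) ^ a' * (- 1) ^ b' :: int) = - 1"
    using s[of a'] s[of b'] by auto
  ultimately show ?thesis by blast
qed

text \<open>Powers of \<open>- \<i>\<close> with exponents of equal parity differ only in sign, so
  one of them can be taken out of the whole sum.\<close>

lemma imaginary_sum_parity: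
  assumes "\<And>x. x \<in> F \<Longrightarrow> q x \<noteq> 0 \<Longrightarrow> even (w x + e)"
  shows "\<exists>N. (\<Sum>x\<in>F. (- \<i>) ^ w x * of_int (q x)) = (- \<i>) ^ e * of_int N"
proof -
  have "\<exists>s. \<forall>x\<in>F. (- \<i>) ^ w x * of_int (q x) = (- \<i>) ^ e * of_int (s x)"
  proof (rule bchoice, rule ballI)
    fix x assume x: "x \<in> F"
    show "\<exists>s. (- \<i>) ^ w x * of_int (q x) = (- \<i>) ^ e * of_int s"
    proof (cases "q x = 0")
      case True
      then show ?thesis by (intro exI[of _ 0]) simp
    next
      case False
      then obtain s where "(- \<i>) ^ w x = (- \<i>) ^ e * of_int s"
        using imaginary_power_parity[OF assms[OF x]] by blast
      then show ?thesis by (intro exI[of _ "s * q x"]) simp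
    qed
  qed
  then obtain s where "\<forall>x\<in>F. (- \<i>) ^ w x * of_int (q x) = (- \<i>) ^ e * of_int (s x)" by blast
  then have "(\<Sum>x\<in>F. (- \<i>) ^ w x * of_int (q x)) = (- \<i>) ^ e * of_int (\<Sum>x\<in>F. s x)"
    by (simp add: sum_distrib_left)
  then show ?thesis ..
qed

context coloured_tangle
begin

text \<open>The mixed closures exchange one hole, which shifts their parity. The two additional
  factors \<open>- \<i>\<close> multiply to -1 and turn the minus sign of the determinant into the
  plus sign of \<open>p * s + q * r\<close>.\<close>

lemma determinant_square:
  obtains p q r s N :: int and e :: nat
  where "nodes.closure_sum (- \<i>) {} = (- \<i>) ^ e * of_int p"
    and "nodes.closure_sum (- \<i>) {Suc n} = (- \<i>) ^ Suc e * of_int q"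
    and "nodes.closure_sum (- \<i>) {n} = (- \<i>) ^ Suc e * of_int r"
    and "nodes.closure_sum (- \<i>) {n, Suc n} = (- \<i>) ^ e * of_int s"
    and "p * s + q * r = N\<^sup>2"
proof -
  \<comment> \<open>A state that contributes has one cycle; with this \<open>e\<close> the parity
    count makes \<open>card W + card E + e\<close> even for all of them.\<close>
  define e where "e = card (orbits {f} X) + 1"
  have par: "even (card W + (card E + e))"
    if "W \<subseteq> {..<n}" "E \<subseteq> {n, Suc n}" "nodes.cyclic (W \<union> E) \<noteq> 0" for W E
  proof -
    have "finite W" "finite E" using that(1,2) by (auto intro: finite_subset)
    moreover have "x < n" if "x \<in> W" for x using \<open>W \<subseteq> {..<n}\<close> that by auto
    moreover have "x = n \<or> x = Suc n" if "x \<in> E" for x using \<open>E \<subseteq> {n, Suc n}\<close> that by auto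
    ultimately have "W \<inter> E = {}" "W \<union> E \<subseteq> {..<n + 2}" "finite W" "finite E" by fastforce+
    then have "card (W \<union> E) = card W + card E" "odd (card (W \<union> E) + card (orbits {f} X))"
      using card_Un_disjoint nodes.cyclic_parity[OF _ that(3)] by blast+
    then show ?thesis unfolding e_def by presburger
  qed
  have sum: "\<exists>p. nodes.closure_sum (- \<i>) E = (- \<i>) ^ e' * of_int p"
    if E: "E \<subseteq> {n, Suc n}" "even (card E + e + e')" for E e'
    unfolding nodes.closure_sum_def
  proof (rule imaginary_sum_parity)
    fix W assume "W \<in> Pow {..<n}" "nodes.cyclic (W \<union> E) \<noteq> 0"
    then have "even (card W + (card E + e))" using par E(1) by auto
    then show "even (card W + e')" using E(2) by presburger
  qed
  obtain p q r s where T: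
    "nodes.closure_sum (- \<i>) {} = (- \<i>) ^ e * of_int p"
    "nodes.closure_sum (- \<i>) {Suc n} = (- \<i>) ^ Suc e * of_int q"
    "nodes.closure_sum (- \<i>) {n} = (- \<i>) ^ Suc e * of_int r"
    "nodes.closure_sum (- \<i>) {n, Suc n} = (- \<i>) ^ e * of_int s"
    using sum[of "{}" e] sum[of "{Suc n}" "Suc e"] sum[of "{n}" "Suc e"] sum[of "{n, Suc n}" e] by auto
  obtain u u' where u: "\<And>W. W \<subseteq> {..<n} \<Longrightarrow> u W * u' W
      = nodes.cyclic W * nodes.cyclic (W \<union> {n, Suc n}) - nodes.cyclic (W \<union> {Suc n}) * nodes.cyclic (W \<union> {n})"
    "\<And>W. W \<subseteq> {..<n} \<Longrightarrow> u W = 0 \<longleftrightarrow> u' W = 0"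
    "\<And>w. nodes.closure_sum w {} * nodes.closure_sum w {n, Suc n}
        - nodes.closure_sum w {Suc n} * nodes.closure_sum w {n}
      = (\<Sum>W\<in>Pow {..<n}. w ^ card W * of_int (u W)) * (\<Sum>W\<in>Pow {..<n}. w ^ card W * of_int (u' W))"
    by (rule nodes.closure_sums_product) blast
  have c01: "nodes.cyclic W = 0 \<or> nodes.cyclic W = 1" for W unfolding nodes.cyclic_def by auto
  have unit_eq: "a = b \<and> k = 1 \<or> a = - b \<and> k = - 1" if "a * b = k" "k = 1 \<or> k = - 1" for a b k :: int
  proof -
    have "\<bar>a * b\<bar> = 1" using that by auto
    then have "\<bar>a\<bar> = 1" by (rule abs_zmult_eq_1)
    then consider "a = 1" | "a = - 1" by linarith
    then show ?thesis using that by cases auto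
  qed
  \<comment> \<open>If \<open>same_colour\<close> holds, \<open>not_both_connected\<close> leaves
    only the product of the mixed closures. It enters with a minus sign, hence
    \<open>\<epsilon> = -1\<close>, and these closures exchange one hole, hence the exponent
    \<open>e + 1\<close>.\<close>
  define d where "d = (if same_colour then e + 1 else e)"
  define \<epsilon> :: int where "\<epsilon> = (if same_colour then - 1 else 1)"
  have key: "(u W \<noteq> 0 \<longrightarrow> even (card W + d)) \<and> u' W = \<epsilon> * u W" if W: "W \<subseteq> {..<n}" for W
  proof (cases "u W = 0")
    case True
    then show ?thesis using u(2)[OF W] by simp
  next
    case False
    then have nz: "u W * u' W \<noteq> 0" using u(2)[OF W] by simp
    show ?thesis
    proof (cases same_colour)
      case True
      have "nodes.cyclic (W \<union> {}) * nodes.cyclic (W \<union> {n, Suc n}) = 0"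
        using not_both_connected[of W] True cyclic_smoothing[OF W, of "{}"]
          cyclic_smoothing[OF W, of "{n, Suc n}"] by (auto split: if_splits)
      then have k: "u W * u' W = - (nodes.cyclic (W \<union> {Suc n}) * nodes.cyclic (W \<union> {n}))"
        using u(1)[OF W] by simp
      then have c: "nodes.cyclic (W \<union> {Suc n}) = 1" "nodes.cyclic (W \<union> {n}) = 1"
        using nz c01[of "W \<union> {Suc n}"] c01[of "W \<union> {n}"] by auto
      then have "u' W = - u W" using unit_eq[OF k] by auto
      moreover have "even (card W + (card {n} + e))" using par[OF W, of "{n}"] c by simp
      ultimately show ?thesis using True by (simp add: d_def \<epsilon>_def)
    next
      case neq: False
      have "nodes.cyclic (W \<union> {Suc n}) * nodes.cyclic (W \<union> {n}) = 0"
        using not_both_connected[of W] neq cyclic_smoothing[OF W, of "{Suc n}"]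
          cyclic_smoothing[OF W, of "{n}"] by (auto split: if_splits)
      then have k: "u W * u' W = nodes.cyclic W * nodes.cyclic (W \<union> {n, Suc n})"
        using u(1)[OF W] by simp
      then have c: "nodes.cyclic W = 1" "nodes.cyclic (W \<union> {n, Suc n}) = 1"
        using nz c01[of W] c01[of "W \<union> {n, Suc n}"] by auto
      then have "u' W = u W" using unit_eq[OF k] by auto
      moreover have "even (card W + (card ({} :: nat set) + e))" using par[OF W, of "{}"] c by simp
      ultimately show ?thesis using neq by (simp add: d_def \<epsilon>_def)
    qed
  qed
  obtain N where N: "(\<Sum>W\<in>Pow {..<n}. (- \<i>) ^ card W * of_int (u W)) = (- \<i>) ^ d * of_int N"
    using imaginary_sum_parity[of "Pow {..<n}" u card d] key by blast
  have "(\<Sum>W\<in>Pow {..<n}. (- \<i>) ^ card W * of_int (u' W))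
      = (\<Sum>W\<in>Pow {..<n}. of_int \<epsilon> * ((- \<i>) ^ card W * of_int (u W)))"
    by (intro sum.cong refl) (use key in auto)
  then have N': "(\<Sum>W\<in>Pow {..<n}. (- \<i>) ^ card W * of_int (u' W)) = of_int \<epsilon> * ((- \<i>) ^ d * of_int N)"
    unfolding sum_distrib_left[symmetric] N .
  have "\<i> * z * (\<i> * z) = - (z * z)" for z
    by (simp add: mult.assoc mult.left_commute[of z])
  \<comment> \<open>If \<open>d = e + 1\<close>, the additional \<open>(- \<i>) ^ 2 = -1\<close>
    cancels \<open>\<epsilon> = -1\<close>.\<close>
  then have "(- \<i>) ^ d * (- \<i>) ^ d * of_int \<epsilon> = (- \<i>) ^ e * (- \<i>) ^ e"
    by (simp add: d_def \<epsilon>_def)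
  then have "(- \<i>) ^ e * (- \<i>) ^ e * of_int (p * s + q * r) = (- \<i>) ^ e * (- \<i>) ^ e * of_int (N\<^sup>2)"
    using u(3)[of "- \<i>"] unfolding T N N' by (simp add: algebra_simps power2_eq_square)
  then have "complex_of_int (p * s + q * r) = of_int (N\<^sup>2)" by simp
  then have "p * s + q * r = N\<^sup>2" by (simp only: of_int_eq_iff)
  with T show thesis by (rule that)
qed

lemma det_F_square: "\<exists>N :: int. det_F S = N\<^sup>2"
proof -
  obtain p q r s N :: int and e :: nat where T:
    "nodes.closure_sum (- \<i>) {} = (- \<i>) ^ e * of_int p"
    "nodes.closure_sum (- \<i>) {Suc n} = (- \<i>) ^ Suc e * of_int q"
    "nodes.closure_sum (- \<i>) {n} = (- \<i>) ^ Suc e * of_int r"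
    "nodes.closure_sum (- \<i>) {n, Suc n} = (- \<i>) ^ e * of_int s"
    and N: "p * s + q * r = N\<^sup>2"
    by (rule determinant_square)
  \<comment> \<open>A loop makes all four brackets vanish; the factor \<open>l\<close> covers this
    case.\<close>
  define l :: int where "l = (if loops S = 0 then 1 else 0)"
  \<comment> \<open>The common factor of the four brackets is an eighth root of 1, so its inverse is
    an admissible \<open>z\<close> that yields integers.\<close>
  define \<zeta> where "\<zeta> = A ^ n * (- \<i>) ^ e"
  define M :: "int^2^2" where "M = vector [vector [l * p, - (l * q)], vector [l * r, l * s]]"
  have z8: "\<zeta> ^ 8 = 1"
  proof -
    have "\<zeta> ^ 8 = (A ^ 8) ^ n * ((- \<i>) ^ 8) ^ e"
      by (simp add: \<zeta>_def power_mult_distrib mult.commute flip: power_mult)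
    also have "(- \<i>) ^ 8 = 1" by (simp add: power_mult[of _ 2 4, simplified])
    finally show ?thesis by (simp add: A_power8)
  qed
  then have z0: "\<zeta> \<noteq> 0" by auto
  have "bracket (closure_diagram S 1 1) = \<zeta> * of_int (l * p)"
    "bracket (closure_diagram S 1 2) = \<zeta> * (- \<i>) * of_int (l * q)"
    "bracket (closure_diagram S 2 1) = \<zeta> * (- \<i>) * of_int (l * r)"
    "bracket (closure_diagram S 2 2) = \<zeta> * of_int (l * s)"
    using bracket_closure[of "{}" 1 1] bracket_closure[of "{Suc n}" 1 2] bracket_closure[of "{n}" 2 1]
      bracket_closure[of "{n, Suc n}" 2 2] unfolding T by (simp_all add: \<zeta>_def l_def)
  moreover have "- \<i> * (\<zeta> * (- \<i>) * x) = - (\<zeta> * x)" "\<i> * (\<zeta> * (- \<i>) * x) = \<zeta> * x" for x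
    by (simp_all add: mult.left_commute[of _ \<zeta>] mult.assoc)
  ultimately have B: "bracket_matrix S $ i $ j = \<zeta> * of_int (M $ i $ j)" for i j
    using exhaust_2[of i] exhaust_2[of j] by (auto simp: bracket_matrix_def M_def simp del: of_int_mult)
  have detM: "Determinants.det M = l\<^sup>2 * N\<^sup>2"
    unfolding N[symmetric] by (simp add: det_2 M_def power2_eq_square algebra_simps)
  have mem: "M \<in> invariant_F S"
    unfolding invariant_F_def by (rule CollectI, rule exI[of _ "inverse \<zeta>"])
      (use z8 z0 in \<open>simp add: B power_inverse\<close>)
  have uniq: "Determinants.det M' = Determinants.det M" if "M' \<in> invariant_F S" for M'
  proof -
    obtain z where z: "z ^ 8 = 1" "\<And>i j. of_int (M' $ i $ j) = z * (\<zeta> * of_int (M $ i $ j))"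
      using \<open>M' \<in> invariant_F S\<close> B unfolding invariant_F_def by auto
    define y where "y = z * \<zeta>"
    have y: "of_int (M' $ i $ j) = y * of_int (M $ i $ j)" for i j
      using z(2) by (simp add: y_def)
    have y8: "y ^ 8 = 1" using z(1) z8 by (simp add: y_def power_mult_distrib)
    \<comment> \<open>A nonzero entry of \<open>M\<close> makes \<open>y\<close> a quotient of
      integers. The only real eighth roots of 1 are 1 and -1, and a determinant of size 2 changes by
      the factor \<open>y ^ 2 = 1\<close>.\<close>
    show ?thesis
    proof (cases "\<forall>i j. M $ i $ j = 0")
      case True
      then have "M' $ i $ j = 0" for i j using y[of i j] by simp
      then show ?thesis using True by (simp add: det_2)
    next
      case False
      then obtain i j where m: "M $ i $ j \<noteq> 0" by blast
      then have "y = of_real (of_int (M' $ i $ j) / of_int (M $ i $ j))"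
        using y[of i j] by (simp add: field_simps)
      then obtain x where x: "y = of_real x" by blast
      then have "complex_of_real (x ^ 8) = of_real 1" using y8 by simp
      then have "(x ^ 2) ^ 4 = 1" by (simp only: of_real_eq_iff) (simp flip: power_mult)
      then have "x ^ 2 = 1" using power_eq_1_iff[of "x ^ 2" 4] by auto
      then have "y ^ 2 = 1" using x by (simp flip: of_real_power)
      moreover have "complex_of_int (Determinants.det M') = y ^ 2 * of_int (Determinants.det M)"
        by (simp add: det_2 y power2_eq_square algebra_simps)
      ultimately have "complex_of_int (Determinants.det M') = of_int (Determinants.det M)" by simp
      then show ?thesis by (simp only: of_int_eq_iff)
    qed
  qed
  have "det_F S = Determinants.det M"
    unfolding det_F_def
  proof (rule the_equality)
    fix d assume "\<exists>M'\<in>invariant_F S. d = Determinants.det M'"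
    then obtain M' where M': "M' \<in> invariant_F S" "d = Determinants.det M'" by (elim bexE)
    show "d = Determinants.det M" using M'(2) uniq[OF M'(1)] by (rule trans)
  qed (rule bexI[OF refl mem])
  also have "\<dots> = (l * N)\<^sup>2" using detM by (simp add: power_mult_distrib)
  finally show ?thesis by blast
qed

end

theorem theorem4p34:
  fixes S :: tangle
  assumes "spherical_tangle_diagram S"
  shows "[det_F S = 0] (mod 4) \<or> [det_F S = 1] (mod 4)"
proof -
  obtain c where "coloured_tangle S c" by (rule tangle_colouring[OF assms])
  then obtain N where N: "det_F S = N\<^sup>2"
    using coloured_tangle.det_F_square by blast
  show ?thesis
  proof (cases "even N")
    case True
    then obtain k where "N = 2 * k" by blast
    then have "det_F S = 4 * k\<^sup>2" using N by (simp add: power_mult_distrib)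
    then show ?thesis by (simp add: cong_def)
  next
    case False
    then obtain k where "N = 2 * k + 1" by (rule oddE)
    then have "det_F S = 1 + 4 * (k\<^sup>2 + k)" using N by (simp add: power2_eq_square algebra_simps)
    moreover have "(1 + 4 * m) mod 4 = 1" for m :: int by presburger
    ultimately show ?thesis by (simp only: cong_def) simp
  qed
qed

end
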